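(* Let $(M,g,\lambda)$ be a magnetic system with $\kappa_0\leq0$. We have $\kappa_0=0$ (identically on $SM$) if and only if $G_s^*=G_u^*$ everywhere on $SM$.
   Context: A thermostat $(M,g,\lambda)$ consists of a closed oriented Riemannian surface $(M,g)$ and a function $\lambda\in\mathcal{C}^\infty(SM,\mathbb{R})$, where $\pi:SM\to M$ is the unit tangent bundle. Let $X$ be the geodesic vector field on $SM$, $V$ the vertical vector field (generator of the rotations of the fibers), and $H:=[V,X]$. The thermostat flow $\varphi_t$ on $SM$ is the flow of $F:=X+\lambda V$; its orbits are $(\gamma,\dot\gamma)$ with $\nabla_{\dot\gamma}\dot\gamma=\lambda(\gamma,\dot\gamma)J\dot\gamma$, where $\nabla$ is the Levi-Civita connection and $J$ is rotation by $\pi/2$. A magnetic system is a thermostat with $V\lambda=0$, i.e. $\lambda$ depends only on position. $\kappa_0:=\pi^*K_g-H\lambda+\lambda^2$, where $K_g$ is the Gaussian curvature. The exponential map is $\exp^\lambda_x(tv):=\pi(\varphi_t(x,v))$ for $x\in M$, $t\ge 0$, $v\in S_xM$; the thermostat has no conjugate points if $\exp_x^\lambda:T_xM\to M$ is a local diffeomorphism for all $x\in M$. (If $\kappa_0\le0$, there are no conjugate points, so the Green bundles below are defined.) Let $(\alpha,\beta,\psi)$ be the coframe of $T^*(SM)$ dual to $(X,H,V)$, $\mathbb{H}^*:=\mathbb{R}\beta$, and $\Sigma(v):=\{\xi\in T_v^*(SM):\xi(F(v))=0\}$. The map $d_v\varphi_t^{-\top}$ sends $\xi\in T_v^*(SM)$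 to $\xi\circ(d_v\varphi_t)^{-1}$. For a thermostat without conjugate points the Green bundles are the lines $$G_s^*(v):=\lim_{t\to\infty}d\varphi_{-t}^{-\top}(\mathbb{H}^*(\varphi_t(v))),\qquad G_u^*(v):=\lim_{t\to\infty}d\varphi_t^{-\top}(\mathbb{H}^*(\varphi_{-t}(v)))$$ in $\Sigma(v)$; these limits exist for every $v\in SM$, are flow-invariant, and are transverse to $\mathbb{H}^*$. *)

theory Defs
  imports "HOL-Analysis.Analysis"
begin

section \<open>Smooth functions and manifolds\<close>

fun Ck_on :: "nat \<Rightarrow> 'a::euclidean_space set \<Rightarrow> ('a \<Rightarrow> 'b::real_normed_vector) \<Rightarrow> bool" where
  "Ck_on 0 S f = continuous_on S f"
| "Ck_on (Suc k) S f =
     ((\<forall>x\<in>S. f differentiable (at x)) \<and> (\<forall>v. Ck_on k S (\<lambda>x. frechet_derivative f (at x) v)))"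

text \<open>Only used for open sets.\<close>

definition smooth_on :: "'a::euclidean_space set \<Rightarrow> ('a \<Rightarrow> 'b::real_normed_vector) \<Rightarrow> bool" where
  "smooth_on S f \<longleftrightarrow> (\<forall>k. Ck_on k S f)"

text \<open>
  A manifold is given by an atlas of injective local parametrizations \<open>(U, \<sigma>)\<close>, i.e. by the
  inverses of its charts, with \<open>U\<close> open in a Euclidean space; its set of points is the union of
  the images, and its topology is the one induced by the parametrizations.
\<close>

type_synonym ('m, 'e) param = "'e set \<times> ('e \<Rightarrow> 'm)"
type_synonym ('m, 'e) atlas = "('m, 'e) param set"

definition points :: "('m, 'e) atlas \<Rightarrow> 'm set" where
  "points A = (\<Union>(U, \<sigma>)\<in>A. \<sigma> ` U)"

definition atlas_topology :: "('m, 'e::euclidean_space) atlas \<Rightarrow> 'm topology" where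
  "atlas_topology A = topology (\<lambda>S. S \<subseteq> points A \<and> (\<forall>(U, \<sigma>)\<in>A. open {x \<in> U. \<sigma> x \<in> S}))"

lemma openin_atlas_topology:
  "openin (atlas_topology A) S \<longleftrightarrow> S \<subseteq> points A \<and> (\<forall>(U, \<sigma>)\<in>A. open {x \<in> U. \<sigma> x \<in> S})"
proof -
  let ?P = "\<lambda>S. S \<subseteq> points A \<and> (\<forall>(U, \<sigma>)\<in>A. open {x \<in> U. \<sigma> x \<in> S})"
  have "istopology ?P"
    unfolding istopology_def
  proof (intro conjI allI impI)
    fix S T assume S: "?P S" and T: "?P T"
    show "S \<inter> T \<subseteq> points A" using S by blast
    show "\<forall>(U, \<sigma>)\<in>A. open {x \<in> U. \<sigma> x \<in> S \<inter> T}"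
    proof clarify
      fix U \<sigma> assume "(U, \<sigma>) \<in> A"
      then have "open ({x \<in> U. \<sigma> x \<in> S} \<inter> {x \<in> U. \<sigma> x \<in> T})" using S T by blast
      moreover have "{x \<in> U. \<sigma> x \<in> S} \<inter> {x \<in> U. \<sigma> x \<in> T} = {x \<in> U. \<sigma> x \<in> S \<inter> T}" by blast
      ultimately show "open {x \<in> U. \<sigma> x \<in> S \<inter> T}" by simp
    qed
  next
    fix K assume K: "\<forall>S\<in>K. ?P S"
    show "\<Union>K \<subseteq> points A" using K by blast
    show "\<forall>(U, \<sigma>)\<in>A. open {x \<in> U. \<sigma> x \<in> \<Union>K}"
    proof clarify
      fix U \<sigma> assume "(U, \<sigma>) \<in> A"
      then have "open (\<Union>S\<in>K. {x \<in> U. \<sigma> x \<in> S})" using K by blast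
      moreover have "(\<Union>S\<in>K. {x \<in> U. \<sigma> x \<in> S}) = {x \<in> U. \<sigma> x \<in> \<Union>K}" by blast
      ultimately show "open {x \<in> U. \<sigma> x \<in> \<Union>K}" by simp
    qed
  qed
  then show ?thesis
    unfolding atlas_topology_def by (simp only: topology_inverse')
qed

definition smooth_map ::
    "('m, 'e::euclidean_space) atlas \<Rightarrow> ('n, 'd::euclidean_space) atlas \<Rightarrow> ('m \<Rightarrow> 'n) \<Rightarrow> bool" where
  "smooth_map A B f \<longleftrightarrow> f ` points A \<subseteq> points B \<and>
     (\<forall>(U, \<sigma>)\<in>A. \<forall>(W, \<tau>)\<in>B.
        open {x \<in> U. f (\<sigma> x) \<in> \<tau> ` W} \<and>
        smooth_on {x \<in> U. f (\<sigma> x) \<in> \<tau> ` W} (\<lambda>x. inv_into W \<tau> (f (\<sigma> x))))"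

text \<open>Smoothness of the identity map expresses smoothness of all transition maps.\<close>

definition smooth_atlas :: "('m, 'e::euclidean_space) atlas \<Rightarrow> bool" where
  "smooth_atlas A \<longleftrightarrow> (\<forall>(U, \<sigma>)\<in>A. open U \<and> inj_on \<sigma> U) \<and> smooth_map A A (\<lambda>p. p)"

definition smooth_fun :: "('m, 'e::euclidean_space) atlas \<Rightarrow> ('m \<Rightarrow> real) \<Rightarrow> bool" where
  "smooth_fun A f \<longleftrightarrow> (\<forall>(U, \<sigma>)\<in>A. smooth_on U (f \<circ> \<sigma>))"

definition smooth_near :: "('m, 'e::euclidean_space) atlas \<Rightarrow> ('m \<Rightarrow> real) \<Rightarrow> 'm \<Rightarrow> bool" where
  "smooth_near A f p \<longleftrightarrow>
     (\<exists>(U, \<sigma>)\<in>A. \<exists>N. open N \<and> N \<subseteq> U \<and> p \<in> \<sigma> ` N \<and> smooth_on N (f \<circ> \<sigma>))"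

definition interval_atlas :: "real \<Rightarrow> (real, real) atlas" where
  "interval_atlas \<epsilon> = {({-\<epsilon><..<\<epsilon>}, (\<lambda>t. t))}"

definition time_product :: "('m, 'e::euclidean_space) atlas \<Rightarrow> (real \<times> 'm, real \<times> 'e) atlas" where
  "time_product A = {(UNIV \<times> U, (\<lambda>(t, x). (t, \<sigma> x))) | U \<sigma>. (U, \<sigma>) \<in> A}"

section \<open>Tangent and cotangent vectors\<close>

text \<open>
  The velocity of a curve is the operator \<open>f \<mapsto> (f \<circ> c)'\<close> on the functions \<open>f\<close> that are smooth near
  the base point. Tangent vectors are such operators; they are extended by 0 to the other
  functions, so that equality of tangent vectors is equality of HOL functions.
\<close>

type_synonym 'm tvec = "('m \<Rightarrow> real) \<Rightarrow> real"
type_synonym 'm covec = "'m tvec \<Rightarrow> real"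

definition velocity :: "('m, 'e::euclidean_space) atlas \<Rightarrow> (real \<Rightarrow> 'm) \<Rightarrow> real \<Rightarrow> 'm tvec" where
  "velocity A c t = (\<lambda>f. if smooth_near A f (c t) then deriv (\<lambda>s. f (c s)) t else 0)"

definition tangent_space :: "('m, 'e::euclidean_space) atlas \<Rightarrow> 'm \<Rightarrow> 'm tvec set" where
  "tangent_space A p =
     {velocity A c 0 | c. \<exists>\<epsilon>>0. smooth_map (interval_atlas \<epsilon>) A c \<and> c 0 = p}"

definition cotangent_space :: "('m, 'e::euclidean_space) atlas \<Rightarrow> 'm \<Rightarrow> 'm covec set" where
  "cotangent_space A p =
     {\<xi>. (\<forall>v\<in>tangent_space A p. \<forall>w\<in>tangent_space A p. \<forall>a b.
            \<xi> (\<lambda>f. a * v f + b * w f) = a * \<xi> v + b * \<xi> w) \<and>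
         (\<forall>v. v \<notin> tangent_space A p \<longrightarrow> \<xi> v = 0)}"

definition differential ::
    "('m, 'e::euclidean_space) atlas \<Rightarrow> ('n, 'd::euclidean_space) atlas \<Rightarrow> ('m \<Rightarrow> 'n) \<Rightarrow> 'm
      \<Rightarrow> 'm tvec \<Rightarrow> 'n tvec" where
  "differential A B h p v = (\<lambda>f. if smooth_near B f (h p) then v (f \<circ> h) else 0)"

text \<open>The map \<open>\<xi> \<mapsto> \<xi> \<circ> (d\<^sub>p h)\<^sup>-\<^sup>1\<close> from the cotangent space at \<open>p\<close> to the one at \<open>h p\<close>.\<close>

definition inverse_transpose ::
    "('m, 'e::euclidean_space) atlas \<Rightarrow> ('m \<Rightarrow> 'm) \<Rightarrow> 'm \<Rightarrow> 'm covec \<Rightarrow> 'm covec" where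
  "inverse_transpose A h p \<xi> = (\<lambda>w. if w \<in> tangent_space A (h p)
     then \<xi> (inv_into (tangent_space A p) (differential A A h p) w) else 0)"

definition lie_bracket ::
    "('m, 'e::euclidean_space) atlas \<Rightarrow> ('m \<Rightarrow> 'm tvec) \<Rightarrow> ('m \<Rightarrow> 'm tvec) \<Rightarrow> 'm \<Rightarrow> 'm tvec" where
  "lie_bracket A Y Z p =
     (\<lambda>f. if smooth_near A f p then Y p (\<lambda>q. Z q f) - Z p (\<lambda>q. Y q f) else 0)"

definition is_flow ::
    "('m, 'e::euclidean_space) atlas \<Rightarrow> ('m \<Rightarrow> 'm tvec) \<Rightarrow> (real \<Rightarrow> 'm \<Rightarrow> 'm) \<Rightarrow> bool" where
  "is_flow A Y \<phi> \<longleftrightarrow>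
     smooth_map (time_product A) A (\<lambda>(t, p). \<phi> t p) \<and>
     (\<forall>p\<in>points A. \<phi> 0 p = p) \<and>
     (\<forall>s t. \<forall>p\<in>points A. \<phi> (s + t) p = \<phi> s (\<phi> t p)) \<and>
     (\<forall>p\<in>points A. velocity A (\<lambda>t. \<phi> t p) 0 = Y p)"

definition line_of :: "'m covec \<Rightarrow> 'm covec set" where
  "line_of \<xi> = range (\<lambda>c w. c * \<xi> w)"

text \<open>
  Convergence of lines in projective space: suitable spanning vectors converge to a nonzero limit.
  On a finite-dimensional cotangent space the topology is that of pointwise convergence.
\<close>

definition lines_tendsto ::
    "('t \<Rightarrow> 'm covec set) \<Rightarrow> 'm covec set \<Rightarrow> 't filter \<Rightarrow> bool" where
  "lines_tendsto L l F \<longleftrightarrow> (\<exists>\<xi> \<xi>\<^sub>0. (\<forall>\<^sub>F t in F. L t = line_of (\<xi> t)) \<and>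
     (\<forall>w. ((\<lambda>t. \<xi> t w) \<longlongrightarrow> \<xi>\<^sub>0 w) F) \<and> \<xi>\<^sub>0 \<noteq> (\<lambda>w. 0) \<and> l = line_of \<xi>\<^sub>0)"

section \<open>Closed oriented Riemannian surfaces\<close>

type_synonym 'm surface = "('m, real^2) atlas"
type_synonym 'm metric = "'m \<Rightarrow> 'm tvec \<Rightarrow> 'm tvec \<Rightarrow> real"

definition oriented_atlas :: "'m surface \<Rightarrow> bool" where
  "oriented_atlas A \<longleftrightarrow> (\<forall>(U, \<sigma>)\<in>A. \<forall>(W, \<tau>)\<in>A. \<forall>x\<in>U. \<sigma> x \<in> \<tau> ` W \<longrightarrow>
     det (matrix (frechet_derivative (\<lambda>y. inv_into W \<tau> (\<sigma> y)) (at x))) > 0)"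

text \<open>Second countability follows from compactness.\<close>

definition closed_oriented_surface :: "'m surface \<Rightarrow> bool" where
  "closed_oriented_surface A \<longleftrightarrow> smooth_atlas A \<and> oriented_atlas A \<and>
     Hausdorff_space (atlas_topology A) \<and> compact_space (atlas_topology A)"

text \<open>The coordinate function \<open>x\<^sup>k\<close> on \<open>M\<close>; the components of a tangent vector \<open>v\<close> are the
  numbers \<open>v (x\<^sup>k)\<close>.\<close>

definition coord :: "('m, real^2) param \<Rightarrow> 2 \<Rightarrow> 'm \<Rightarrow> real" where
  "coord c k = (\<lambda>q. inv_into (fst c) (snd c) q $ k)"

definition coord_vec :: "'m surface \<Rightarrow> ('m, real^2) param \<Rightarrow> real^2 \<Rightarrow> 2 \<Rightarrow> 'm tvec" where
  "coord_vec A c x i = velocity A (\<lambda>t. snd c (x + t *\<^sub>R axis i 1)) 0"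

definition metric_coeff ::
    "'m surface \<Rightarrow> 'm metric \<Rightarrow> ('m, real^2) param \<Rightarrow> 2 \<Rightarrow> 2 \<Rightarrow> real^2 \<Rightarrow> real" where
  "metric_coeff A g c i j x = g (snd c x) (coord_vec A c x i) (coord_vec A c x j)"

definition riemannian_metric :: "'m surface \<Rightarrow> 'm metric \<Rightarrow> bool" where
  "riemannian_metric A g \<longleftrightarrow>
     (\<forall>p\<in>points A. \<forall>u\<in>tangent_space A p. \<forall>v\<in>tangent_space A p.
        g p u v = g p v u \<and>
        (u \<noteq> (\<lambda>f. 0) \<longrightarrow> g p u u > 0) \<and>
        (\<forall>w\<in>tangent_space A p. \<forall>a b.
           g p (\<lambda>f. a * u f + b * v f) w = a * g p u w + b * g p v w)) \<and>
     (\<forall>c\<in>A. \<forall>i j. smooth_on (fst c) (metric_coeff A g c i j))"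

definition partial :: "2 \<Rightarrow> (real^2 \<Rightarrow> real) \<Rightarrow> real^2 \<Rightarrow> real" where
  "partial i f x = frechet_derivative f (at x) (axis i 1)"

definition inv_metric_coeff ::
    "'m surface \<Rightarrow> 'm metric \<Rightarrow> ('m, real^2) param \<Rightarrow> 2 \<Rightarrow> 2 \<Rightarrow> real^2 \<Rightarrow> real" where
  "inv_metric_coeff A g c i j x = matrix_inv (\<chi> k l. metric_coeff A g c k l x) $ i $ j"

text \<open>\<open>christoffel A g c k i j\<close> is \<open>\<Gamma>\<^sup>k\<^sub>i\<^sub>j\<close> for the Levi-Civita connection.\<close>

definition christoffel ::
    "'m surface \<Rightarrow> 'm metric \<Rightarrow> ('m, real^2) param \<Rightarrow> 2 \<Rightarrow> 2 \<Rightarrow> 2 \<Rightarrow> real^2 \<Rightarrow> real" where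
  "christoffel A g c k i j x = (1/2) * (\<Sum>l\<in>UNIV. inv_metric_coeff A g c k l x *
     (partial i (metric_coeff A g c j l) x + partial j (metric_coeff A g c i l) x
        - partial l (metric_coeff A g c i j) x))"

text \<open>\<open>riemann A g c l k i j\<close> is the \<open>l\<close>-th component of
  \<open>R(\<partial>\<^sub>i,\<partial>\<^sub>j)\<partial>\<^sub>k = \<nabla>\<^sub>i\<nabla>\<^sub>j\<partial>\<^sub>k - \<nabla>\<^sub>j\<nabla>\<^sub>i\<partial>\<^sub>k\<close>.\<close>

definition riemann ::
    "'m surface \<Rightarrow> 'm metric \<Rightarrow> ('m, real^2) param \<Rightarrow> 2 \<Rightarrow> 2 \<Rightarrow> 2 \<Rightarrow> 2 \<Rightarrow> real^2 \<Rightarrow> real" where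
  "riemann A g c l k i j x =
     partial i (christoffel A g c l j k) x - partial j (christoffel A g c l i k) x
     + (\<Sum>m\<in>UNIV. christoffel A g c l i m x * christoffel A g c m j k x
                 - christoffel A g c l j m x * christoffel A g c m i k x)"

text \<open>\<open>K = g(R(\<partial>\<^sub>1,\<partial>\<^sub>2)\<partial>\<^sub>2, \<partial>\<^sub>1) / det g\<close> in every local parametrization.\<close>

definition gauss_curvature :: "'m surface \<Rightarrow> 'm metric \<Rightarrow> 'm \<Rightarrow> real" where
  "gauss_curvature A g p = (THE K. \<forall>c\<in>A. \<forall>x\<in>fst c. snd c x = p \<longrightarrow>
     K = (\<Sum>l\<in>UNIV. metric_coeff A g c l 1 x * riemann A g c l 2 1 2 x)
         / det (\<chi> i j. metric_coeff A g c i j x))"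

definition positively_oriented :: "'m surface \<Rightarrow> 'm \<Rightarrow> 'm tvec \<Rightarrow> 'm tvec \<Rightarrow> bool" where
  "positively_oriented A p v w \<longleftrightarrow> (\<forall>c\<in>A. p \<in> snd c ` fst c \<longrightarrow>
     v (coord c 1) * w (coord c 2) - v (coord c 2) * w (coord c 1) > 0)"

definition rot90 :: "'m surface \<Rightarrow> 'm metric \<Rightarrow> 'm \<Rightarrow> 'm tvec \<Rightarrow> 'm tvec" where
  "rot90 A g p v = (THE w. w \<in> tangent_space A p \<and> g p w w = g p v v \<and> g p v w = 0 \<and>
     (v = (\<lambda>f. 0) \<or> positively_oriented A p v w))"

definition rotate_by :: "'m surface \<Rightarrow> 'm metric \<Rightarrow> 'm \<Rightarrow> real \<Rightarrow> 'm tvec \<Rightarrow> 'm tvec" where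
  "rotate_by A g p \<theta> v = (\<lambda>f. cos \<theta> * v f + sin \<theta> * rot90 A g p v f)"

section \<open>The unit tangent bundle and its frame\<close>

definition unit_bundle :: "'m surface \<Rightarrow> 'm metric \<Rightarrow> ('m \<times> 'm tvec) set" where
  "unit_bundle A g = {(p, v). p \<in> points A \<and> v \<in> tangent_space A p \<and> g p v v = 1}"

text \<open>
  Over a parametrization \<open>(U, \<sigma>)\<close> of \<open>M\<close>, the pair \<open>(x, \<theta>)\<close> stands for the unit vector at \<open>\<sigma> x\<close>
  which makes the oriented angle \<open>\<theta>\<close> with \<open>\<partial>\<^sub>1\<close>; injectivity requires \<open>\<theta>\<close> to range over an open
  interval of length \<open>2 * pi\<close>.
\<close>

definition unit_coord_vec ::
    "'m surface \<Rightarrow> 'm metric \<Rightarrow> ('m, real^2) param \<Rightarrow> real^2 \<Rightarrow> 'm tvec" where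
  "unit_coord_vec A g c x = (\<lambda>f. coord_vec A c x 1 f / sqrt (metric_coeff A g c 1 1 x))"

definition unit_bundle_atlas ::
    "'m surface \<Rightarrow> 'm metric \<Rightarrow> ('m \<times> 'm tvec, (real^2) \<times> real) atlas" where
  "unit_bundle_atlas A g =
     {(fst c \<times> {a<..<a + 2 * pi},
       (\<lambda>(x, \<theta>). (snd c x, rotate_by A g (snd c x) \<theta> (unit_coord_vec A g c x)))) | c a. c \<in> A}"

text \<open>Over \<open>c\<close>, the geodesic equation as a first order system reads
  \<open>\<dot>x\<^sup>k = y\<^sup>k\<close>, \<open>\<dot>y\<^sup>k = - \<Gamma>\<^sup>k\<^sub>i\<^sub>j y\<^sup>i y\<^sup>j\<close>, where \<open>y\<^sup>k\<close> is the function \<open>(q, w) \<mapsto> w (x\<^sup>k)\<close>.\<close>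

definition geodesic_field ::
    "'m surface \<Rightarrow> 'm metric \<Rightarrow> 'm \<times> 'm tvec \<Rightarrow> ('m \<times> 'm tvec) tvec" where
  "geodesic_field A g u = (THE \<xi>. \<xi> \<in> tangent_space (unit_bundle_atlas A g) u \<and>
     (\<forall>c\<in>A. \<forall>x\<in>fst c. snd c x = fst u \<longrightarrow> (\<forall>k.
        \<xi> (\<lambda>(q, w). coord c k q) = snd u (coord c k) \<and>
        \<xi> (\<lambda>(q, w). w (coord c k)) =
          - (\<Sum>i\<in>UNIV. \<Sum>j\<in>UNIV.
               christoffel A g c k i j x * snd u (coord c i) * snd u (coord c j)))))"

definition vertical_field ::
    "'m surface \<Rightarrow> 'm metric \<Rightarrow> 'm \<times> 'm tvec \<Rightarrow> ('m \<times> 'm tvec) tvec" where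
  "vertical_field A g u =
     velocity (unit_bundle_atlas A g) (\<lambda>\<theta>. (fst u, rotate_by A g (fst u) \<theta> (snd u))) 0"

definition horizontal_field ::
    "'m surface \<Rightarrow> 'm metric \<Rightarrow> 'm \<times> 'm tvec \<Rightarrow> ('m \<times> 'm tvec) tvec" where
  "horizontal_field A g =
     lie_bracket (unit_bundle_atlas A g) (vertical_field A g) (geodesic_field A g)"

section \<open>Thermostats\<close>

definition thermostat :: "'m surface \<Rightarrow> 'm metric \<Rightarrow> ('m \<times> 'm tvec \<Rightarrow> real) \<Rightarrow> bool" where
  "thermostat A g lam \<longleftrightarrow> closed_oriented_surface A \<and> riemannian_metric A g \<and>
     smooth_fun (unit_bundle_atlas A g) lam"

definition magnetic_system :: "'m surface \<Rightarrow> 'm metric \<Rightarrow> ('m \<times> 'm tvec \<Rightarrow> real) \<Rightarrow> bool" where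
  "magnetic_system A g lam \<longleftrightarrow> thermostat A g lam \<and>
     (\<forall>u\<in>unit_bundle A g. vertical_field A g u lam = 0)"

definition thermostat_field ::
    "'m surface \<Rightarrow> 'm metric \<Rightarrow> ('m \<times> 'm tvec \<Rightarrow> real) \<Rightarrow> 'm \<times> 'm tvec
      \<Rightarrow> ('m \<times> 'm tvec) tvec" where
  "thermostat_field A g lam u =
     (\<lambda>f. geodesic_field A g u f + lam u * vertical_field A g u f)"

definition kappa0 ::
    "'m surface \<Rightarrow> 'm metric \<Rightarrow> ('m \<times> 'm tvec \<Rightarrow> real) \<Rightarrow> 'm \<times> 'm tvec \<Rightarrow> real" where
  "kappa0 A g lam u =
     gauss_curvature A g (fst u) - horizontal_field A g u lam + (lam u)\<^sup>2"

definition thermostat_flow ::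
    "'m surface \<Rightarrow> 'm metric \<Rightarrow> ('m \<times> 'm tvec \<Rightarrow> real)
      \<Rightarrow> (real \<Rightarrow> 'm \<times> 'm tvec \<Rightarrow> 'm \<times> 'm tvec) \<Rightarrow> bool" where
  "thermostat_flow A g lam \<phi> \<longleftrightarrow>
     is_flow (unit_bundle_atlas A g) (thermostat_field A g lam) \<phi>"

text \<open>The element \<open>\<beta>\<close> of the coframe \<open>(\<alpha>, \<beta>, \<psi>)\<close> dual to \<open>(X, H, V)\<close>.\<close>

definition beta_form :: "'m surface \<Rightarrow> 'm metric \<Rightarrow> 'm \<times> 'm tvec \<Rightarrow> ('m \<times> 'm tvec) covec" where
  "beta_form A g u = (THE \<xi>. \<xi> \<in> cotangent_space (unit_bundle_atlas A g) u \<and>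
     \<xi> (geodesic_field A g u) = 0 \<and> \<xi> (horizontal_field A g u) = 1 \<and>
     \<xi> (vertical_field A g u) = 0)"

definition Hstar :: "'m surface \<Rightarrow> 'm metric \<Rightarrow> 'm \<times> 'm tvec \<Rightarrow> ('m \<times> 'm tvec) covec set" where
  "Hstar A g u = line_of (beta_form A g u)"

definition green_stable ::
    "'m surface \<Rightarrow> 'm metric \<Rightarrow> (real \<Rightarrow> 'm \<times> 'm tvec \<Rightarrow> 'm \<times> 'm tvec) \<Rightarrow> 'm \<times> 'm tvec
      \<Rightarrow> ('m \<times> 'm tvec) covec set" where
  "green_stable A g \<phi> u = (THE l. lines_tendsto
     (\<lambda>t. inverse_transpose (unit_bundle_atlas A g) (\<phi> (- t)) (\<phi> t u) ` Hstar A g (\<phi> t u))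
     l at_top)"

definition green_unstable ::
    "'m surface \<Rightarrow> 'm metric \<Rightarrow> (real \<Rightarrow> 'm \<times> 'm tvec \<Rightarrow> 'm \<times> 'm tvec) \<Rightarrow> 'm \<times> 'm tvec
      \<Rightarrow> ('m \<times> 'm tvec) covec set" where
  "green_unstable A g \<phi> u = (THE l. lines_tendsto
     (\<lambda>t. inverse_transpose (unit_bundle_atlas A g) (\<phi> t) (\<phi> (- t) u) ` Hstar A g (\<phi> (- t) u))
     l at_top)"

end

theory Submission
  imports Defs
begin

text \<open>
  Along an orbit of \<open>F = X + \<lambda> V\<close> the brackets \<open>[F, V] = - H\<close> and
  \<open>[F, H] = \<kappa>\<^sub>0 V - \<lambda> F\<close> turn the pull-back of the frame to a fixed point \<open>u\<close> into solutions of
  the Jacobi equation \<open>y'' = - \<kappa>\<^sub>0 y\<close>. If \<open>A\<close> and \<open>S\<close> are its solutions with initial values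
  \<open>(1, 0)\<close> and \<open>(0, 1)\<close>, the line \<open>\<real> \<beta>\<close> pulled back from \<open>\<phi> T u\<close> is spanned by
  \<open>A(T) \<beta> + S(T) (\<psi> - \<lambda> \<alpha>)\<close>. By constancy of the Wronskian, \<open>A / S\<close> decreases to a limit \<open>r \<ge> 0\<close>
  at infinity and, symmetrically, tends to some \<open>- s \<le> 0\<close> at minus infinity. So the Green bundles
  agree at \<open>u\<close> iff \<open>r = s = 0\<close>. This holds if \<open>\<kappa>\<^sub>0\<close> vanishes along the orbit, while \<open>r > 0\<close>
  as soon as \<open>\<kappa>\<^sub>0 < 0\<close> at \<open>u\<close> itself.
\<close>

section \<open>Smooth functions on open sets\<close>

text \<open>Two facts make the problem scalar. Only covectors annihilating \<open>F\<close> occur,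
  so the term \<open>- \<lambda> F\<close> of \<open>[F, H]\<close> is invisible and the values on
  the pulled-back \<open>V\<close> and \<open>H\<close> form a closed two by two system. The
  magnetic condition removes the term \<open>- (V \<lambda>) V\<close> from \<open>[F, V]\<close>,
  so the Jacobi equation has no first order term and its Wronskian is constant. Pulling back to
  \<open>u\<close> keeps all times in one cotangent space, where ordinary derivatives of real
  functions suffice.

  Strictness is needed at one point only: \<kappa>0 < 0 at \<open>u\<close> makes \<open>A'\<close>
  positive right after time 0, and \<kappa>0 \<le> 0 along the orbit preserves the resulting lower
  bound for \<open>A / S\<close>.

  Much of the work is local geometry. \<open>geodesic_field\<close> and
  \<open>gauss_curvature\<close> are defined by \<open>THE\<close> from conditions in all charts of
  the surface at once, so evaluating them requires independence of the chart. Every chart carries an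
  explicit orthonormal frame built from square roots of metric coefficients. In the coordinates
  (point, angle to the frame) the fields \<open>X\<close>, \<open>H\<close>, \<open>V\<close> are
  explicit, and their brackets reduce to the derivative of the connection form.\<close>

lemma Ck_on_cong:
  assumes "open S" "\<And>x. x \<in> S \<Longrightarrow> f x = g x"
  shows "Ck_on k S f \<longleftrightarrow> Ck_on k S g"
  using assms(2)
proof (induction k arbitrary: f g)
  case 0 then show ?case using continuous_on_cong[OF refl, of S f g] by auto
next
  case (Suc k)
  have d: "(f has_derivative D) (at x) \<longleftrightarrow> (g has_derivative D) (at x)" if "x \<in> S" for x D
    using has_derivative_transform_within_open[OF _ assms(1) that, of f D UNIV g]
      has_derivative_transform_within_open[OF _ assms(1) that, of g D UNIV f] Suc.prems by auto
  have "frechet_derivative f (at x) = frechet_derivative g (at x)" if "x \<in> S" for x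
    unfolding frechet_derivative_def using d[OF that] by simp
  then have "Ck_on k S (\<lambda>x. frechet_derivative f (at x) v) \<longleftrightarrow>
             Ck_on k S (\<lambda>x. frechet_derivative g (at x) v)" for v
    by (intro Suc.IH) simp
  moreover have "f differentiable (at x) \<longleftrightarrow> g differentiable (at x)" if "x \<in> S" for x
    unfolding differentiable_def using d[OF that] by simp
  ultimately show ?case by simp
qed

lemma Ck_on_subset: "Ck_on k S f \<Longrightarrow> T \<subseteq> S \<Longrightarrow> Ck_on k T f"
  by (induction k arbitrary: f) (auto intro: continuous_on_subset)

lemma Ck_on_Suc_imp: "Ck_on (Suc k) S f \<Longrightarrow> Ck_on k S f"
proof (induction k arbitrary: f)
  case 0 then show ?case
    by (auto intro!: differentiable_imp_continuous_on simp: differentiable_on_def)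
      (meson differentiable_at_withinI)
next
  case (Suc k) then show ?case by (metis Ck_on.simps(2))
qed

lemma Ck_on_SucI:
  assumes "open S" "\<And>x. x \<in> S \<Longrightarrow> (f has_derivative f' x) (at x)"
    "\<And>v. Ck_on k S (\<lambda>x. f' x v)"
  shows "Ck_on (Suc k) S f"
proof -
  have "frechet_derivative f (at x) = f' x" if "x \<in> S" for x
    using frechet_derivative_at[OF assms(2)[OF that]] by simp
  then have "Ck_on k S (\<lambda>x. frechet_derivative f (at x) v)" for v
    using assms(3)[of v] Ck_on_cong[OF assms(1), of "\<lambda>x. frechet_derivative f (at x) v" "\<lambda>x. f' x v"]
    by simp
  then show ?thesis using assms(2) by (auto simp: differentiable_def)
qed

lemma Ck_on_SucD:
  assumes "Ck_on (Suc k) S f"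
  shows "x \<in> S \<Longrightarrow> (f has_derivative frechet_derivative f (at x)) (at x)"
    "Ck_on k S (\<lambda>x. frechet_derivative f (at x) v)"
  using assms by (auto simp: frechet_derivative_works)

lemma Ck_on_const: "Ck_on k S (\<lambda>x. c)"
  by (induction k arbitrary: c) auto

lemma Ck_on_bounded_linear:
  assumes "bounded_linear L" "open S" "Ck_on k S f"
  shows "Ck_on k S (\<lambda>x. L (f x))"
  using assms(3)
proof (induction k arbitrary: f)
  case 0 then show ?case using assms(1) by (simp add: bounded_linear.continuous_on)
next
  case (Suc k)
  show ?case
    by (rule Ck_on_SucI[OF assms(2) bounded_linear.has_derivative[OF assms(1) Ck_on_SucD(1)[OF Suc.prems]]])
       (auto intro!: Suc.IH Ck_on_SucD(2)[OF Suc.prems])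
qed

lemma Ck_on_add:
  assumes "open S" "Ck_on k S f" "Ck_on k S g"
  shows "Ck_on k S (\<lambda>x. f x + g x)"
  using assms(2,3)
proof (induction k arbitrary: f g)
  case 0 then show ?case by (simp add: continuous_on_add)
next
  case (Suc k)
  show ?case
    by (rule Ck_on_SucI[OF assms(1) has_derivative_add[OF Ck_on_SucD(1)[OF Suc.prems(1)]
          Ck_on_SucD(1)[OF Suc.prems(2)]]])
       (auto intro!: Suc.IH Ck_on_SucD(2)[OF Suc.prems(1)] Ck_on_SucD(2)[OF Suc.prems(2)])
qed

lemma Ck_on_sum:
  assumes "open S" "\<And>i. i \<in> I \<Longrightarrow> Ck_on k S (f i)"
  shows "Ck_on k S (\<lambda>x. \<Sum>i\<in>I. f i x)"
  using assms(2)
proof (induction I rule: infinite_finite_induct)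
  case (insert i I)
  then have "Ck_on k S (\<lambda>x. f i x + (\<Sum>i\<in>I. f i x))"
    by (intro Ck_on_add[OF assms(1)]) auto
  then show ?case using insert.hyps by simp
qed (simp_all add: Ck_on_const)

lemma Ck_on_bilinear:
  assumes B: "bounded_bilinear B" and "open S" "Ck_on k S f" "Ck_on k S g"
  shows "Ck_on k S (\<lambda>x. B (f x) (g x))"
  using assms(3,4)
proof (induction k arbitrary: f g)
  case 0 then show ?case by (simp add: bounded_bilinear.continuous_on[OF B])
next
  case (Suc k)
  show ?case
  proof (rule Ck_on_SucI[OF assms(2) bounded_bilinear.FDERIV[OF B Ck_on_SucD(1)[OF Suc.prems(1)]
          Ck_on_SucD(1)[OF Suc.prems(2)]]])
    show "Ck_on k S (\<lambda>x. B (f x) (frechet_derivative g (at x) v) +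
        B (frechet_derivative f (at x) v) (g x))" for v
      by (intro Ck_on_add assms(2) Suc.IH Ck_on_SucD(2)[OF Suc.prems(1)]
          Ck_on_SucD(2)[OF Suc.prems(2)] Ck_on_Suc_imp[OF Suc.prems(1)] Ck_on_Suc_imp[OF Suc.prems(2)])
  qed
qed

lemma linear_euclidean_expand:
  fixes L :: "'a::euclidean_space \<Rightarrow> 'b::real_vector"
  assumes "linear L"
  shows "L v = (\<Sum>b\<in>Basis. (v \<bullet> b) *\<^sub>R L b)"
proof -
  have "L v = L (\<Sum>b\<in>Basis. (v \<bullet> b) *\<^sub>R b)" by (simp add: euclidean_representation)
  also have "\<dots> = (\<Sum>b\<in>Basis. (v \<bullet> b) *\<^sub>R L b)"
    by (simp add: linear_sum[OF assms] linear_scale[OF assms])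
  finally show ?thesis .
qed

text \<open>The chain rule applies the derivative of \<open>f\<close> to a vector that varies with
  the point, whereas \<open>Ck_on\<close> controls derivatives in fixed directions. Expanding that
  vector in the basis leaves a finite sum of products, and the induction hypothesis applies to the
  directional derivatives of \<open>f\<close>; hence the induction over arbitrary
  \<open>f\<close>.\<close>

lemma Ck_on_compose:
  fixes f :: "'b::euclidean_space \<Rightarrow> 'c::real_normed_vector" and g :: "'a::euclidean_space \<Rightarrow> 'b"
  assumes "open S" "open T" "Ck_on k T f" "Ck_on k S g" "g ` S \<subseteq> T"
  shows "Ck_on k S (\<lambda>x. f (g x))"
  using assms(3,4)
proof (induction k arbitrary: f)
  case 0 then show ?case using assms(5) by (auto intro: continuous_on_compose2)
next
  case (Suc k)
  let ?f' = "\<lambda>x. frechet_derivative f (at x)" and ?g' = "\<lambda>x. frechet_derivative g (at x)"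
  have f: "(f has_derivative ?f' (g x)) (at (g x))" if "x \<in> S" for x
    using Ck_on_SucD(1)[OF Suc.prems(1)] assms(5) that by blast
  have g: "(g has_derivative ?g' x) (at x)" if "x \<in> S" for x
    using Ck_on_SucD(1)[OF Suc.prems(2)] that by blast
  have gk: "Ck_on k S g" by (rule Ck_on_Suc_imp[OF Suc.prems(2)])
  have d: "((\<lambda>x. f (g x)) has_derivative (\<lambda>v. \<Sum>b\<in>Basis. (?g' x v \<bullet> b) *\<^sub>R ?f' (g x) b)) (at x)"
    if "x \<in> S" for x
  proof -
    have "(\<lambda>v. ?f' (g x) (?g' x v)) = (\<lambda>v. \<Sum>b\<in>Basis. (?g' x v \<bullet> b) *\<^sub>R ?f' (g x) b)"
      by (rule ext) (rule linear_euclidean_expand[OF has_derivative_linear[OF f[OF that]]])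
    then show ?thesis using has_derivative_compose[OF g[OF that] f[OF that]] by metis
  qed
  show ?case
  proof (rule Ck_on_SucI[OF assms(1) d])
    fix v
    show "Ck_on k S (\<lambda>x. \<Sum>b\<in>Basis. (?g' x v \<bullet> b) *\<^sub>R ?f' (g x) b)"
      by (intro Ck_on_sum Ck_on_bilinear[OF bounded_bilinear_scaleR] assms(1)
          Ck_on_bounded_linear[OF bounded_linear_inner_left] Ck_on_SucD(2)[OF Suc.prems(2)]
          Suc.IH Ck_on_SucD(2)[OF Suc.prems(1)] gk)
  qed
qed

lemma Ck_on_Pair:
  assumes "open S" "Ck_on k S f" "Ck_on k S g"
  shows "Ck_on k S (\<lambda>x. (f x, g x))"
proof -
  have "Ck_on k S (\<lambda>x. (f x, 0))"
    using Ck_on_bounded_linear[of "\<lambda>a. (a, 0)", OF _ assms(1,2)]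
    by (simp add: bounded_linear_Pair bounded_linear_ident bounded_linear_zero)
  moreover have "Ck_on k S (\<lambda>x. (0, g x))"
    using Ck_on_bounded_linear[of "\<lambda>a. (0, a)", OF _ assms(1,3)]
    by (simp add: bounded_linear_Pair bounded_linear_ident bounded_linear_zero)
  ultimately have "Ck_on k S (\<lambda>x. (f x, 0) + (0, g x))"
    by (rule Ck_on_add[OF assms(1)])
  then show ?thesis by simp
qed

section \<open>Closure properties of smooth functions\<close>

named_theorems smooth_intros

lemma smooth_on_cong:
  "open S \<Longrightarrow> (\<And>x. x \<in> S \<Longrightarrow> f x = g x) \<Longrightarrow> smooth_on S f \<longleftrightarrow> smooth_on S g"
  using Ck_on_cong[of S f g] by (simp add: smooth_on_def)

lemma smooth_on_subset: "smooth_on S f \<Longrightarrow> T \<subseteq> S \<Longrightarrow> smooth_on T f"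
  unfolding smooth_on_def by (auto intro: Ck_on_subset)

lemma smooth_on_has_derivative:
  "smooth_on S f \<Longrightarrow> x \<in> S \<Longrightarrow> (f has_derivative frechet_derivative f (at x)) (at x)"
  unfolding smooth_on_def by (rule Ck_on_SucD(1)[of 0]) auto

lemma smooth_on_continuous_on: "smooth_on S f \<Longrightarrow> continuous_on S f"
  unfolding smooth_on_def using Ck_on.simps(1)[of S f] by metis

lemma smooth_on_isCont: "open S \<Longrightarrow> smooth_on S f \<Longrightarrow> x \<in> S \<Longrightarrow> isCont f x"
  using continuous_on_eq_continuous_at[of S f] smooth_on_continuous_on[of S f] by simp

lemma smooth_on_derivative: "smooth_on S f \<Longrightarrow> smooth_on S (\<lambda>x. frechet_derivative f (at x) v)"
  unfolding smooth_on_def by (intro allI Ck_on_SucD(2)) simp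

lemma smooth_on_const [smooth_intros]: "smooth_on S (\<lambda>x. c)"
  by (simp add: smooth_on_def Ck_on_const)

lemma smooth_on_linear:
  "bounded_linear L \<Longrightarrow> open S \<Longrightarrow> smooth_on S f \<Longrightarrow> smooth_on S (\<lambda>x. L (f x))"
  by (simp add: smooth_on_def Ck_on_bounded_linear)

lemma smooth_on_id [smooth_intros]: "open S \<Longrightarrow> smooth_on S (\<lambda>x. x)"
  unfolding smooth_on_def
proof
  fix k assume "open S" then show "Ck_on k S (\<lambda>x. x)"
    by (cases k) (auto intro!: Ck_on_const)
qed

lemma smooth_on_add [smooth_intros]:
  "open S \<Longrightarrow> smooth_on S f \<Longrightarrow> smooth_on S g \<Longrightarrow> smooth_on S (\<lambda>x. f x + g x)"
  by (simp add: smooth_on_def Ck_on_add)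

lemma smooth_on_sum [smooth_intros]:
  "open S \<Longrightarrow> (\<And>i. i \<in> I \<Longrightarrow> smooth_on S (f i)) \<Longrightarrow> smooth_on S (\<lambda>x. \<Sum>i\<in>I. f i x)"
  by (simp add: smooth_on_def Ck_on_sum)

lemma smooth_on_scaleR [smooth_intros]:
  "open S \<Longrightarrow> smooth_on S f \<Longrightarrow> smooth_on S g \<Longrightarrow> smooth_on S (\<lambda>x. f x *\<^sub>R g x)"
  by (simp add: smooth_on_def Ck_on_bilinear[OF bounded_bilinear_scaleR])

lemma smooth_on_mult [smooth_intros]:
  fixes f g :: "_ \<Rightarrow> real"
  shows "open S \<Longrightarrow> smooth_on S f \<Longrightarrow> smooth_on S g \<Longrightarrow> smooth_on S (\<lambda>x. f x * g x)"
  by (simp add: smooth_on_def Ck_on_bilinear[OF bounded_bilinear_mult])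

lemma smooth_on_inner [smooth_intros]:
  "open S \<Longrightarrow> smooth_on S f \<Longrightarrow> smooth_on S g \<Longrightarrow> smooth_on S (\<lambda>x. f x \<bullet> g x)"
  by (simp add: smooth_on_def Ck_on_bilinear[OF bounded_bilinear_inner])

lemma smooth_on_minus [smooth_intros]: "open S \<Longrightarrow> smooth_on S f \<Longrightarrow> smooth_on S (\<lambda>x. - f x)"
  by (rule smooth_on_linear[OF bounded_linear_minus[OF bounded_linear_ident]])

lemma smooth_on_diff [smooth_intros]:
  "open S \<Longrightarrow> smooth_on S f \<Longrightarrow> smooth_on S g \<Longrightarrow> smooth_on S (\<lambda>x. f x - g x)"
  using smooth_on_add[of S f "\<lambda>x. - g x"] smooth_on_minus[of S g] by simp

lemma smooth_on_Pair [smooth_intros]: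
  "open S \<Longrightarrow> smooth_on S f \<Longrightarrow> smooth_on S g \<Longrightarrow> smooth_on S (\<lambda>x. (f x, g x))"
  by (simp add: smooth_on_def Ck_on_Pair)

lemma smooth_on_fst [smooth_intros]: "open S \<Longrightarrow> smooth_on S f \<Longrightarrow> smooth_on S (\<lambda>x. fst (f x))"
  by (rule smooth_on_linear[OF bounded_linear_fst])

lemma smooth_on_snd [smooth_intros]: "open S \<Longrightarrow> smooth_on S f \<Longrightarrow> smooth_on S (\<lambda>x. snd (f x))"
  by (rule smooth_on_linear[OF bounded_linear_snd])

lemma smooth_on_vec_nth [smooth_intros]:
  "open S \<Longrightarrow> smooth_on S f \<Longrightarrow> smooth_on S (\<lambda>x. f x $ i)"
  by (rule smooth_on_linear[OF bounded_linear_vec_nth])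

lemma smooth_on_compose:
  fixes f :: "'b::euclidean_space \<Rightarrow> 'c::real_normed_vector" and g :: "'a::euclidean_space \<Rightarrow> 'b"
  shows "open S \<Longrightarrow> open T \<Longrightarrow> smooth_on T f \<Longrightarrow> smooth_on S g \<Longrightarrow> g ` S \<subseteq> T \<Longrightarrow>
    smooth_on S (\<lambda>x. f (g x))"
  unfolding smooth_on_def by (intro allI Ck_on_compose[of S T _ f g]) auto

text \<open>\<open>smooth_on_derivative\<close> covers constant directions; a basis expansion of
  \<open>v x\<close> reduces a vector field to that case.\<close>

lemma smooth_on_derivative_field:
  assumes "open S" "smooth_on S f" "smooth_on S v"
  shows "smooth_on S (\<lambda>x. frechet_derivative f (at x) (v x))"
proof -
  have "smooth_on S (\<lambda>x. \<Sum>b\<in>Basis. (v x \<bullet> b) *\<^sub>R frechet_derivative f (at x) b)"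
    by (intro smooth_intros smooth_on_derivative assms)
  moreover have "frechet_derivative f (at x) (v x) =
      (\<Sum>b\<in>Basis. (v x \<bullet> b) *\<^sub>R frechet_derivative f (at x) b)" if "x \<in> S" for x
    by (rule linear_euclidean_expand)
      (rule has_derivative_linear[OF smooth_on_has_derivative[OF assms(2) that]])
  ultimately show ?thesis
    using smooth_on_cong[OF assms(1), of "\<lambda>x. frechet_derivative f (at x) (v x)"
      "\<lambda>x. \<Sum>b\<in>Basis. (v x \<bullet> b) *\<^sub>R frechet_derivative f (at x) b"] by blast
qed

text \<open>Bootstrapping: if the derivative is as regular as the function itself, each round gains
  one order. This suits functions such as \<open>inverse\<close> and \<open>sqrt\<close>, whose
  derivatives are expressed through themselves.\<close>

lemma smooth_on_real_ode:
  fixes h :: "real \<Rightarrow> real"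
  assumes "open S" "\<And>x. x \<in> S \<Longrightarrow> (h has_real_derivative h' x) (at x)"
    "\<And>k. Ck_on k S h \<Longrightarrow> Ck_on k S h'"
  shows "smooth_on S h"
  unfolding smooth_on_def
proof
  fix k show "Ck_on k S h"
  proof (induction k)
    case 0
    show ?case using assms(2)
      by (auto intro!: continuous_at_imp_continuous_on DERIV_isCont)
  next
    case (Suc k)
    show ?case
      by (rule Ck_on_SucI[OF assms(1), where f' = "\<lambda>x v. h' x * v"])
        (auto intro: assms(2)[unfolded has_field_derivative_def] assms(3)[OF Suc]
          Ck_on_bounded_linear[OF bounded_linear_mult_left assms(1)])
  qed
qed

lemma smooth_on_inverse:
  fixes S :: "real set"
  assumes "open S" "0 \<notin> S"
  shows "smooth_on S inverse"
proof (rule smooth_on_real_ode[OF assms(1), where h' = "\<lambda>x. - (inverse x * inverse x)"])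
  show "(inverse has_real_derivative - (inverse x * inverse x)) (at x)" if "x \<in> S" for x
    using assms(2) that by (auto intro!: derivative_eq_intros)
  show "Ck_on k S (\<lambda>x. - (inverse x * inverse x))" if "Ck_on k S inverse" for k
    by (intro Ck_on_bounded_linear[OF bounded_linear_minus[OF bounded_linear_ident]]
        Ck_on_bilinear[OF bounded_bilinear_mult] assms that)
qed

lemma smooth_on_divide [smooth_intros]:
  fixes f g :: "_ \<Rightarrow> real"
  assumes "open S" "smooth_on S f" "smooth_on S g" "\<And>x. x \<in> S \<Longrightarrow> g x \<noteq> 0"
  shows "smooth_on S (\<lambda>x. f x / g x)"
proof -
  have "smooth_on S (\<lambda>x. inverse (g x))"
    by (rule smooth_on_compose[OF assms(1) _ smooth_on_inverse[of "- {0}"] assms(3)])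
      (use assms(4) in auto)
  then show ?thesis
    unfolding divide_inverse by (rule smooth_on_mult[OF assms(1,2)])
qed

lemma smooth_on_sqrt [smooth_intros]:
  assumes "open S" "smooth_on S f" "\<And>x. x \<in> S \<Longrightarrow> f x > 0"
  shows "smooth_on S (\<lambda>x. sqrt (f x))"
proof -
  have "smooth_on {0<..} sqrt"
  proof (rule smooth_on_real_ode[where h' = "\<lambda>x. inverse (sqrt x) * (1/2)"])
    show "(sqrt has_real_derivative inverse (sqrt x) * (1/2)) (at x)" if "x \<in> {0<..}" for x
      using that by (auto intro!: derivative_eq_intros)
    show "Ck_on k {0<..} (\<lambda>x. inverse (sqrt x) * (1/2))" if "Ck_on k {0<..} sqrt" for k
    proof -
      have "Ck_on k {0<..} (inverse :: real \<Rightarrow> real)"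
        using smooth_on_inverse[of "{0<..}"] by (simp add: smooth_on_def)
      then have "Ck_on k {0<..} (\<lambda>x. inverse (sqrt x))"
        using Ck_on_compose[of "{0<..}" "{0<..}" k inverse sqrt] that by force
      then show ?thesis
        by (intro Ck_on_bounded_linear[OF bounded_linear_mult_left]) auto
    qed
  qed simp
  then show ?thesis
    using smooth_on_compose[OF assms(1), of "{0<..}" sqrt f] assms by auto
qed

lemma smooth_on_sin_cos:
  shows "smooth_on UNIV (sin :: real \<Rightarrow> real)" "smooth_on UNIV (cos :: real \<Rightarrow> real)"
proof -
  \<comment> \<open>Each function is the derivative of the other up to sign, so neither induction
    closes alone.\<close>
  have "Ck_on k UNIV (sin :: real \<Rightarrow> real) \<and> Ck_on k UNIV (cos :: real \<Rightarrow> real)" for k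
  proof (induction k)
    case 0 show ?case by (auto intro!: continuous_intros)
  next
    case (Suc k)
    have c: "Ck_on k UNIV (\<lambda>x. cos x * v)" and s: "Ck_on k UNIV (\<lambda>x. sin x * - v)" for v :: real
      using Ck_on_bounded_linear[OF bounded_linear_mult_left open_UNIV, of k cos v]
        Ck_on_bounded_linear[OF bounded_linear_mult_left open_UNIV, of k sin "- v"] Suc by auto
    have "Ck_on (Suc k) UNIV (sin :: real \<Rightarrow> real)"
      by (rule Ck_on_SucI[OF open_UNIV DERIV_sin[unfolded has_field_derivative_def] c])
    moreover have "Ck_on (Suc k) UNIV (cos :: real \<Rightarrow> real)"
    proof (rule Ck_on_SucI[OF open_UNIV _ s])
      show "(cos has_derivative (\<lambda>v. sin x * - v)) (at x)" for x :: real
      using DERIV_cos[of x, unfolded has_field_derivative_def]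
      by (rule has_derivative_eq_rhs) auto
    qed
    ultimately show ?case by blast
  qed
  then show "smooth_on UNIV (sin :: real \<Rightarrow> real)" "smooth_on UNIV (cos :: real \<Rightarrow> real)"
    unfolding smooth_on_def by blast+
qed

lemma smooth_on_sin [smooth_intros]:
  "open S \<Longrightarrow> smooth_on S f \<Longrightarrow> smooth_on S (\<lambda>x. sin (f x :: real))"
  by (rule smooth_on_compose[OF _ _ smooth_on_sin_cos(1)]) auto

lemma smooth_on_cos [smooth_intros]:
  "open S \<Longrightarrow> smooth_on S f \<Longrightarrow> smooth_on S (\<lambda>x. cos (f x :: real))"
  by (rule smooth_on_compose[OF _ _ smooth_on_sin_cos(2)]) auto

lemma smooth_on_arctan [smooth_intros]:
  assumes "open S" "smooth_on S f"
  shows "smooth_on S (\<lambda>x. arctan (f x))"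
proof -
  have "smooth_on UNIV (\<lambda>x::real. 1 / (1 + x * x))"
    by (intro smooth_intros) (auto simp: add_nonneg_eq_0_iff)
  then have "smooth_on UNIV arctan"
    by (intro smooth_on_real_ode[where h' = "\<lambda>x. 1 / (1 + x * x)"])
      (auto intro!: derivative_eq_intros simp: smooth_on_def power2_eq_square inverse_eq_divide)
  then show ?thesis
    using smooth_on_compose[OF assms(1), of UNIV arctan f] assms by auto
qed

section \<open>Symmetry of second derivatives\<close>

lemma symmetric_second_derivative_real:
  fixes f :: "'a::euclidean_space \<Rightarrow> real"
  assumes "open S" "smooth_on S f" "x \<in> S"
  shows "frechet_derivative (\<lambda>y. frechet_derivative f (at y) v) (at x) w =
         frechet_derivative (\<lambda>y. frechet_derivative f (at y) w) (at x) v"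
proof -
  let ?D = "\<lambda>a y. frechet_derivative f (at y) a"
  let ?DD = "\<lambda>a b y. frechet_derivative (?D a) (at y) b"
  have hd: "((\<lambda>s. g (p + s *\<^sub>R a)) has_real_derivative frechet_derivative g (at (p + s *\<^sub>R a)) a) (at s)"
    if "smooth_on S g" "p + s *\<^sub>R a \<in> S" for g :: "'a \<Rightarrow> real" and p a s
  proof -
    have "((\<lambda>s. p + s *\<^sub>R a) has_derivative (\<lambda>h. h *\<^sub>R a)) (at s)"
      by (auto intro!: derivative_eq_intros)
    from has_derivative_compose[OF this, of g] smooth_on_has_derivative[OF that]
    have "((\<lambda>s. g (p + s *\<^sub>R a)) has_derivative
        (\<lambda>h. frechet_derivative g (at (p + s *\<^sub>R a)) (h *\<^sub>R a))) (at s)" by blast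
    moreover have "linear (frechet_derivative g (at (p + s *\<^sub>R a)))"
      using has_derivative_linear[OF smooth_on_has_derivative[OF that]] .
    ultimately show ?thesis
      unfolding has_field_derivative_def
      by (elim has_derivative_eq_rhs) (simp add: fun_eq_iff linear_scale)
  qed
  obtain e where e: "e > 0" "ball x e \<subseteq> S" using openE[OF assms(1,3)] by blast
  \<comment> \<open>A vector s v + t w with s, t in [0, h] is shorter than \<open>h * M\<close>; the
    summand 1 keeps the bound strict and \<open>M\<close> positive even for v = w = 0.\<close>
  define M where "M = norm v + norm w + 1"
  have Mp: "M > 0" unfolding M_def using norm_ge_zero[of v] norm_ge_zero[of w] by linarith
  have inS: "x + s *\<^sub>R v + t *\<^sub>R w \<in> ball x (h * M)" if "0 \<le> s" "s \<le> h" "0 \<le> t" "t \<le> h" "0 < h" for s t h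
  proof -
    have "norm (s *\<^sub>R v + t *\<^sub>R w) \<le> s * norm v + t * norm w"
      using norm_triangle_ineq[of "s *\<^sub>R v" "t *\<^sub>R w"] that by simp
    also have "\<dots> \<le> h * norm v + h * norm w" using that by (intro add_mono mult_right_mono) auto
    also have "\<dots> < h * M" using that(5) unfolding M_def distrib_left by linarith
    also have "norm (s *\<^sub>R v + t *\<^sub>R w) = dist x (x + s *\<^sub>R v + t *\<^sub>R w)"
      unfolding dist_norm by (subst norm_minus_commute) (simp add: add.assoc)
    finally show ?thesis by simp
  qed
  \<comment> \<open>The second difference of \<open>f\<close> over the parallelogram spanned by h v
    and h w does not depend on the order of the two directions. Two applications of the mean value
    theorem, in either order, express it by both mixed derivatives at points that converge to
    \<open>x\<close>.\<close>
  define \<Delta> where "\<Delta> h = f (x + h *\<^sub>R v + h *\<^sub>R w) - f (x + h *\<^sub>R v) - f (x + h *\<^sub>R w) + f x" for h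
  have ex: "\<exists>y\<in>ball x (h * M). \<exists>z\<in>ball x (h * M). \<Delta> h = h * h * ?DD v w y \<and> \<Delta> h = h * h * ?DD w v z"
    if h: "h > 0" "h * M < e" for h
  proof -
    have sub: "ball x (h * M) \<subseteq> S" using h e by (meson dual_order.trans less_imp_le subset_ball)
    have S1: "x + s *\<^sub>R v + t *\<^sub>R w \<in> S" if "0 \<le> s" "s \<le> h" "0 \<le> t" "t \<le> h" for s t
      using inS[OF that h(1)] sub by blast
    have swap: "x + t *\<^sub>R w + s *\<^sub>R v = x + s *\<^sub>R v + t *\<^sub>R w" for s t by simp
    have S2: "x + t *\<^sub>R w + s *\<^sub>R v \<in> S" if "0 \<le> s" "s \<le> h" "0 \<le> t" "t \<le> h" for s t
      using S1[OF that] by (simp only: swap)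
    have S3: "x + s *\<^sub>R v \<in> S" "x + s *\<^sub>R w \<in> S" if "0 \<le> s" "s \<le> h" for s
      using S1[of s 0] S1[of 0 s] that h by auto
    have "\<exists>s>0. s < h \<and> (f (x + h *\<^sub>R w + h *\<^sub>R v) - f (x + h *\<^sub>R v)) - (f (x + h *\<^sub>R w + 0 *\<^sub>R v) - f (x + 0 *\<^sub>R v)) =
       (h - 0) * (?D v (x + h *\<^sub>R w + s *\<^sub>R v) - ?D v (x + s *\<^sub>R v))"
      by (rule MVT2[OF h(1), where f = "\<lambda>s. f (x + h *\<^sub>R w + s *\<^sub>R v) - f (x + s *\<^sub>R v)"])
         (intro DERIV_diff hd assms(2) S2 S3; use h in simp)
    then obtain s where s: "0 < s" "s < h"
      "\<Delta> h = h * (?D v (x + h *\<^sub>R w + s *\<^sub>R v) - ?D v (x + s *\<^sub>R v))"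
      unfolding \<Delta>_def swap[symmetric, of h h] by auto
    have "\<exists>t>0. t < h \<and> ?D v (x + s *\<^sub>R v + h *\<^sub>R w) - ?D v (x + s *\<^sub>R v + 0 *\<^sub>R w) =
       (h - 0) * ?DD v w (x + s *\<^sub>R v + t *\<^sub>R w)"
      by (rule MVT2[OF h(1), where f = "\<lambda>t. ?D v (x + s *\<^sub>R v + t *\<^sub>R w)"])
         (intro hd smooth_on_derivative assms(2) S1; use s h in simp)
    then obtain t where t: "0 < t" "t < h"
      "\<Delta> h = h * h * ?DD v w (x + s *\<^sub>R v + t *\<^sub>R w)" using s(3) unfolding swap by auto
    have "\<exists>s>0. s < h \<and> (f (x + h *\<^sub>R v + h *\<^sub>R w) - f (x + h *\<^sub>R w)) - (f (x + h *\<^sub>R v + 0 *\<^sub>R w) - f (x + 0 *\<^sub>R w)) =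
       (h - 0) * (?D w (x + h *\<^sub>R v + s *\<^sub>R w) - ?D w (x + s *\<^sub>R w))"
      by (rule MVT2[OF h(1), where f = "\<lambda>s. f (x + h *\<^sub>R v + s *\<^sub>R w) - f (x + s *\<^sub>R w)"])
         (intro DERIV_diff hd assms(2) S1 S3; use h in simp)
    then obtain s' where s': "0 < s'" "s' < h"
      "\<Delta> h = h * (?D w (x + h *\<^sub>R v + s' *\<^sub>R w) - ?D w (x + s' *\<^sub>R w))"
      unfolding \<Delta>_def by auto
    have "\<exists>t>0. t < h \<and> ?D w (x + s' *\<^sub>R w + h *\<^sub>R v) - ?D w (x + s' *\<^sub>R w + 0 *\<^sub>R v) =
       (h - 0) * ?DD w v (x + s' *\<^sub>R w + t *\<^sub>R v)"
      by (rule MVT2[OF h(1), where f = "\<lambda>t. ?D w (x + s' *\<^sub>R w + t *\<^sub>R v)"])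
         (intro hd smooth_on_derivative assms(2) S2; use s' h in simp)
    then obtain t' where t': "0 < t'" "t' < h"
      "\<Delta> h = h * h * ?DD w v (x + t' *\<^sub>R v + s' *\<^sub>R w)" using s'(3) unfolding swap by auto
    show ?thesis
      using t(3) t'(3) inS[of s h t] inS[of t' h s'] t(1,2) t'(1,2) s(1,2) s'(1,2) h(1)
      by (meson less_imp_le)
  qed
  have cont: "isCont (?DD a b) x" for a b
    by (rule smooth_on_isCont[OF assms(1) _ assms(3)])
      (intro smooth_on_derivative assms(2))
  show ?thesis
  proof (rule ccontr)
    assume ne: "?DD v w x \<noteq> ?DD w v x"
    \<comment> \<open>Half the gap: equal numbers cannot lie within \<open>d\<close> of two limits
      that are \<open>2 * d\<close> apart.\<close>
    define d where "d = \<bar>?DD v w x - ?DD w v x\<bar> / 2"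
    have d: "d > 0" using ne by (simp add: d_def)
    obtain e1 where e1: "e1 > 0" "\<And>y. dist y x < e1 \<Longrightarrow> dist (?DD v w y) (?DD v w x) < d"
      using cont[of v w] d unfolding continuous_at_eps_delta by metis
    obtain e2 where e2: "e2 > 0" "\<And>y. dist y x < e2 \<Longrightarrow> dist (?DD w v y) (?DD w v x) < d"
      using cont[of w v] d unfolding continuous_at_eps_delta by metis
    define h where "h = min e (min e1 e2) / (2 * M)"
    have h: "h > 0" using Mp e e1 e2 by (simp add: h_def)
    have hM: "h * M = min e (min e1 e2) / 2" using Mp by (simp add: h_def)
    have lt: "h * M < e" "h * M < e1" "h * M < e2" unfolding hM using e e1 e2 by auto
    obtain y z where yz: "y \<in> ball x (h*M)" "z \<in> ball x (h*M)" "h * h * ?DD v w y = h * h * ?DD w v z"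
      using ex[OF h lt(1)] by auto
    have "?DD v w y = ?DD w v z" using yz(3) h by simp
    moreover have "dist (?DD v w y) (?DD v w x) < d" "dist (?DD w v z) (?DD w v x) < d"
      using e1(2)[of y] e2(2)[of z] yz lt by (auto simp: dist_commute)
    moreover have "\<lbrakk>a = b; dist a p < d; dist b q < d; d = \<bar>p - q\<bar> / 2\<rbrakk> \<Longrightarrow> False" for a b p q :: real
      by (auto simp: dist_real_def abs_if split: if_splits)
    ultimately show False using d_def by blast
  qed
qed

lemma symmetric_second_derivative:
  fixes f :: "'a::euclidean_space \<Rightarrow> 'b::euclidean_space"
  assumes "open S" "smooth_on S f" "x \<in> S"
  shows "frechet_derivative (\<lambda>y. frechet_derivative f (at y) v) (at x) w =
         frechet_derivative (\<lambda>y. frechet_derivative f (at y) w) (at x) v"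
proof (rule euclidean_eqI)
  fix b :: 'b
  have sm: "smooth_on S (\<lambda>y. f y \<bullet> b)" by (intro smooth_intros assms)
  have 1: "frechet_derivative (\<lambda>y. g y \<bullet> b) (at y) = (\<lambda>a. frechet_derivative g (at y) a \<bullet> b)"
    if "smooth_on S g" "y \<in> S" for g y
    using frechet_derivative_at[OF bounded_linear.has_derivative[OF bounded_linear_inner_left
      smooth_on_has_derivative[OF that]], of b] by simp
  have 2: "frechet_derivative (\<lambda>y. frechet_derivative (\<lambda>y. f y \<bullet> b) (at y) a) (at x) c =
      frechet_derivative (\<lambda>y. frechet_derivative f (at y) a) (at x) c \<bullet> b" for a c
  proof -
    have "frechet_derivative (\<lambda>y. frechet_derivative (\<lambda>y. f y \<bullet> b) (at y) a) (at x) =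
      frechet_derivative (\<lambda>y. frechet_derivative f (at y) a \<bullet> b) (at x)"
      by (rule frechet_derivative_transform_within_open[OF _ assms(1,3)])
        (use 1[OF assms(2)] smooth_on_has_derivative[OF smooth_on_derivative[OF sm] assms(3)] in
          \<open>auto simp: differentiable_def\<close>)
    then show ?thesis using 1[OF smooth_on_derivative[OF assms(2)] assms(3)] by simp
  qed
  show "frechet_derivative (\<lambda>y. frechet_derivative f (at y) v) (at x) w \<bullet> b =
        frechet_derivative (\<lambda>y. frechet_derivative f (at y) w) (at x) v \<bullet> b"
    using symmetric_second_derivative_real[OF assms(1) sm assms(3), of v w] by (simp add: 2)
qed

section \<open>Tangent vectors and vector fields in charts\<close>

text \<open>A product rule. Second derivatives are available only as derivatives of the first
  derivative in a constant direction, so \<open>q\<close> is expanded in the basis, differentiated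
  and reassembled; the first summand is the one in which the direction is frozen at
  \<open>q z\<close>.\<close>

lemma derivative_along_field:
  fixes f :: "'a::euclidean_space \<Rightarrow> 'b::euclidean_space" and h :: "'d::real_normed_vector \<Rightarrow> 'a"
  assumes f: "smooth_on S f" and N: "open N" "z \<in> N" "h ` N \<subseteq> S"
    and h: "(h has_derivative h') (at z)" and q: "(q has_derivative q') (at z)"
    and S: "open S"
  shows "((\<lambda>z. frechet_derivative f (at (h z)) (q z)) has_derivative
    (\<lambda>v. frechet_derivative (\<lambda>y. frechet_derivative f (at y) (q z)) (at (h z)) (h' v) +
         frechet_derivative f (at (h z)) (q' v))) (at z)"
proof -
  let ?D = "\<lambda>b y. frechet_derivative f (at y) b"
  have hz: "h z \<in> S" using N by auto
  have exp: "?D a y = (\<Sum>b\<in>Basis. (a \<bullet> b) *\<^sub>R ?D b y)" if "y \<in> S" for a y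
    by (rule linear_euclidean_expand[OF has_derivative_linear[OF smooth_on_has_derivative[OF f that]]])
  have Db: "(?D b has_derivative frechet_derivative (?D b) (at (h z))) (at (h z))" for b
    by (rule smooth_on_has_derivative[OF smooth_on_derivative[OF f] hz])
  have Dbh: "((\<lambda>z. ?D b (h z)) has_derivative (\<lambda>v. frechet_derivative (?D b) (at (h z)) (h' v))) (at z)" for b
    using diff_chain_at[OF h Db[of b]] by (simp add: comp_def)
  have inn: "((\<lambda>y. q y \<bullet> b) has_derivative (\<lambda>v. q' v \<bullet> b)) (at z)" for b
    by (rule bounded_linear.has_derivative[OF bounded_linear_inner_left q])
  have "((\<lambda>y. \<Sum>b\<in>Basis. (q y \<bullet> b) *\<^sub>R ?D b (h y)) has_derivative
     (\<lambda>v. \<Sum>b\<in>Basis. (q z \<bullet> b) *\<^sub>R frechet_derivative (?D b) (at (h z)) (h' v) + (q' v \<bullet> b) *\<^sub>R ?D b (h z))) (at z)"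
    by (intro has_derivative_sum has_derivative_scaleR inn Dbh)
  then have 1: "((\<lambda>y. frechet_derivative f (at (h y)) (q y)) has_derivative
     (\<lambda>v. \<Sum>b\<in>Basis. (q z \<bullet> b) *\<^sub>R frechet_derivative (?D b) (at (h z)) (h' v) + (q' v \<bullet> b) *\<^sub>R ?D b (h z))) (at z)"
  proof (rule has_derivative_transform_within_open[OF _ N(1,2)])
    fix y assume "y \<in> N"
    then have "h y \<in> S" using N by auto
    then show "(\<Sum>b\<in>Basis. (q y \<bullet> b) *\<^sub>R ?D b (h y)) = frechet_derivative f (at (h y)) (q y)"
      by (rule exp[symmetric])
  qed
  have "((\<lambda>y. \<Sum>b\<in>Basis. (q z \<bullet> b) *\<^sub>R ?D b y) has_derivative
     (\<lambda>v. \<Sum>b\<in>Basis. (q z \<bullet> b) *\<^sub>R frechet_derivative (?D b) (at (h z)) v)) (at (h z))"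
    by (intro has_derivative_sum has_derivative_scaleR_right Db)
  then have "(?D (q z) has_derivative
     (\<lambda>v. \<Sum>b\<in>Basis. (q z \<bullet> b) *\<^sub>R frechet_derivative (?D b) (at (h z)) v)) (at (h z))"
    by (rule has_derivative_transform_within_open[OF _ S hz]) (simp add: exp[symmetric])
  then have "frechet_derivative (?D (q z)) (at (h z)) =
     (\<lambda>v. \<Sum>b\<in>Basis. (q z \<bullet> b) *\<^sub>R frechet_derivative (?D b) (at (h z)) v)"
    by (rule frechet_derivative_at[symmetric])
  then show ?thesis
    by (intro has_derivative_eq_rhs[OF 1] ext)
      (simp only: sum.distrib exp[OF hz, of "q' _"])
qed

lemma derivative_of_derivative_field:
  fixes f :: "'a::euclidean_space \<Rightarrow> 'b::euclidean_space"
  assumes "open S" "smooth_on S f" "(q has_derivative q') (at x)" "x \<in> S"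
  shows "((\<lambda>y. frechet_derivative f (at y) (q y)) has_derivative
    (\<lambda>v. frechet_derivative (\<lambda>y. frechet_derivative f (at y) (q x)) (at x) v +
         frechet_derivative f (at x) (q' v))) (at x)"
  by (rule derivative_along_field[OF assms(2,1,4) _ has_derivative_ident assms(3,1)]) simp

text \<open>The tangent vector with components \<open>\<xi>\<close> in the chart
  \<open>\<sigma>\<close>. The value 0 on the remaining functions agrees with that of
  \<open>velocity\<close>, so that the two can be compared as HOL functions.\<close>

definition tvec_of :: "('m, 'e::euclidean_space) atlas \<Rightarrow> ('e \<Rightarrow> 'm) \<Rightarrow> 'e \<Rightarrow> 'e \<Rightarrow> 'm tvec" where
  "tvec_of A \<sigma> x \<xi> = (\<lambda>f. if smooth_near A f (\<sigma> x) then frechet_derivative (f \<circ> \<sigma>) (at x) \<xi> else 0)"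

definition smooth_field :: "('m, 'e::euclidean_space) atlas \<Rightarrow> ('m \<Rightarrow> 'm tvec) \<Rightarrow> bool" where
  "smooth_field A Y \<longleftrightarrow> (\<forall>(U, \<sigma>)\<in>A. \<exists>P. smooth_on U P \<and> (\<forall>x\<in>U. Y (\<sigma> x) = tvec_of A \<sigma> x (P x)))"

lemma smooth_mapD:
  assumes "smooth_map A B h" "(U, \<sigma>) \<in> A" "(W, \<tau>) \<in> B"
  shows "open {x \<in> U. h (\<sigma> x) \<in> \<tau> ` W}"
    "smooth_on {x \<in> U. h (\<sigma> x) \<in> \<tau> ` W} (\<lambda>x. inv_into W \<tau> (h (\<sigma> x)))"
  using assms unfolding smooth_map_def by blast+

lemma pointsE:
  assumes "p \<in> points A" obtains U \<sigma> x where "(U, \<sigma>) \<in> A" "x \<in> U" "p = \<sigma> x"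
  using assms unfolding points_def by auto

lemma pointsI: "(U, \<sigma>) \<in> A \<Longrightarrow> x \<in> U \<Longrightarrow> \<sigma> x \<in> points A"
  unfolding points_def by auto

lemma smooth_nearI:
  "(U, \<sigma>) \<in> A \<Longrightarrow> open N \<Longrightarrow> x \<in> N \<Longrightarrow> N \<subseteq> U \<Longrightarrow> smooth_on N (f \<circ> \<sigma>) \<Longrightarrow> smooth_near A f (\<sigma> x)"
  unfolding smooth_near_def by blast

section \<open>Calculus on a manifold given by a smooth atlas\<close>

locale smooth_manifold =
  fixes A :: "('m, 'e::euclidean_space) atlas"
  assumes smooth_atlas: "smooth_atlas A"
begin

lemma chart_open: "(U, \<sigma>) \<in> A \<Longrightarrow> open U"
  and chart_inj: "(U, \<sigma>) \<in> A \<Longrightarrow> inj_on \<sigma> U"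
  and identity_smooth: "smooth_map A A (\<lambda>p. p)"
  using smooth_atlas unfolding smooth_atlas_def by auto

text \<open>By definition \<open>f\<close> is only smooth in some chart, possibly a different one.\<close>

lemma smooth_near_chartE:
  assumes c: "(U, \<sigma>) \<in> A" "x \<in> U" and f: "smooth_near A f (\<sigma> x)"
  obtains N where "open N" "x \<in> N" "N \<subseteq> U" "smooth_on N (f \<circ> \<sigma>)"
proof -
  obtain W \<tau> N' where W: "(W, \<tau>) \<in> A" "open N'" "N' \<subseteq> W" "\<sigma> x \<in> \<tau> ` N'" "smooth_on N' (f \<circ> \<tau>)"
    using f unfolding smooth_near_def by blast
  let ?T = "\<lambda>x. inv_into W \<tau> (\<sigma> x)"
  define D where "D = {x \<in> U. \<sigma> x \<in> \<tau> ` W}"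
  have D: "open D" "smooth_on D ?T"
    using smooth_mapD[OF identity_smooth c(1) W(1)] unfolding D_def by auto
  define N where "N = D \<inter> ?T -` N'"
  have N: "open N" unfolding N_def
    by (rule continuous_open_preimage[OF smooth_on_continuous_on[OF D(2)] D(1) W(2)])
  have xN: "x \<in> N"
    using W c chart_inj[OF W(1)] unfolding N_def D_def by (auto simp: inv_into_f_eq subset_iff)
  have "smooth_on N (\<lambda>x. (f \<circ> \<tau>) (?T x))"
    by (rule smooth_on_compose[OF N W(2,5) smooth_on_subset[OF D(2)]]) (auto simp: N_def)
  then have "smooth_on N (f \<circ> \<sigma>)"
    by (rule smooth_on_cong[OF N, THEN iffD1, rotated]) (auto simp: N_def D_def f_inv_into_f)
  then show thesis using that[OF N xN] by (auto simp: N_def D_def)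
qed

lemma tvec_of_eq:
  assumes c: "(U, \<sigma>) \<in> A" and N: "open N" "x \<in> N" "N \<subseteq> U"
    and F: "smooth_on N F" "\<And>y. y \<in> N \<Longrightarrow> f (\<sigma> y) = F y"
  shows "smooth_near A f (\<sigma> x)" "tvec_of A \<sigma> x \<xi> f = frechet_derivative F (at x) \<xi>"
proof -
  have sm: "smooth_on N (f \<circ> \<sigma>)"
    by (rule smooth_on_cong[OF N(1), THEN iffD2, OF _ F(1)]) (simp add: F(2))
  show 1: "smooth_near A f (\<sigma> x)" by (rule smooth_nearI[OF c N sm])
  have "frechet_derivative F (at x) = frechet_derivative (f \<circ> \<sigma>) (at x)"
  proof (rule frechet_derivative_transform_within_open[OF _ N(1,2)])
    show "F differentiable at x"
      using smooth_on_has_derivative[OF F(1) N(2)] by (auto simp: differentiable_def)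
  qed (simp add: F(2))
  then show "tvec_of A \<sigma> x \<xi> f = frechet_derivative F (at x) \<xi>" using 1 by (simp add: tvec_of_def)
qed

lemma chart_has_derivative:
  assumes "(U, \<sigma>) \<in> A" "x \<in> U" "smooth_near A f (\<sigma> x)"
  shows "(f \<circ> \<sigma> has_derivative (\<lambda>\<xi>. tvec_of A \<sigma> x \<xi> f)) (at x)"
proof -
  obtain N where N: "open N" "x \<in> N" "N \<subseteq> U" "smooth_on N (f \<circ> \<sigma>)"
    using smooth_near_chartE[OF assms] .
  show ?thesis using smooth_on_has_derivative[OF N(4,2)] assms(3) by (simp add: tvec_of_def eta_contract_eq)
qed

lemma smooth_near_cong:
  assumes c: "(U, \<sigma>) \<in> A" and N: "open N" "x \<in> N" "N \<subseteq> U"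
    and eq: "\<And>y. y \<in> N \<Longrightarrow> f (\<sigma> y) = h (\<sigma> y)"
  shows "smooth_near A f (\<sigma> x) \<longleftrightarrow> smooth_near A h (\<sigma> x)" (is ?A)
    "tvec_of A \<sigma> x \<xi> f = tvec_of A \<sigma> x \<xi> h"
proof -
  have *: "smooth_near A h (\<sigma> x) \<and> tvec_of A \<sigma> x \<xi> h = tvec_of A \<sigma> x \<xi> f"
    if f: "smooth_near A f (\<sigma> x)" and eq: "\<And>y. y \<in> N \<Longrightarrow> f (\<sigma> y) = h (\<sigma> y)" for f h
  proof -
    have "x \<in> U" using N by auto
    then obtain M where M: "open M" "x \<in> M" "M \<subseteq> U" "smooth_on M (f \<circ> \<sigma>)"
      using smooth_near_chartE[OF c _ f] by blast
    have o: "open (M \<inter> N)" "x \<in> M \<inter> N" "M \<inter> N \<subseteq> U" using M N by auto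
    have sm: "smooth_on (M \<inter> N) (f \<circ> \<sigma>)" using smooth_on_subset[OF M(4)] by blast
    have h: "y \<in> M \<inter> N \<Longrightarrow> h (\<sigma> y) = (f \<circ> \<sigma>) y" for y using eq by auto
    have "tvec_of A \<sigma> x \<xi> h = tvec_of A \<sigma> x \<xi> f"
      using tvec_of_eq(2)[OF c o sm h] f by (simp only: tvec_of_def if_True)
    then show ?thesis using tvec_of_eq(1)[OF c o sm h] by simp
  qed
  show ?A using *[of f h] *[of h f] eq by metis
  then show "tvec_of A \<sigma> x \<xi> f = tvec_of A \<sigma> x \<xi> h"
    using *[of f h] eq by (cases "smooth_near A f (\<sigma> x)") (auto simp: tvec_of_def)
qed

lemma velocity_chart:
  assumes c: "(U, \<sigma>) \<in> A" "x \<in> U" and d: "(d has_vector_derivative \<xi>) (at t)" "d t = x"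
    and ev: "\<forall>\<^sub>F s in nhds t. \<gamma> s = \<sigma> (d s)"
  shows "velocity A \<gamma> t = tvec_of A \<sigma> x \<xi>"
proof
  fix f
  have \<gamma>t: "\<gamma> t = \<sigma> x" using eventually_nhds_x_imp_x[OF ev] d(2) by simp
  show "velocity A \<gamma> t f = tvec_of A \<sigma> x \<xi> f"
  proof (cases "smooth_near A f (\<sigma> x)")
    case True
    have D: "(f \<circ> \<sigma> has_derivative (\<lambda>\<xi>. tvec_of A \<sigma> x \<xi> f)) (at (d t))"
      using chart_has_derivative[OF c True] d(2) by simp
    have "((f \<circ> \<sigma> \<circ> d) has_derivative ((\<lambda>\<xi>. tvec_of A \<sigma> x \<xi> f) \<circ> (\<lambda>h. h *\<^sub>R \<xi>))) (at t)"
      by (rule diff_chain_at[OF d(1)[unfolded has_vector_derivative_def] D])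
    then have "((f \<circ> \<sigma> \<circ> d) has_real_derivative tvec_of A \<sigma> x \<xi> f) (at t)"
      unfolding has_field_derivative_def
      by (elim has_derivative_eq_rhs)
        (simp add: fun_eq_iff linear_scale[OF has_derivative_linear[OF D]])
    moreover have "\<forall>\<^sub>F s in nhds t. (f \<circ> \<sigma> \<circ> d) s = f (\<gamma> s)"
      using ev by eventually_elim simp
    ultimately have "((\<lambda>s. f (\<gamma> s)) has_real_derivative tvec_of A \<sigma> x \<xi> f) (at t)"
      using DERIV_cong_ev[OF refl _ refl, of "f \<circ> \<sigma> \<circ> d" "\<lambda>s. f (\<gamma> s)" t] by blast
    then show ?thesis using True \<gamma>t by (simp add: velocity_def DERIV_imp_deriv)
  qed (simp add: velocity_def tvec_of_def \<gamma>t)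
qed

text \<open>Collects the facts about the coordinate expression \<open>T\<close> of a map on its
  domain \<open>D\<close>. Applied to the identity map it describes a transition function.\<close>

lemma smooth_map_chart:
  assumes h: "smooth_map B A h" and c: "(V, \<rho>) \<in> B" "(U, \<sigma>) \<in> A"
  defines "T \<equiv> \<lambda>z. inv_into U \<sigma> (h (\<rho> z))" and "D \<equiv> {z \<in> V. h (\<rho> z) \<in> \<sigma> ` U}"
  shows "open D" "smooth_on D T" "\<And>z. z \<in> D \<Longrightarrow> \<sigma> (T z) = h (\<rho> z)" "\<And>z. z \<in> D \<Longrightarrow> T z \<in> U"
    "\<And>z x. z \<in> V \<Longrightarrow> x \<in> U \<Longrightarrow> h (\<rho> z) = \<sigma> x \<Longrightarrow> z \<in> D \<and> T z = x"
  using smooth_mapD[OF h c] chart_inj[OF c(2)] unfolding T_def D_def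
  by (auto simp: f_inv_into_f inv_into_into inv_into_f_eq)

text \<open>A curve is differentiated in the chart for one inclusion. For the other, a short
  straight segment x + t \<xi> stays in \<open>U\<close> and is mapped to a curve with the
  prescribed velocity.\<close>

lemma tangent_space_eq:
  assumes c: "(U, \<sigma>) \<in> A" "x \<in> U"
  shows "tangent_space A (\<sigma> x) = range (tvec_of A \<sigma> x)"
proof (intro set_eqI iffI)
  fix v assume "v \<in> tangent_space A (\<sigma> x)"
  then obtain \<gamma> \<epsilon> where \<gamma>: "v = velocity A \<gamma> 0" "\<epsilon> > 0" "smooth_map (interval_atlas \<epsilon>) A \<gamma>" "\<gamma> 0 = \<sigma> x"
    unfolding tangent_space_def by auto
  define T where "T t = inv_into U \<sigma> (\<gamma> t)" for t
  define D where "D = {z \<in> {-\<epsilon><..<\<epsilon>}. \<gamma> z \<in> \<sigma> ` U}"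
  have "({-\<epsilon><..<\<epsilon>}, \<lambda>t. t) \<in> interval_atlas \<epsilon>" by (simp add: interval_atlas_def)
  note T = smooth_map_chart[OF \<gamma>(3) this c(1), folded T_def, folded D_def]
  have 0: "0 \<in> D" "T 0 = x" using T(5)[of 0 x] c \<gamma> by auto
  have "\<forall>\<^sub>F s in nhds 0. \<gamma> s = \<sigma> (T s)"
    using eventually_nhds_in_open[OF T(1) 0(1)] by eventually_elim (simp add: T(3))
  moreover have "(T has_vector_derivative vector_derivative T (at 0)) (at 0)"
    using smooth_on_has_derivative[OF T(2) 0(1)]
    by (auto simp: differentiable_def vector_derivative_works[symmetric])
  ultimately show "v \<in> range (tvec_of A \<sigma> x)"
    using velocity_chart[OF c, of T _ 0 \<gamma>] 0(2) \<gamma>(1) by auto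
next
  fix v assume "v \<in> range (tvec_of A \<sigma> x)"
  then obtain \<xi> where v: "v = tvec_of A \<sigma> x \<xi>" by auto
  define d where "d t = x + t *\<^sub>R \<xi>" for t
  have dc: "continuous_on S d" "open S \<Longrightarrow> smooth_on S d" for S
    unfolding d_def by (auto intro!: continuous_intros smooth_intros)
  have "open (d -` U)" using chart_open[OF c(1)] dc(1) by (intro open_vimage) auto
  moreover have "0 \<in> d -` U" using c by (simp add: d_def)
  ultimately obtain \<epsilon> where e: "\<epsilon> > 0" "ball 0 \<epsilon> \<subseteq> d -` U" using openE by blast
  have ball: "{-\<epsilon><..<\<epsilon>} = ball 0 \<epsilon>" by (auto simp: dist_real_def)
  have "open {t \<in> {-\<epsilon><..<\<epsilon>}. \<sigma> (d t) \<in> \<tau> ` W} \<and>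
      smooth_on {t \<in> {-\<epsilon><..<\<epsilon>}. \<sigma> (d t) \<in> \<tau> ` W} (\<lambda>t. inv_into W \<tau> (\<sigma> (d t)))"
    if W: "(W, \<tau>) \<in> A" for W \<tau>
  proof -
    note T = smooth_map_chart[OF identity_smooth c(1) W]
    let ?D = "{x \<in> U. \<sigma> x \<in> \<tau> ` W}" and ?E = "{t \<in> {-\<epsilon><..<\<epsilon>}. \<sigma> (d t) \<in> \<tau> ` W}"
    have "?E = ball 0 \<epsilon> \<inter> d -` ?D" using e ball by auto
    moreover have "open (ball 0 \<epsilon> \<inter> d -` ?D)"
      by (rule open_Int[OF open_ball open_vimage[OF T(1) dc(1)]])
    ultimately have o: "open ?E" by (simp only:)
    have "smooth_on ?E (\<lambda>t. inv_into W \<tau> (\<sigma> (d t)))"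
      by (rule smooth_on_compose[OF o T(1,2) dc(2)[OF o]]) (use e ball in auto)
    then show ?thesis using o by blast
  qed
  moreover have "\<sigma> (d t) \<in> points A" if "t \<in> {-\<epsilon><..<\<epsilon>}" for t
    using that e ball pointsI[OF c(1)] by blast
  ultimately have "smooth_map (interval_atlas \<epsilon>) A (\<lambda>t. \<sigma> (d t))"
    unfolding smooth_map_def interval_atlas_def by (auto simp: points_def[of "{_}"])
  moreover have "velocity A (\<lambda>t. \<sigma> (d t)) 0 = v" unfolding v
    by (rule velocity_chart[OF c, where d = d])
      (auto simp: d_def[abs_def] intro!: derivative_eq_intros)
  ultimately show "v \<in> tangent_space A (\<sigma> x)"
    unfolding tangent_space_def using e(1)
    by (intro CollectI exI[of _ "\<lambda>t. \<sigma> (d t)"] conjI exI[of _ \<epsilon>]) (auto simp: d_def)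
qed

lemma tvec_of_linear:
  assumes "(U, \<sigma>) \<in> A" "x \<in> U"
  shows "tvec_of A \<sigma> x (a *\<^sub>R \<xi> + b *\<^sub>R \<eta>) = (\<lambda>f. a * tvec_of A \<sigma> x \<xi> f + b * tvec_of A \<sigma> x \<eta> f)"
proof
  fix f
  show "tvec_of A \<sigma> x (a *\<^sub>R \<xi> + b *\<^sub>R \<eta>) f = a * tvec_of A \<sigma> x \<xi> f + b * tvec_of A \<sigma> x \<eta> f"
  proof (cases "smooth_near A f (\<sigma> x)")
    case True
    have "linear (\<lambda>\<xi>. tvec_of A \<sigma> x \<xi> f)"
      by (rule has_derivative_linear[OF chart_has_derivative[OF assms True]])
    then show ?thesis
      using linear_add[of "\<lambda>\<xi>. tvec_of A \<sigma> x \<xi> f" "a *\<^sub>R \<xi>" "b *\<^sub>R \<eta>"]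
        linear_scale[of "\<lambda>\<xi>. tvec_of A \<sigma> x \<xi> f"] by simp
  qed (simp add: tvec_of_def)
qed

lemma tvec_of_scale: "(U, \<sigma>) \<in> A \<Longrightarrow> x \<in> U \<Longrightarrow> tvec_of A \<sigma> x (a *\<^sub>R \<xi>) = (\<lambda>f. a * tvec_of A \<sigma> x \<xi> f)"
  using tvec_of_linear[of U \<sigma> x a \<xi> 0 0] by simp

lemma tvec_of_zero: "(U, \<sigma>) \<in> A \<Longrightarrow> x \<in> U \<Longrightarrow> tvec_of A \<sigma> x 0 = (\<lambda>f. 0)"
  using tvec_of_linear[of U \<sigma> x 0 0 0 0] by simp

lemma tvec_of_chart_fun:
  assumes c: "(U, \<sigma>) \<in> A" "x \<in> U" and F: "smooth_on U F"
  shows "smooth_near A (\<lambda>q. F (inv_into U \<sigma> q)) (\<sigma> x)"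
    "tvec_of A \<sigma> x \<xi> (\<lambda>q. F (inv_into U \<sigma> q)) = frechet_derivative F (at x) \<xi>"
  using tvec_of_eq[OF c(1) chart_open[OF c(1)] c(2) order_refl F, of "\<lambda>q. F (inv_into U \<sigma> q)"]
  by (auto simp: inv_into_f_f[OF chart_inj[OF c(1)]])

lemma tvec_of_coord:
  assumes c: "(U, \<sigma>) \<in> A" "x \<in> U" and L: "bounded_linear L"
  shows "smooth_near A (\<lambda>q. L (inv_into U \<sigma> q)) (\<sigma> x)" "tvec_of A \<sigma> x \<xi> (\<lambda>q. L (inv_into U \<sigma> q)) = L \<xi>"
proof -
  have "smooth_on U L" using smooth_on_linear[OF L _ smooth_on_id] chart_open[OF c(1)] by auto
  note 1 = tvec_of_chart_fun[OF c this]
  have "frechet_derivative L (at x) = L"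
    using frechet_derivative_at[OF bounded_linear.has_derivative[OF L has_derivative_ident]] by simp
  then show "smooth_near A (\<lambda>q. L (inv_into U \<sigma> q)) (\<sigma> x)" "tvec_of A \<sigma> x \<xi> (\<lambda>q. L (inv_into U \<sigma> q)) = L \<xi>"
    using 1 by auto
qed

lemma tvec_of_inj:
  assumes "(U, \<sigma>) \<in> A" "x \<in> U" "tvec_of A \<sigma> x \<xi> = tvec_of A \<sigma> x \<eta>"
  shows "\<xi> = \<eta>"
proof (rule euclidean_eqI)
  fix b :: 'e
  show "\<xi> \<bullet> b = \<eta> \<bullet> b"
    using tvec_of_coord(2)[OF assms(1,2) bounded_linear_inner_left] assms(3) by metis
qed

lemma tangent_combination:
  assumes "p \<in> points A" "v \<in> tangent_space A p" "w \<in> tangent_space A p"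
  shows "(\<lambda>f. a * v f + b * w f) \<in> tangent_space A p"
proof -
  obtain U \<sigma> x where c: "(U, \<sigma>) \<in> A" "x \<in> U" "p = \<sigma> x" using pointsE[OF assms(1)] .
  then obtain \<xi> \<eta> where "v = tvec_of A \<sigma> x \<xi>" "w = tvec_of A \<sigma> x \<eta>"
    using assms tangent_space_eq by auto
  then show ?thesis using tvec_of_linear[OF c(1,2), of a \<xi> b \<eta>, symmetric] tangent_space_eq[OF c(1,2)] c(3) by simp
qed

lemma tangent_not_smooth: "p \<in> points A \<Longrightarrow> v \<in> tangent_space A p \<Longrightarrow> \<not> smooth_near A f p \<Longrightarrow> v f = 0"
  by (elim pointsE) (auto simp: tangent_space_eq tvec_of_def)

text \<open>Identities between flow maps hold on \<open>points A\<close> only, not on the whole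
  type. This lemma allows rewriting with them inside the argument of a tangent vector.\<close>

lemma tangent_cong:
  assumes "p \<in> points A" "v \<in> tangent_space A p" "\<And>q. q \<in> points A \<Longrightarrow> f q = h q"
  shows "v f = v h" "smooth_near A f p \<longleftrightarrow> smooth_near A h p"
proof -
  obtain U \<sigma> x where c: "(U, \<sigma>) \<in> A" "x \<in> U" "p = \<sigma> x" using pointsE[OF assms(1)] .
  then obtain \<xi> where v: "v = tvec_of A \<sigma> x \<xi>" using assms tangent_space_eq by auto
  have eq: "f (\<sigma> y) = h (\<sigma> y)" if "y \<in> U" for y using assms(3)[OF pointsI[OF c(1) that]] .
  note 1 = smooth_near_cong[OF c(1) chart_open[OF c(1)] c(2) order_refl, of f h, OF eq]
  show "v f = v h" unfolding v using 1(2) by simp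
  show "smooth_near A f p \<longleftrightarrow> smooth_near A h p" using 1(1) c by simp
qed

lemma
  assumes p: "p \<in> points A" and f: "smooth_near A f p" and h: "smooth_near A h p"
  shows smooth_near_mult: "smooth_near A (\<lambda>q. f q * h q) p"
    and tangent_add: "v \<in> tangent_space A p \<Longrightarrow> v (\<lambda>q. f q + h q) = v f + v h"
    and tangent_mult: "v \<in> tangent_space A p \<Longrightarrow> v (\<lambda>q. f q * h q) = v f * h p + f p * v h"
proof -
  obtain U \<sigma> x where c: "(U, \<sigma>) \<in> A" "x \<in> U" "p = \<sigma> x" using pointsE[OF p] .
  obtain N where N: "open N" "x \<in> N" "N \<subseteq> U" "smooth_on N (f \<circ> \<sigma>)"
    using smooth_near_chartE[OF c(1,2)] f c(3) by blast
  obtain M where M: "open M" "x \<in> M" "M \<subseteq> U" "smooth_on M (h \<circ> \<sigma>)"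
    using smooth_near_chartE[OF c(1,2)] h c(3) by blast
  have o: "open (M \<inter> N)" "x \<in> M \<inter> N" "M \<inter> N \<subseteq> U" using M N by auto
  have sm: "smooth_on (M \<inter> N) (f \<circ> \<sigma>)" "smooth_on (M \<inter> N) (h \<circ> \<sigma>)"
    using smooth_on_subset[OF M(4)] smooth_on_subset[OF N(4)] by blast+
  have s1: "smooth_on (M \<inter> N) (\<lambda>y. (f \<circ> \<sigma>) y + (h \<circ> \<sigma>) y)"
    and s2: "smooth_on (M \<inter> N) (\<lambda>y. (f \<circ> \<sigma>) y * (h \<circ> \<sigma>) y)"
    by (intro smooth_intros o sm)+
  have 1: "tvec_of A \<sigma> x \<xi> (\<lambda>q. f q + h q) = frechet_derivative (\<lambda>y. (f \<circ> \<sigma>) y + (h \<circ> \<sigma>) y) (at x) \<xi>" for \<xi>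
    using tvec_of_eq[OF c(1) o s1, of "\<lambda>q. f q + h q"] c(3) by auto
  have 2: "smooth_near A (\<lambda>q. f q * h q) p"
    "tvec_of A \<sigma> x \<xi> (\<lambda>q. f q * h q) = frechet_derivative (\<lambda>y. (f \<circ> \<sigma>) y * (h \<circ> \<sigma>) y) (at x) \<xi>" for \<xi>
    using tvec_of_eq[OF c(1) o s2, of "\<lambda>q. f q * h q"] c(3) by auto
  show "smooth_near A (\<lambda>q. f q * h q) p" by fact
  assume "v \<in> tangent_space A p"
  then obtain \<xi> where v: "v = tvec_of A \<sigma> x \<xi>" using tangent_space_eq[OF c(1,2)] c(3) by auto
  have df: "(f \<circ> \<sigma> has_derivative (\<lambda>\<xi>. tvec_of A \<sigma> x \<xi> f)) (at x)"
    and dh: "(h \<circ> \<sigma> has_derivative (\<lambda>\<xi>. tvec_of A \<sigma> x \<xi> h)) (at x)"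
    using chart_has_derivative[OF c(1,2)] f h c(3) by auto
  show "v (\<lambda>q. f q + h q) = v f + v h"
    unfolding v 1 frechet_derivative_at[OF has_derivative_add[OF df dh], symmetric] by simp
  show "v (\<lambda>q. f q * h q) = v f * h p + f p * v h"
    unfolding v 2(2) frechet_derivative_at[OF has_derivative_mult[OF df dh], symmetric] by (simp add: c(3))
qed

lemma smooth_fun_near: "smooth_fun A a \<Longrightarrow> p \<in> points A \<Longrightarrow> smooth_near A a p"
  by (elim pointsE) (auto simp: smooth_fun_def intro!: smooth_nearI chart_open)

lemma smooth_fieldE:
  assumes "smooth_field A Y" "(U, \<sigma>) \<in> A"
  obtains P where "smooth_on U P" "\<And>x. x \<in> U \<Longrightarrow> Y (\<sigma> x) = tvec_of A \<sigma> x (P x)"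
  using assms unfolding smooth_field_def by blast

lemma smooth_field_tangent:
  assumes "smooth_field A Y" "p \<in> points A" shows "Y p \<in> tangent_space A p"
  using assms(2)
proof (rule pointsE)
  fix U \<sigma> x assume c: "(U, \<sigma>) \<in> A" "x \<in> U" "p = \<sigma> x"
  then show ?thesis using smooth_fieldE[OF assms(1) c(1)] tangent_space_eq[OF c(1,2)] by (metis rangeI)
qed

lemma field_apply_chart:
  assumes c: "(U, \<sigma>) \<in> A" "x \<in> U" and P: "smooth_on U P" "\<And>y. y \<in> U \<Longrightarrow> Y (\<sigma> y) = tvec_of A \<sigma> y (P y)"
    and N: "open N" "x \<in> N" "N \<subseteq> U" "smooth_on N (f \<circ> \<sigma>)"
  shows "smooth_near A (\<lambda>q. Y q f) (\<sigma> x)"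
    "tvec_of A \<sigma> x \<xi> (\<lambda>q. Y q f) = frechet_derivative (\<lambda>y. frechet_derivative (f \<circ> \<sigma>) (at y) (P y)) (at x) \<xi>"
proof -
  have "smooth_on N (\<lambda>y. frechet_derivative (f \<circ> \<sigma>) (at y) (P y))"
    by (intro smooth_on_derivative_field N smooth_on_subset[OF P(1)])
  moreover have "Y (\<sigma> y) f = frechet_derivative (f \<circ> \<sigma>) (at y) (P y)" if "y \<in> N" for y
    using P(2)[of y] that N smooth_nearI[OF c(1) N(1) that N(3,4)] by (auto simp: tvec_of_def)
  ultimately show "smooth_near A (\<lambda>q. Y q f) (\<sigma> x)"
    "tvec_of A \<sigma> x \<xi> (\<lambda>q. Y q f) = frechet_derivative (\<lambda>y. frechet_derivative (f \<circ> \<sigma>) (at y) (P y)) (at x) \<xi>"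
    using tvec_of_eq[OF c(1) N(1-3), of "\<lambda>y. frechet_derivative (f \<circ> \<sigma>) (at y) (P y)" "\<lambda>q. Y q f"] by auto
qed

lemma smooth_field_apply:
  assumes "smooth_field A Y" "p \<in> points A" "smooth_near A f p"
  shows "smooth_near A (\<lambda>q. Y q f) p"
  using assms(2)
proof (rule pointsE)
  fix U \<sigma> x assume c: "(U, \<sigma>) \<in> A" "x \<in> U" "p = \<sigma> x"
  obtain P where P: "smooth_on U P" "\<And>y. y \<in> U \<Longrightarrow> Y (\<sigma> y) = tvec_of A \<sigma> y (P y)"
    using smooth_fieldE[OF assms(1) c(1)] by blast
  obtain N where N: "open N" "x \<in> N" "N \<subseteq> U" "smooth_on N (f \<circ> \<sigma>)"
    using smooth_near_chartE[OF c(1,2)] assms(3) c(3) by blast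
  show ?thesis using field_apply_chart(1)[OF c(1,2) P N] c(3) by simp
qed

text \<open>Each of the two iterated derivatives of \<open>f\<close> contains the same second
  derivative in the directions \<open>P x\<close> and \<open>Q x\<close>. These cancel by symmetry,
  and only derivatives of the coordinate fields remain.\<close>

lemma lie_bracket_chart:
  assumes c: "(U, \<sigma>) \<in> A" "x \<in> U"
    and P: "smooth_on U P" "\<And>y. y \<in> U \<Longrightarrow> Y (\<sigma> y) = tvec_of A \<sigma> y (P y)"
    and Q: "smooth_on U Q" "\<And>y. y \<in> U \<Longrightarrow> Z (\<sigma> y) = tvec_of A \<sigma> y (Q y)"
  shows "lie_bracket A Y Z (\<sigma> x) =
    tvec_of A \<sigma> x (frechet_derivative Q (at x) (P x) - frechet_derivative P (at x) (Q x))"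
proof
  fix f
  show "lie_bracket A Y Z (\<sigma> x) f =
    tvec_of A \<sigma> x (frechet_derivative Q (at x) (P x) - frechet_derivative P (at x) (Q x)) f"
  proof (cases "smooth_near A f (\<sigma> x)")
    case True
    obtain N where N: "open N" "x \<in> N" "N \<subseteq> U" "smooth_on N (f \<circ> \<sigma>)"
      using smooth_near_chartE[OF c True] .
    let ?F = "f \<circ> \<sigma>"
    let ?D = "\<lambda>a y. frechet_derivative ?F (at y) a"
    have *: "frechet_derivative (\<lambda>y. frechet_derivative ?F (at y) (R y)) (at x) \<xi> =
        frechet_derivative (?D (R x)) (at x) \<xi> + ?D (frechet_derivative R (at x) \<xi>) x"
      if "smooth_on U R" for R \<xi>
      by (rule fun_cong[OF frechet_derivative_at[OF derivative_of_derivative_field[OF N(1,4)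
          smooth_on_has_derivative[OF that c(2)] N(2)], symmetric]])
    have "linear (frechet_derivative ?F (at x))"
      by (rule has_derivative_linear[OF smooth_on_has_derivative[OF N(4,2)]])
    moreover have "frechet_derivative (?D (Q x)) (at x) (P x) = frechet_derivative (?D (P x)) (at x) (Q x)"
      by (rule symmetric_second_derivative[OF N(1,4,2)])
    moreover have "tvec_of A \<sigma> x \<xi> f = frechet_derivative ?F (at x) \<xi>" for \<xi>
      using True by (simp add: tvec_of_def)
    ultimately show ?thesis
      using True P(2)[OF c(2)] Q(2)[OF c(2)] field_apply_chart(2)[OF c P N] field_apply_chart(2)[OF c Q N]
        *[OF P(1)] *[OF Q(1)]
      by (simp add: lie_bracket_def linear_diff)
  qed (simp add: lie_bracket_def tvec_of_def)
qed

lemma smooth_field_combination: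
  assumes "smooth_fun A a" "smooth_fun A b" "smooth_field A Y" "smooth_field A Z"
  shows "smooth_field A (\<lambda>p f. a p * Y p f + b p * Z p f)"
  unfolding smooth_field_def
proof clarify
  fix U \<sigma> assume c: "(U, \<sigma>) \<in> A"
  obtain P where P: "smooth_on U P" "\<And>x. x \<in> U \<Longrightarrow> Y (\<sigma> x) = tvec_of A \<sigma> x (P x)"
    using smooth_fieldE[OF assms(3) c] by blast
  obtain Q where Q: "smooth_on U Q" "\<And>x. x \<in> U \<Longrightarrow> Z (\<sigma> x) = tvec_of A \<sigma> x (Q x)"
    using smooth_fieldE[OF assms(4) c] by blast
  have "smooth_on U (\<lambda>x. (a \<circ> \<sigma>) x *\<^sub>R P x + (b \<circ> \<sigma>) x *\<^sub>R Q x)"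
    using assms(1,2) c by (intro smooth_intros chart_open[OF c] P Q) (auto simp: smooth_fun_def comp_def)
  moreover have "(\<lambda>f. a (\<sigma> x) * Y (\<sigma> x) f + b (\<sigma> x) * Z (\<sigma> x) f) =
      tvec_of A \<sigma> x ((a \<circ> \<sigma>) x *\<^sub>R P x + (b \<circ> \<sigma>) x *\<^sub>R Q x)" if "x \<in> U" for x
    using tvec_of_linear[OF c that] P(2)[OF that] Q(2)[OF that] by simp
  ultimately show "\<exists>P. smooth_on U P \<and> (\<forall>x\<in>U. (\<lambda>f. a (\<sigma> x) * Y (\<sigma> x) f + b (\<sigma> x) * Z (\<sigma> x) f) = tvec_of A \<sigma> x (P x))"
    by blast
qed

lemma smooth_near_compose:
  assumes h: "smooth_map A A h" and p: "p \<in> points A" and f: "smooth_near A f (h p)"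
  shows "smooth_near A (f \<circ> h) p"
proof -
  obtain U \<sigma> x where c: "(U, \<sigma>) \<in> A" "x \<in> U" "p = \<sigma> x" using pointsE[OF p] .
  have "h p \<in> points A" using h p unfolding smooth_map_def by blast
  then obtain W \<tau> y where d: "(W, \<tau>) \<in> A" "y \<in> W" "h p = \<tau> y" by (rule pointsE)
  obtain N where N: "open N" "y \<in> N" "N \<subseteq> W" "smooth_on N (f \<circ> \<tau>)"
    using smooth_near_chartE[OF d(1,2)] f d(3) by metis
  define T where "T x = inv_into W \<tau> (h (\<sigma> x))" for x
  define D where "D = {x \<in> U. h (\<sigma> x) \<in> \<tau> ` W}"
  note T = smooth_map_chart[OF h c(1) d(1), folded T_def, folded D_def]
  have xD: "x \<in> D" "T x = y" using T(5)[of x y] c d by auto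
  have o: "open (D \<inter> T -` N)"
    by (rule continuous_open_preimage[OF smooth_on_continuous_on[OF T(2)] T(1) N(1)])
  have s: "smooth_on (D \<inter> T -` N) (\<lambda>x. (f \<circ> \<tau>) (T x))"
    by (rule smooth_on_compose[OF o N(1,4) smooth_on_subset[OF T(2)]]) auto
  show ?thesis unfolding c(3)
    by (rule tvec_of_eq(1)[OF c(1) o _ _ s]) (use xD N T(3) in \<open>auto simp: D_def\<close>)
qed

lemma differential_tangent:
  assumes h: "smooth_map A A h" and p: "p \<in> points A" and v: "v \<in> tangent_space A p"
  shows "differential A A h p v \<in> tangent_space A (h p)"
proof -
  obtain U \<sigma> x where c: "(U, \<sigma>) \<in> A" "x \<in> U" "p = \<sigma> x" using pointsE[OF p] .
  obtain \<xi> where v: "v = tvec_of A \<sigma> x \<xi>" using v tangent_space_eq[OF c(1,2)] c(3) by auto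
  have "h p \<in> points A" using h p unfolding smooth_map_def by blast
  then obtain W \<tau> y where d: "(W, \<tau>) \<in> A" "y \<in> W" "h p = \<tau> y" by (rule pointsE)
  define T where "T x = inv_into W \<tau> (h (\<sigma> x))" for x
  define D where "D = {x \<in> U. h (\<sigma> x) \<in> \<tau> ` W}"
  note T = smooth_map_chart[OF h c(1) d(1), folded T_def, folded D_def]
  have xD: "x \<in> D" "T x = y" using T(5)[of x y] c d by auto
  have "differential A A h p v f = tvec_of A \<tau> y (frechet_derivative T (at x) \<xi>) f" for f
  proof (cases "smooth_near A f (h p)")
    case True
    have fy: "smooth_near A f (\<tau> y)" using True d by simp
    have "((f \<circ> \<tau>) \<circ> T has_derivative (\<lambda>\<xi>. tvec_of A \<tau> y \<xi> f) \<circ> frechet_derivative T (at x)) (at x)"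
      by (rule diff_chain_at[OF smooth_on_has_derivative[OF T(2) xD(1)]])
        (use chart_has_derivative[OF d(1,2) fy] xD in simp)
    then have "((f \<circ> h) \<circ> \<sigma> has_derivative (\<lambda>\<xi>. tvec_of A \<tau> y \<xi> f) \<circ> frechet_derivative T (at x)) (at x)"
      by (rule has_derivative_transform_within_open[OF _ T(1) xD(1)]) (simp add: T(3))
    from frechet_derivative_at[OF this]
    have "frechet_derivative ((f \<circ> h) \<circ> \<sigma>) (at x) \<xi> = tvec_of A \<tau> y (frechet_derivative T (at x) \<xi>) f"
      by (auto dest: fun_cong[of _ _ \<xi>])
    moreover have "smooth_near A (f \<circ> h) (\<sigma> x)"
      using smooth_near_compose[OF h p True] c(3) by simp
    ultimately show ?thesis using True by (simp add: differential_def v tvec_of_def[of A \<sigma>])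
  qed (simp add: differential_def tvec_of_def d)
  then have "differential A A h p v = tvec_of A \<tau> y (frechet_derivative T (at x) \<xi>)" by blast
  then show ?thesis using tangent_space_eq[OF d(1,2)] d(3) by simp
qed

lemma differential_combination:
  "differential A A h p (\<lambda>f. a * v f + b * w f) =
   (\<lambda>f. a * differential A A h p v f + b * differential A A h p w f)"
  by (auto simp: differential_def)

lemma differential_compose:
  assumes "smooth_map A A h" "k p \<in> points A"
  shows "differential A A h (k p) (differential A A k p v) = differential A A (h \<circ> k) p v"
  using smooth_near_compose[OF assms] by (auto simp: differential_def fun_eq_iff o_assoc)

end

section \<open>Flows and Lie derivatives\<close>

lemma DERIV_transform_eventually:
  fixes f :: "real \<Rightarrow> real"
  assumes "(f has_real_derivative D) (at x)" "\<forall>\<^sub>F y in nhds x. f y = g y"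
  shows "(g has_real_derivative D) (at x)"
  using DERIV_cong_ev[OF refl assms(2) refl, of D] assms(1) by simp

locale smooth_flow = smooth_manifold A
  for A :: "('m, 'e::euclidean_space) atlas" +
  fixes F :: "'m \<Rightarrow> 'm tvec" and \<phi> :: "real \<Rightarrow> 'm \<Rightarrow> 'm"
  assumes F: "smooth_field A F" and flow: "is_flow A F \<phi>"
begin

lemma flow_zero: "p \<in> points A \<Longrightarrow> \<phi> 0 p = p"
  and flow_add: "p \<in> points A \<Longrightarrow> \<phi> (s + t) p = \<phi> s (\<phi> t p)"
  and flow_velocity: "p \<in> points A \<Longrightarrow> velocity A (\<lambda>t. \<phi> t p) 0 = F p"
  and flow_smooth: "smooth_map (time_product A) A (\<lambda>(t, p). \<phi> t p)"
  using flow unfolding is_flow_def by auto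

lemma flow_points: "p \<in> points A \<Longrightarrow> \<phi> t p \<in> points A"
proof -
  assume "p \<in> points A"
  then obtain U \<sigma> x where c: "(U, \<sigma>) \<in> A" "x \<in> U" "p = \<sigma> x" by (rule pointsE)
  have "(UNIV \<times> U, \<lambda>(t, x). (t, \<sigma> x)) \<in> time_product A"
    unfolding time_product_def using c by blast
  from pointsI[OF this, of "(t, x)"] have "(t, p) \<in> points (time_product A)"
    using c by simp
  then show ?thesis using flow_smooth unfolding smooth_map_def by auto
qed

lemma flow_inverse: "p \<in> points A \<Longrightarrow> \<phi> (-t) (\<phi> t p) = p" "p \<in> points A \<Longrightarrow> \<phi> t (\<phi> (-t) p) = p"
  using flow_add[of p "-t" t] flow_add[of p t "-t"] flow_zero by auto

lemma flow_chart:
  assumes c: "(U, \<sigma>) \<in> A" "(W, \<tau>) \<in> A"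
  defines "T \<equiv> \<lambda>z. inv_into W \<tau> (\<phi> (fst z) (\<sigma> (snd z)))"
    and "D \<equiv> {z. snd z \<in> U \<and> \<phi> (fst z) (\<sigma> (snd z)) \<in> \<tau> ` W}"
  shows "open D" "smooth_on D T" "\<And>t x. (t, x) \<in> D \<Longrightarrow> \<tau> (T (t, x)) = \<phi> t (\<sigma> x)"
    "\<And>z. z \<in> D \<Longrightarrow> T z \<in> W"
    "\<And>t x y. x \<in> U \<Longrightarrow> y \<in> W \<Longrightarrow> \<phi> t (\<sigma> x) = \<tau> y \<Longrightarrow> (t, x) \<in> D \<and> T (t, x) = y"
proof -
  have c': "(UNIV \<times> U, \<lambda>(t, x). (t, \<sigma> x)) \<in> time_product A"
    unfolding time_product_def using c by blast
  have D: "D = {z \<in> UNIV \<times> U. (\<lambda>(t, p). \<phi> t p) ((\<lambda>(t, x). (t, \<sigma> x)) z) \<in> \<tau> ` W}"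
    unfolding D_def by auto
  have T: "T = (\<lambda>z. inv_into W \<tau> ((\<lambda>(t, p). \<phi> t p) ((\<lambda>(t, x). (t, \<sigma> x)) z)))"
    unfolding T_def by (auto simp: fun_eq_iff)
  note * = smooth_map_chart[OF flow_smooth c' c(2)]
  show "open D" unfolding D by (rule *(1))
  show "smooth_on D T" unfolding D T by (rule *(2))
  show "\<tau> (T (t, x)) = \<phi> t (\<sigma> x)" if "(t, x) \<in> D" for t x using *(3)[OF that[unfolded D]] unfolding T by simp
  show "T z \<in> W" if "z \<in> D" for z using *(4)[OF that[unfolded D]] unfolding T by simp
  show "(t, x) \<in> D \<and> T (t, x) = y" if "x \<in> U" "y \<in> W" "\<phi> t (\<sigma> x) = \<tau> y" for t x y
    using *(5)[of "(t, x)" y] that unfolding T D by simp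
qed

lemma flow_map_smooth: "smooth_map A A (\<phi> t)"
  unfolding smooth_map_def
proof (intro conjI ballI, goal_cases)
  case 1 then show ?case using flow_points by blast
next
  case (2 c)
  have "open {x \<in> U. \<phi> t (\<sigma> x) \<in> \<tau> ` W} \<and>
      smooth_on {x \<in> U. \<phi> t (\<sigma> x) \<in> \<tau> ` W} (\<lambda>x. inv_into W \<tau> (\<phi> t (\<sigma> x)))"
    if c: "(U, \<sigma>) \<in> A" "(W, \<tau>) \<in> A" for U \<sigma> W \<tau>
  proof -
    let ?D = "{z. snd z \<in> U \<and> \<phi> (fst z) (\<sigma> (snd z)) \<in> \<tau> ` W}"
    let ?E = "{x \<in> U. \<phi> t (\<sigma> x) \<in> \<tau> ` W}"
    note T = flow_chart[OF c]
    have "?E = (\<lambda>x. (t, x)) -` ?D" by auto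
    moreover have "open ((\<lambda>x. (t, x)) -` ?D)"
      by (rule open_vimage[OF T(1)]) (auto intro!: continuous_intros)
    ultimately have o: "open ?E" by (simp only:)
    have "smooth_on ?E (\<lambda>x. (\<lambda>z. inv_into W \<tau> (\<phi> (fst z) (\<sigma> (snd z)))) (t, x))"
      by (rule smooth_on_compose[OF o T(1,2)]) (auto intro!: smooth_intros o)
    then show ?thesis using o by simp
  qed
  then show ?case using 2 by auto
qed

text \<open>With \<open>G (s, x) = f (\<phi> (-s) (\<sigma> x))\<close>, differentiating \<open>D G (s, x(s)) (0, Y)\<close> along an orbit
  gives the two terms of the bracket, since the mixed derivatives of \<open>G\<close> commute.\<close>

lemma lie_derivative_at_0:
  assumes Y: "smooth_field A Y" and p: "p \<in> points A" and f: "smooth_near A f p"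
  shows "((\<lambda>s. Y (\<phi> s p) (f \<circ> \<phi> (-s))) has_real_derivative lie_bracket A F Y p f) (at 0)"
proof -
  obtain U \<sigma> x0 where c: "(U, \<sigma>) \<in> A" "x0 \<in> U" and px: "p = \<sigma> x0" using pointsE[OF p] .
  obtain P where P: "smooth_on U P" "\<And>x. x \<in> U \<Longrightarrow> F (\<sigma> x) = tvec_of A \<sigma> x (P x)"
    using smooth_fieldE[OF F c(1)] by blast
  obtain Q where Q: "smooth_on U Q" "\<And>x. x \<in> U \<Longrightarrow> Y (\<sigma> x) = tvec_of A \<sigma> x (Q x)"
    using smooth_fieldE[OF Y c(1)] by blast
  obtain N where N: "open N" "x0 \<in> N" "N \<subseteq> U" "smooth_on N (f \<circ> \<sigma>)"
    using smooth_near_chartE[OF c] f px by blast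
  define g where "g = f \<circ> \<sigma>"
  define T where "T z = inv_into U \<sigma> (\<phi> (fst z) (\<sigma> (snd z)))" for z
  define D where "D = {z. snd z \<in> U \<and> \<phi> (fst z) (\<sigma> (snd z)) \<in> \<sigma> ` U}"
  note T = flow_chart[OF c(1) c(1), folded T_def, folded D_def]
  have T0: "(0, x) \<in> D" "T (0, x) = x" if "x \<in> U" for x
    using T(5)[OF that that] flow_zero[OF pointsI[OF c(1) that]] by auto
  \<comment> \<open>The test function is composed with the flow at time \<open>-s\<close>, so the
    flow chart is needed at negative times.\<close>
  define m :: "real \<times> 'e \<Rightarrow> real \<times> 'e" where "m z = (- fst z, snd z)" for z
  have m: "continuous_on UNIV m" "\<And>S. open S \<Longrightarrow> smooth_on S m"
    unfolding m_def by (auto intro!: continuous_intros smooth_intros)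
  define E where "E = m -` D"
  have E: "open E" unfolding E_def by (rule open_vimage[OF T(1) m(1)])
  have Tm: "smooth_on E (\<lambda>z. T (m z))"
    by (rule smooth_on_compose[OF E T(1,2) m(2)[OF E]]) (auto simp: E_def)
  \<comment> \<open>The pairs (s, x) for which the flow at time \<open>-s\<close> moves x into
    \<open>N\<close>, where \<open>f\<close> is smooth in coordinates.\<close>
  define \<Omega> where "\<Omega> = E \<inter> (\<lambda>z. T (m z)) -` N"
  have \<Omega>: "open \<Omega>" unfolding \<Omega>_def
    by (rule continuous_open_preimage[OF smooth_on_continuous_on[OF Tm] E N(1)])
  define G where "G z = g (T (m z))" for z
  have G: "smooth_on \<Omega> G" unfolding G_def g_def
    by (rule smooth_on_compose[OF \<Omega> N(1) N(4) smooth_on_subset[OF Tm]]) (auto simp: \<Omega>_def)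
  have GU: "snd z \<in> U" if "z \<in> \<Omega>" for z using that by (auto simp: \<Omega>_def E_def m_def D_def)
  have Geq: "G (s, x) = f (\<phi> (-s) (\<sigma> x))" if "(s, x) \<in> \<Omega>" for s x
    using that T(3)[of "-s" x] by (auto simp: G_def g_def m_def \<Omega>_def E_def)
  have \<Omega>0: "(0, x) \<in> \<Omega>" "G (0, x) = g x" if "x \<in> N" for x
    using T0[of x] that N(3) by (auto simp: \<Omega>_def E_def m_def G_def subset_iff)
  define \<gamma> where "\<gamma> s = T (s, x0)" for s
  define S where "S = {s. (s, x0) \<in> D}"
  have S: "open S"
  proof -
    have "open ((\<lambda>s. (s, x0)) -` D)" by (rule open_vimage[OF T(1)]) (intro continuous_intros)
    then show ?thesis by (simp add: S_def vimage_def)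
  qed
  have S0: "0 \<in> S" "\<gamma> 0 = x0" using T0[OF c(2)] by (auto simp: S_def \<gamma>_def)
  have \<gamma>s: "smooth_on S \<gamma>" unfolding \<gamma>_def
    by (rule smooth_on_compose[OF S T(1,2)]) (intro smooth_intros S, auto simp: S_def)
  have \<gamma>\<sigma>: "\<phi> s p = \<sigma> (\<gamma> s)" "\<gamma> s \<in> U" if "s \<in> S" for s
    using T(3)[of s x0] T(4)[of "(s, x0)"] that by (auto simp: S_def \<gamma>_def px)
  have evS: "\<forall>\<^sub>F s in nhds 0. s \<in> S" by (rule eventually_nhds_in_open[OF S S0(1)])
  have d\<gamma>: "(\<gamma> has_vector_derivative P x0) (at 0)"
  proof -
    have *: "(\<gamma> has_vector_derivative vector_derivative \<gamma> (at 0)) (at 0)"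
      using smooth_on_has_derivative[OF \<gamma>s S0(1)]
      by (auto simp: differentiable_def vector_derivative_works[symmetric])
    have "\<forall>\<^sub>F s in nhds 0. \<phi> s p = \<sigma> (\<gamma> s)" using evS by eventually_elim (rule \<gamma>\<sigma>)
    from velocity_chart[OF c * S0(2) this] flow_velocity[OF p] P(2)[OF c(2)]
    have "tvec_of A \<sigma> x0 (P x0) = tvec_of A \<sigma> x0 (vector_derivative \<gamma> (at 0))" by (simp add: px)
    then show ?thesis using tvec_of_inj[OF c] * by metis
  qed
  have DG: "(G has_derivative frechet_derivative G (at z)) (at z)" if "z \<in> \<Omega>" for z
    by (rule smooth_on_has_derivative[OF G that])
  have slice: "open {x. (s, x) \<in> \<Omega>}" for s
  proof -
    have "open ((\<lambda>x. (s, x)) -` \<Omega>)" by (rule open_vimage[OF \<Omega>]) (intro continuous_intros)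
    then show ?thesis by (simp add: vimage_def)
  qed
  have slice_smooth: "smooth_on {x. (s, x) \<in> \<Omega>} (\<lambda>x. G (s, x))" for s
    by (rule smooth_on_compose[OF slice \<Omega> G]) (intro smooth_intros slice, auto)
  have sd: "((\<lambda>x. h (s, x)) has_derivative (\<lambda>v. h' (0, v))) (at x)"
    if "(h has_derivative h') (at (s, x))" for h :: "real \<times> 'e \<Rightarrow> real" and h' s x
  proof -
    have "((\<lambda>x. (s, x)) has_derivative (\<lambda>v. (0, v))) (at x)"
      by (auto intro!: derivative_eq_intros)
    from diff_chain_at[OF this that] show ?thesis by (simp add: comp_def)
  qed
  have slice_d: "frechet_derivative (\<lambda>x. G (s, x)) (at x) v = frechet_derivative G (at (s, x)) (0, v)"
    if "(s, x) \<in> \<Omega>" for s x v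
    using fun_cong[OF frechet_derivative_at[OF sd[OF DG[OF that]]]] by simp
  \<comment> \<open>The space derivative of \<open>G\<close> along \<open>Y\<close>. By
    \<open>val\<close>, its restriction to the orbit is the function to be differentiated.\<close>
  define \<Phi> where "\<Phi> z = frechet_derivative G (at z) (0, Q (snd z))" for z
  have val: "Y (\<phi> s p) (f \<circ> \<phi> (-s)) = \<Phi> (s, \<gamma> s)" if s: "s \<in> S" "(s, \<gamma> s) \<in> \<Omega>" for s
  proof -
    have "tvec_of A \<sigma> (\<gamma> s) (Q (\<gamma> s)) (f \<circ> \<phi> (-s)) = frechet_derivative (\<lambda>x. G (s, x)) (at (\<gamma> s)) (Q (\<gamma> s))"
      by (rule tvec_of_eq(2)[OF c(1) slice _ _ slice_smooth])
        (use s GU in \<open>auto simp: Geq\<close>)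
    then show ?thesis using slice_d[OF s(2)] \<gamma>\<sigma>[OF s(1)] Q(2) by (simp add: \<Phi>_def)
  qed
  have c\<gamma>: "isCont (\<lambda>s. (s, \<gamma> s)) 0"
    using smooth_on_isCont[OF S \<gamma>s S0(1)] by (intro continuous_intros)
  have ev\<Omega>: "\<forall>\<^sub>F s in nhds 0. (s, \<gamma> s) \<in> \<Omega>"
  proof -
    have "((\<lambda>s. (s, \<gamma> s)) \<longlongrightarrow> (0, x0)) (nhds 0)"
      using c\<gamma> S0(2) tendsto_at_iff_tendsto_nhds[of "\<lambda>s. (s, \<gamma> s)" 0] by (simp add: isCont_def)
    then show ?thesis using \<Omega> \<Omega>0(1)[OF N(2)] topological_tendstoD by blast
  qed
  have dQ: "((\<lambda>z. (0::real, Q (snd z))) has_derivative (\<lambda>v. (0, frechet_derivative Q (at x0) (snd v)))) (at (0::real, x0))"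
  proof -
    have "(Q has_derivative frechet_derivative Q (at x0)) (at (snd (0, x0)))"
      using smooth_on_has_derivative[OF Q(1) c(2)] by simp
    from diff_chain_at[OF has_derivative_snd[OF has_derivative_ident] this]
    have "((\<lambda>z::real \<times> 'e. Q (snd z)) has_derivative (\<lambda>v. frechet_derivative Q (at x0) (snd v))) (at (0, x0))"
      by (simp add: comp_def)
    then show ?thesis by (intro has_derivative_Pair has_derivative_const)
  qed
  note z0 = \<Omega>0(1)[OF N(2)]
  define \<Phi>' where "\<Phi>' v = frechet_derivative (\<lambda>z. frechet_derivative G (at z) (0, Q x0)) (at (0, x0)) v
      + frechet_derivative G (at (0, x0)) (0, frechet_derivative Q (at x0) (snd v))" for v
  have d\<Phi>: "(\<Phi> has_derivative \<Phi>') (at (0, x0))"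
    using derivative_of_derivative_field[OF \<Omega> G dQ z0] unfolding \<Phi>_def \<Phi>'_def by simp
  have lin: "linear \<Phi>'" by (rule has_derivative_linear[OF d\<Phi>])
  have "((\<lambda>s. \<Phi> (s, \<gamma> s)) has_derivative (\<lambda>h. \<Phi>' (h, h *\<^sub>R P x0))) (at 0)"
  proof -
    have "((\<lambda>s. (s, \<gamma> s)) has_derivative (\<lambda>h. (h, h *\<^sub>R P x0))) (at 0)"
      using d\<gamma>[unfolded has_vector_derivative_def] by (intro has_derivative_Pair has_derivative_ident)
    from diff_chain_at[OF this, of \<Phi> \<Phi>'] d\<Phi> S0(2) show ?thesis by (simp add: comp_def)
  qed
  moreover have "\<Phi>' (h, h *\<^sub>R P x0) = \<Phi>' (1, P x0) * h" for h
    using linear_scale[OF lin, of h "(1, P x0)"] by simp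
  ultimately have "((\<lambda>s. \<Phi> (s, \<gamma> s)) has_real_derivative \<Phi>' (1, P x0)) (at 0)"
    unfolding has_field_derivative_def by (elim has_derivative_eq_rhs) (rule ext)
  moreover have "\<forall>\<^sub>F s in nhds 0. \<Phi> (s, \<gamma> s) = Y (\<phi> s p) (f \<circ> \<phi> (-s))"
    using evS ev\<Omega> by eventually_elim (simp add: val)
  ultimately have main: "((\<lambda>s. Y (\<phi> s p) (f \<circ> \<phi> (-s))) has_real_derivative \<Phi>' (1, P x0)) (at 0)"
    by (rule DERIV_transform_eventually)
  \<comment> \<open>At time 0 the time derivative of \<open>G\<close> is \<open>- F f\<close>; the
    sign comes from the reversed time.\<close>
  have dt: "frechet_derivative G (at (0, x)) (1, 0) = - frechet_derivative g (at x) (P x)" if x: "x \<in> N" for x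
  proof -
    have xU: "x \<in> U" using x N by auto
    have xp: "\<sigma> x \<in> points A" by (rule pointsI[OF c(1) xU])
    have "((\<lambda>s. G (s, x)) has_derivative (\<lambda>h. frechet_derivative G (at (0, x)) (h, 0))) (at 0)"
    proof -
      have "((\<lambda>s. (s, x)) has_derivative (\<lambda>h. (h, 0))) (at (0::real))"
        by (auto intro!: derivative_eq_intros)
      from diff_chain_at[OF this, of G] DG[OF \<Omega>0(1)[OF x]] show ?thesis by (simp add: comp_def)
    qed
    moreover have "frechet_derivative G (at (0, x)) (h, 0) = frechet_derivative G (at (0, x)) (1, 0) * h" for h
      using linear_scale[OF has_derivative_linear[OF DG[OF \<Omega>0(1)[OF x]]], of h "(1, 0)"] by simp
    ultimately have "((\<lambda>s. G (s, x)) has_real_derivative frechet_derivative G (at (0, x)) (1, 0)) (at 0)"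
      unfolding has_field_derivative_def by (elim has_derivative_eq_rhs) (rule ext)
    moreover have "\<forall>\<^sub>F s in nhds 0. (s, x) \<in> \<Omega>"
    proof -
      have "open ((\<lambda>s. (s, x)) -` \<Omega>)" by (rule open_vimage[OF \<Omega>]) (auto intro!: continuous_intros)
      then show ?thesis using eventually_nhds_in_open[of _ 0] \<Omega>0(1)[OF x] by fastforce
    qed
    then have "\<forall>\<^sub>F s in nhds 0. G (s, x) = f (\<phi> (-s) (\<sigma> x))" by eventually_elim (rule Geq)
    ultimately have "((\<lambda>s. f (\<phi> (-s) (\<sigma> x))) has_real_derivative frechet_derivative G (at (0, x)) (1, 0)) (at 0)"
      by (rule DERIV_transform_eventually)
    then have df: "((\<lambda>s. f (\<phi> s (\<sigma> x))) has_real_derivative - frechet_derivative G (at (0, x)) (1, 0)) (at 0)"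
      using DERIV_mirror[of "\<lambda>s. f (\<phi> s (\<sigma> x))" "- frechet_derivative G (at (0, x)) (1, 0)" 0] by simp
    have sn: "smooth_near A f (\<sigma> x)" by (rule smooth_nearI[OF c(1) N(1) x N(3,4)])
    then have "velocity A (\<lambda>s. \<phi> s (\<sigma> x)) 0 f = - frechet_derivative G (at (0, x)) (1, 0)"
      using DERIV_imp_deriv[OF df] by (simp add: velocity_def flow_zero[OF xp])
    then have "F (\<sigma> x) f = - frechet_derivative G (at (0, x)) (1, 0)"
      by (simp add: flow_velocity[OF xp])
    then show ?thesis using P(2)[OF xU] sn by (simp add: tvec_of_def g_def)
  qed
  have dD: "((\<lambda>z. frechet_derivative G (at z) a) has_derivative
      frechet_derivative (\<lambda>z. frechet_derivative G (at z) a) (at (0, x0))) (at (0, x0))" for a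
    by (rule smooth_on_has_derivative[OF smooth_on_derivative[OF G] z0])
  \<comment> \<open>Exchanging the mixed derivatives puts the time derivative inside, so
    \<open>dt\<close> turns this contribution into \<open>- Y (F f)\<close>.\<close>
  have 1: "\<Phi>' (1, 0) = - frechet_derivative (\<lambda>x. frechet_derivative g (at x) (P x)) (at x0) (Q x0)"
  proof -
    have "\<Phi>' (1, 0) = frechet_derivative (\<lambda>z. frechet_derivative G (at z) (1, 0)) (at (0, x0)) (0, Q x0)"
      using symmetric_second_derivative[OF \<Omega> G z0]
        linear_0[OF has_derivative_linear[OF smooth_on_has_derivative[OF Q(1) c(2)]]]
        linear_0[OF has_derivative_linear[OF DG[OF z0]]]
      by (simp add: \<Phi>'_def zero_prod_def)
    moreover have "((\<lambda>x. frechet_derivative G (at (0, x)) (1, 0)) has_derivative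
        (\<lambda>v. frechet_derivative (\<lambda>z. frechet_derivative G (at z) (1, 0)) (at (0, x0)) (0, v))) (at x0)"
      by (rule sd[OF dD])
    then have "((\<lambda>x. - frechet_derivative g (at x) (P x)) has_derivative
        (\<lambda>v. frechet_derivative (\<lambda>z. frechet_derivative G (at z) (1, 0)) (at (0, x0)) (0, v))) (at x0)"
      by (rule has_derivative_transform_within_open[OF _ N(1,2)]) (rule dt)
    from has_derivative_minus[OF this]
    have "((\<lambda>x. frechet_derivative g (at x) (P x)) has_derivative
        (\<lambda>v. - frechet_derivative (\<lambda>z. frechet_derivative G (at z) (1, 0)) (at (0, x0)) (0, v))) (at x0)"
      by simp
    from fun_cong[OF frechet_derivative_at[OF this], of "Q x0"]
    have "frechet_derivative (\<lambda>x. frechet_derivative g (at x) (P x)) (at x0) (Q x0) =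
      - frechet_derivative (\<lambda>z. frechet_derivative G (at z) (1, 0)) (at (0, x0)) (0, Q x0)" by simp
    ultimately show ?thesis by simp
  qed
  \<comment> \<open>At time 0 the function \<open>\<Phi>\<close> is \<open>Y f\<close> in
    coordinates; moving the base point along \<open>F\<close> contributes
    \<open>F (Y f)\<close>.\<close>
  have 2: "\<Phi>' (0, P x0) = frechet_derivative (\<lambda>x. frechet_derivative g (at x) (Q x)) (at x0) (P x0)"
  proof -
    have eq: "\<Phi> (0, x) = frechet_derivative g (at x) (Q x)" if "x \<in> N" for x
    proof -
      have "frechet_derivative (\<lambda>x. G (0, x)) (at x) = frechet_derivative g (at x)"
        by (rule frechet_derivative_transform_within_open[OF _ N(1) that])
          (use sd[OF DG[OF \<Omega>0(1)[OF that]]] \<Omega>0(2) in \<open>auto simp: differentiable_def\<close>)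
      then show ?thesis using slice_d[OF \<Omega>0(1)[OF that]] by (simp add: \<Phi>_def)
    qed
    have "((\<lambda>x. frechet_derivative g (at x) (Q x)) has_derivative (\<lambda>v. \<Phi>' (0, v))) (at x0)"
      by (rule has_derivative_transform_within_open[OF sd[OF d\<Phi>] N(1,2) eq])
    from fun_cong[OF frechet_derivative_at[OF this], of "P x0"] show ?thesis by simp
  qed
  have "\<Phi>' (1, P x0) = \<Phi>' (1, 0) + \<Phi>' (0, P x0)"
    using linear_add[OF lin, of "(1, 0)" "(0, P x0)"] by simp
  moreover have "lie_bracket A F Y p f =
      frechet_derivative (\<lambda>x. frechet_derivative g (at x) (Q x)) (at x0) (P x0)
      - frechet_derivative (\<lambda>x. frechet_derivative g (at x) (P x)) (at x0) (Q x0)"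
    using f field_apply_chart(2)[OF c P N] field_apply_chart(2)[OF c Q N] P(2)[OF c(2)] Q(2)[OF c(2)]
    by (simp add: lie_bracket_def px g_def)
  ultimately show ?thesis using main 1 2 by simp
qed

section \<open>Pull-back of vector fields along the flow\<close>

definition pull_back :: "('m \<Rightarrow> 'm tvec) \<Rightarrow> real \<Rightarrow> 'm \<Rightarrow> 'm tvec" where
  "pull_back Y t p = differential A A (\<phi> (-t)) (\<phi> t p) (Y (\<phi> t p))"

lemma pull_back_tangent:
  assumes "smooth_field A Y" "p \<in> points A"
  shows "pull_back Y t p \<in> tangent_space A p"
  unfolding pull_back_def
  using differential_tangent[OF flow_map_smooth flow_points[OF assms(2)]
      smooth_field_tangent[OF assms(1) flow_points[OF assms(2)]], of "-t" t] flow_inverse(1)[OF assms(2), of t]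
  by simp

lemma pull_back_zero:
  assumes "smooth_field A Y" "p \<in> points A"
  shows "pull_back Y 0 p = Y p"
proof
  fix f
  have "Y p (f \<circ> \<phi> 0) = Y p f"
    by (rule tangent_cong(1)[OF assms(2) smooth_field_tangent[OF assms]]) (simp add: flow_zero)
  then show "pull_back Y 0 p f = Y p f"
    using tangent_not_smooth[OF assms(2) smooth_field_tangent[OF assms]]
    by (simp add: pull_back_def differential_def flow_zero[OF assms(2)])
qed

text \<open>By the group law, an increment at time \<open>t\<close> is an increment at time 0 for
  the base point \<open>\<phi> t p\<close> and the test function
  \<open>f \<circ> \<phi> (-t)\<close>, where \<open>lie_derivative_at_0\<close> applies. If
  \<open>f\<close> is not smooth near \<open>p\<close>, everything is 0 by convention.\<close>

lemma pull_back_derivative: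
  assumes Y: "smooth_field A Y" and p: "p \<in> points A"
  shows "((\<lambda>t. pull_back Y t p f) has_real_derivative pull_back (lie_bracket A F Y) t p f) (at t)"
proof (cases "smooth_near A f p")
  case True
  have pt: "\<phi> t p \<in> points A" by (rule flow_points[OF p])
  have ft: "smooth_near A (f \<circ> \<phi> (-t)) (\<phi> t p)"
    by (rule smooth_near_compose[OF flow_map_smooth pt]) (simp add: flow_inverse p True)
  have "Y (\<phi> s (\<phi> t p)) (f \<circ> \<phi> (-t) \<circ> \<phi> (-s)) = pull_back Y (s + t) p f" for s
  proof -
    have "Y (\<phi> (s + t) p) (f \<circ> \<phi> (-t) \<circ> \<phi> (-s)) = Y (\<phi> (s + t) p) (f \<circ> \<phi> (-(s + t)))"
    proof (rule tangent_cong(1)[OF flow_points[OF p] smooth_field_tangent[OF Y flow_points[OF p]]])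
      fix q assume "q \<in> points A"
      then show "(f \<circ> \<phi> (-t) \<circ> \<phi> (-s)) q = (f \<circ> \<phi> (-(s + t))) q"
        using flow_add[of q "-t" "-s"] by (simp add: algebra_simps)
    qed
    then show ?thesis using True flow_inverse(1)[OF p, of "s + t"] flow_add[OF p, of s t]
      unfolding pull_back_def differential_def by simp
  qed
  then have "((\<lambda>s. pull_back Y (s + t) p f) has_real_derivative lie_bracket A F Y (\<phi> t p) (f \<circ> \<phi> (-t))) (at 0)"
    using lie_derivative_at_0[OF Y pt ft] by simp
  then have "((\<lambda>s. pull_back Y s p f) has_real_derivative lie_bracket A F Y (\<phi> t p) (f \<circ> \<phi> (-t))) (at t)"
    using DERIV_shift[of "\<lambda>s. pull_back Y s p f" _ 0 t] by simp
  then show ?thesis using True flow_inverse[OF p] by (simp add: pull_back_def differential_def)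
next
  case False
  then have "pull_back Z s p f = 0" for Z s
    using flow_inverse[OF p] by (simp add: pull_back_def differential_def)
  then show ?thesis by simp
qed

text \<open>A field commutes with itself, so its pull-back is constant in time. Thus a multiple of
  \<open>F\<close> in a bracket pulls back to a multiple of the fixed vector
  \<open>F p\<close>.\<close>

lemma pull_back_self:
  assumes p: "p \<in> points A" shows "pull_back F t p = F p"
proof
  fix f
  have b: "lie_bracket A F F = (\<lambda>q f. 0)" by (auto simp: lie_bracket_def fun_eq_iff)
  have "((\<lambda>t. pull_back F t p f) has_real_derivative 0) (at t)" for t
    using pull_back_derivative[OF F p, of f t] unfolding b by (simp add: pull_back_def differential_def)
  then have "pull_back F t p f = pull_back F 0 p f"
    using DERIV_isconst_all[of "\<lambda>t. pull_back F t p f"] by blast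
  then show "pull_back F t p f = F p f" using pull_back_zero[OF F p] by simp
qed

lemma differential_pull_back:
  assumes Y: "smooth_field A Y" and p: "p \<in> points A"
  shows "differential A A (\<phi> t) p (pull_back Y t p) = Y (\<phi> t p)"
proof
  fix f
  have pt: "\<phi> t p \<in> points A" by (rule flow_points[OF p])
  note T = smooth_field_tangent[OF Y pt]
  have "differential A A (\<phi> t) p (pull_back Y t p) f =
      differential A A (\<phi> t \<circ> \<phi> (-t)) (\<phi> t p) (Y (\<phi> t p)) f"
    using differential_compose[of "\<phi> t" "\<phi> (-t)" "\<phi> t p", OF flow_map_smooth flow_points[OF pt]]
    by (simp add: pull_back_def flow_inverse[OF p])
  also have "\<dots> = Y (\<phi> t p) f"
  proof -
    have "Y (\<phi> t p) (f \<circ> (\<phi> t \<circ> \<phi> (-t))) = Y (\<phi> t p) f"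
      by (rule tangent_cong(1)[OF pt T]) (simp add: flow_inverse)
    then show ?thesis using tangent_not_smooth[OF pt T]
      by (simp add: differential_def flow_inverse[OF p])
  qed
  finally show "differential A A (\<phi> t) p (pull_back Y t p) f = Y (\<phi> t p) f" .
qed

lemma differential_flow_inverse:
  assumes p: "p \<in> points A" and v: "v \<in> tangent_space A p"
  shows "differential A A (\<phi> (-t)) (\<phi> t p) (differential A A (\<phi> t) p v) = v"
proof
  fix f
  have "v (f \<circ> (\<phi> (-t) \<circ> \<phi> t)) = v f"
    by (rule tangent_cong(1)[OF p v]) (simp add: flow_inverse)
  then show "differential A A (\<phi> (-t)) (\<phi> t p) (differential A A (\<phi> t) p v) f = v f"
    using differential_compose[of "\<phi> (-t)" "\<phi> t" p, OF flow_map_smooth flow_points[OF p]]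
      tangent_not_smooth[OF p v]
    by (simp add: differential_def flow_inverse[OF p])
qed

end

section \<open>Metrics on open subsets of the plane\<close>

text \<open>The formula of \<open>christoffel\<close> for bare coefficient functions, so that the
  local geometry can be developed without reference to an atlas. \<open>christoffel_eq\<close>
  connects the two.\<close>

definition chr :: "(2 \<Rightarrow> 2 \<Rightarrow> real^2 \<Rightarrow> real) \<Rightarrow> 2 \<Rightarrow> 2 \<Rightarrow> 2 \<Rightarrow> real^2 \<Rightarrow> real" where
  "chr m k i j x = (1/2) * (\<Sum>l\<in>UNIV. matrix_inv (\<chi> a b. m a b x) $ k $ l *
     (partial i (m j l) x + partial j (m i l) x - partial l (m i j) x))"

definition riem :: "(2 \<Rightarrow> 2 \<Rightarrow> real^2 \<Rightarrow> real) \<Rightarrow> 2 \<Rightarrow> 2 \<Rightarrow> 2 \<Rightarrow> 2 \<Rightarrow> real^2 \<Rightarrow> real" where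
  "riem m l k i j x =
     partial i (chr m l j k) x - partial j (chr m l i k) x
     + (\<Sum>n\<in>UNIV. chr m l i n x * chr m n j k x - chr m l j n x * chr m n i k x)"

definition chr_form :: "(2 \<Rightarrow> 2 \<Rightarrow> real^2 \<Rightarrow> real) \<Rightarrow> real^2 \<Rightarrow> real^2 \<Rightarrow> real^2 \<Rightarrow> real^2" where
  "chr_form m x u v = (\<chi> k. \<Sum>i\<in>UNIV. \<Sum>j\<in>UNIV. chr m k i j x * u $ i * v $ j)"

definition metric_form :: "(2 \<Rightarrow> 2 \<Rightarrow> real^2 \<Rightarrow> real) \<Rightarrow> real^2 \<Rightarrow> real^2 \<Rightarrow> real^2 \<Rightarrow> real" where
  "metric_form m x u v = (\<Sum>i\<in>UNIV. \<Sum>j\<in>UNIV. m i j x * u $ i * v $ j)"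

definition metric_deriv :: "(2 \<Rightarrow> 2 \<Rightarrow> real^2 \<Rightarrow> real) \<Rightarrow> real^2 \<Rightarrow> real^2 \<Rightarrow> real^2 \<Rightarrow> real^2 \<Rightarrow> real" where
  "metric_deriv m x z u v =
     (\<Sum>i\<in>UNIV. \<Sum>j\<in>UNIV. frechet_derivative (m i j) (at x) z * u $ i * v $ j)"

lemma vec2_expand: "(v :: real^2) = v $ 1 *\<^sub>R axis 1 1 + v $ 2 *\<^sub>R axis 2 1"
  by (simp add: vec_eq_iff forall_2 axis_def)

lemma frechet_derivative_partial:
  fixes f :: "real^2 \<Rightarrow> real"
  assumes "smooth_on S f" "x \<in> S"
  shows "frechet_derivative f (at x) v = partial 1 f x * v $ 1 + partial 2 f x * v $ 2"
proof -
  have l: "linear (frechet_derivative f (at x))"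
    by (rule has_derivative_linear[OF smooth_on_has_derivative[OF assms]])
  have "frechet_derivative f (at x) v = frechet_derivative f (at x) (v $ 1 *\<^sub>R axis 1 1 + v $ 2 *\<^sub>R axis 2 1)"
    using vec2_expand[of v] by simp
  then show ?thesis by (simp add: linear_add[OF l] linear_scale[OF l] partial_def)
qed

lemma smooth_on_partial [smooth_intros]: "smooth_on S f \<Longrightarrow> smooth_on S (partial i f)"
  unfolding partial_def[abs_def] by (rule smooth_on_derivative)

lemma partial_rules:
  assumes "x \<in> S" "smooth_on S f" "smooth_on S g"
  shows "partial i (\<lambda>x. f x * g x) x = partial i f x * g x + f x * partial i g x"
    "partial i (\<lambda>x. f x + g x) x = partial i f x + partial i g x"
    "partial i (\<lambda>x. f x - g x) x = partial i f x - partial i g x"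
proof -
  note f = smooth_on_has_derivative[OF assms(2,1)] and g = smooth_on_has_derivative[OF assms(3,1)]
  show "partial i (\<lambda>x. f x * g x) x = partial i f x * g x + f x * partial i g x"
    unfolding partial_def frechet_derivative_at[OF has_derivative_mult[OF f g], symmetric] by simp
  show "partial i (\<lambda>x. f x + g x) x = partial i f x + partial i g x"
    unfolding partial_def frechet_derivative_at[OF has_derivative_add[OF f g], symmetric] by simp
  show "partial i (\<lambda>x. f x - g x) x = partial i f x - partial i g x"
    unfolding partial_def frechet_derivative_at[OF has_derivative_diff[OF f g], symmetric] by simp
qed

lemma partial_minus:
  assumes "x \<in> S" "smooth_on S f"
  shows "partial i (\<lambda>x. - f x) x = - partial i f x"
  unfolding partial_def
    frechet_derivative_at[OF has_derivative_minus[OF smooth_on_has_derivative[OF assms(2,1)]], symmetric]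
  by simp

lemma partial_const [simp]: "partial i (\<lambda>x. c) x = 0"
  by (simp add: partial_def)

lemma partial_cong:
  assumes "open S" "x \<in> S" "smooth_on S f" "\<And>y. y \<in> S \<Longrightarrow> f y = g y"
  shows "partial i f x = partial i g x"
proof -
  have "frechet_derivative f (at x) = frechet_derivative g (at x)"
    by (rule frechet_derivative_transform_within_open[OF _ assms(1,2,4)])
      (use smooth_on_has_derivative[OF assms(3,2)] in \<open>auto simp: differentiable_def\<close>)
  then show ?thesis by (simp add: partial_def)
qed

lemma partial_commute:
  assumes "open S" "x \<in> S" "smooth_on S (f :: real^2 \<Rightarrow> real)"
  shows "partial i (partial j f) x = partial j (partial i f) x"
  unfolding partial_def[abs_def] by (rule symmetric_second_derivative[OF assms(1,3,2)])

lemma bilinear_sum_has_derivative: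
  fixes u w :: "'a::real_normed_vector \<Rightarrow> real^2"
  assumes c: "\<And>i j. (c i j has_derivative c' i j) (at x)"
    and u: "(u has_derivative u') (at x)" and w: "(w has_derivative w') (at x)"
  shows "((\<lambda>x. \<Sum>i\<in>UNIV. \<Sum>j\<in>UNIV. c i j x * u x $ i * w x $ j) has_derivative
    (\<lambda>v. (\<Sum>i\<in>UNIV. \<Sum>j\<in>UNIV. c' i j v * u x $ i * w x $ j)
      + (\<Sum>i\<in>UNIV. \<Sum>j\<in>UNIV. c i j x * u' v $ i * w x $ j)
      + (\<Sum>i\<in>UNIV. \<Sum>j\<in>UNIV. c i j x * u x $ i * w' v $ j))) (at x)"
proof -
  have "((\<lambda>x. \<Sum>i\<in>UNIV. \<Sum>j\<in>UNIV. c i j x * u x $ i * w x $ j) has_derivative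
    (\<lambda>v. \<Sum>i\<in>UNIV. \<Sum>j\<in>UNIV. c i j x * u x $ i * w' v $ j
       + (c i j x * u' v $ i + c' i j v * u x $ i) * w x $ j)) (at x)"
    by (intro has_derivative_sum has_derivative_mult c
        bounded_linear.has_derivative[OF bounded_linear_vec_nth u]
        bounded_linear.has_derivative[OF bounded_linear_vec_nth w])
  then show ?thesis
    by (rule has_derivative_eq_rhs) (simp add: fun_eq_iff sum.distrib algebra_simps sum_2)
qed

locale plane_metric =
  fixes U :: "(real^2) set" and m :: "2 \<Rightarrow> 2 \<Rightarrow> real^2 \<Rightarrow> real"
  assumes U: "open U" and smooth_m: "smooth_on U (m i j)"
    and sym: "x \<in> U \<Longrightarrow> m i j x = m j i x"
    and m11: "x \<in> U \<Longrightarrow> m 1 1 x > 0"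
    and det_pos: "x \<in> U \<Longrightarrow> m 1 1 x * m 2 2 x - m 1 2 x * m 1 2 x > 0"
begin

lemma partial_sym: "x \<in> U \<Longrightarrow> partial k (m i j) x = partial k (m j i) x"
  by (rule partial_cong[OF U _ smooth_m]) (auto simp: sym)

text \<open>Lowering the upper index multiplies the inverse matrix by the matrix itself. The
  geometric arguments below work with this form or with \<open>chr_solve\<close> instead of
  \<open>matrix_inv\<close>.\<close>

lemma chr_lower:
  assumes x: "x \<in> U"
  shows "m c 1 x * chr m 1 i j x + m c 2 x * chr m 2 i j x =
    (partial i (m j c) x + partial j (m i c) x - partial c (m i j) x) / 2"
proof -
  let ?M = "\<chi> a b. m a b x"
  let ?L = "\<lambda>l. partial i (m j l) x + partial j (m i l) x - partial l (m i j) x"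
  have "det ?M \<noteq> 0" using det_pos[OF x] sym[OF x, of 1 2] by (simp add: det_2)
  then have "invertible ?M" by (simp add: invertible_det_nz)
  then have "?M ** matrix_inv ?M = mat 1"
    unfolding invertible_def matrix_inv_def by (rule someI2_ex) simp
  then have *: "m a 1 x * matrix_inv ?M $ 1 $ b + m a 2 x * matrix_inv ?M $ 2 $ b = (if a = b then 1 else 0)" for a b
    by (auto simp: matrix_matrix_mult_def mat_def vec_eq_iff sum_2)
  have "m c 1 x * chr m 1 i j x + m c 2 x * chr m 2 i j x =
    ((m c 1 x * matrix_inv ?M $ 1 $ 1 + m c 2 x * matrix_inv ?M $ 2 $ 1) * ?L 1 +
     (m c 1 x * matrix_inv ?M $ 1 $ 2 + m c 2 x * matrix_inv ?M $ 2 $ 2) * ?L 2) / 2"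
    by (simp add: chr_def sum_2 algebra_simps)
  also have "\<dots> = ?L c / 2" unfolding * using exhaust_2[of c] by auto
  finally show ?thesis .
qed

text \<open>Cramer's rule for the two equations of \<open>chr_lower\<close>. The explicit quotients
  make symmetry and smoothness of the symbols visible.\<close>

lemma chr_solve:
  assumes x: "x \<in> U"
  defines "L \<equiv> \<lambda>c i j. (partial i (m j c) x + partial j (m i c) x - partial c (m i j) x) / 2"
    and "D \<equiv> m 1 1 x * m 2 2 x - m 1 2 x * m 1 2 x"
  shows "chr m 1 i j x = (m 2 2 x * L 1 i j - m 1 2 x * L 2 i j) / D"
    "chr m 2 i j x = (m 1 1 x * L 2 i j - m 1 2 x * L 1 i j) / D"
proof -
  have D: "D > 0" unfolding D_def by (rule det_pos[OF x])
  have 1: "L 1 i j = m 1 1 x * chr m 1 i j x + m 1 2 x * chr m 2 i j x"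
    and 2: "L 2 i j = m 1 2 x * chr m 1 i j x + m 2 2 x * chr m 2 i j x"
    using chr_lower[OF x, of 1 i j] chr_lower[OF x, of 2 i j] sym[OF x, of 2 1] by (auto simp: L_def)
  have "chr m 1 i j x * D = m 2 2 x * L 1 i j - m 1 2 x * L 2 i j"
    "chr m 2 i j x * D = m 1 1 x * L 2 i j - m 1 2 x * L 1 i j"
    unfolding 1 2 D_def by (simp_all add: algebra_simps)
  then show "chr m 1 i j x = (m 2 2 x * L 1 i j - m 1 2 x * L 2 i j) / D"
    "chr m 2 i j x = (m 1 1 x * L 2 i j - m 1 2 x * L 1 i j) / D"
    using D by (simp_all add: field_simps)
qed

lemma chr_sym:
  assumes x: "x \<in> U" shows "chr m k i j x = chr m k j i x"
proof -
  have "(partial i (m j c) x + partial j (m i c) x - partial c (m i j) x) / 2 =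
    (partial j (m i c) x + partial i (m j c) x - partial c (m j i) x) / 2" for c
    using partial_sym[OF x, of c i j] by simp
  then show ?thesis
    using exhaust_2[of k] chr_solve[OF x, of i j] chr_solve[OF x, of j i] by metis
qed

lemma smooth_chr [smooth_intros]: "smooth_on U (chr m k i j)"
proof -
  let ?L = "\<lambda>c x. (partial i (m j c) x + partial j (m i c) x - partial c (m i j) x) / 2"
  let ?D = "\<lambda>x. m 1 1 x * m 2 2 x - m 1 2 x * m 1 2 x"
  have "smooth_on U (\<lambda>x. (m 2 2 x * ?L 1 x - m 1 2 x * ?L 2 x) / ?D x)"
    "smooth_on U (\<lambda>x. (m 1 1 x * ?L 2 x - m 1 2 x * ?L 1 x) / ?D x)"
    by (intro smooth_intros U smooth_m; use det_pos in force)+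
  then show ?thesis
    using exhaust_2[of k] smooth_on_cong[OF U, of "chr m 1 i j"] smooth_on_cong[OF U, of "chr m 2 i j"]
      chr_solve by (metis (no_types, lifting))
qed

text \<open>Metric compatibility of the Levi-Civita connection: adding \<open>chr_lower\<close> for
  suitably exchanged indices cancels all derivatives but one.\<close>

lemma metric_partial:
  assumes x: "x \<in> U"
  shows "partial k (m 1 1) x = 2 * (m 1 1 x * chr m 1 k 1 x + m 1 2 x * chr m 2 k 1 x)"
    "partial k (m 1 2) x = m 1 1 x * chr m 1 k 2 x + m 1 2 x * chr m 2 k 2 x +
       m 1 2 x * chr m 1 k 1 x + m 2 2 x * chr m 2 k 1 x"
    "partial k (m 2 2) x = 2 * (m 1 2 x * chr m 1 k 2 x + m 2 2 x * chr m 2 k 2 x)"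
  using chr_lower[OF x, of 1 k 1] chr_lower[OF x, of 1 k 2] chr_lower[OF x, of 2 k 1] chr_lower[OF x, of 2 k 2]
    sym[OF x, of 2 1] partial_sym[OF x, of _ 2 1]
  by (simp_all add: field_simps)

text \<open>The orthonormal frame is \<open>(fa, 0)\<close>, \<open>(fb1, fb2)\<close>, and \<open>conn k\<close> is the coefficient of its
  second vector in the covariant derivative of the first one along \<open>\<partial>\<^sub>k\<close>.\<close>

definition "vol x = sqrt (m 1 1 x * m 2 2 x - m 1 2 x * m 1 2 x)"
definition "fa x = 1 / sqrt (m 1 1 x)"
definition "fb1 x = - (m 1 2 x * fa x / vol x)"
definition "fb2 x = 1 / (fa x * vol x)"
definition "conn k x = chr m 2 k 1 x * (fa x * fa x * vol x)"

lemma vol_pos: "x \<in> U \<Longrightarrow> vol x > 0" and fa_pos: "x \<in> U \<Longrightarrow> fa x > 0"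
  using det_pos m11 by (auto simp: vol_def fa_def)

lemma smooth_frame [smooth_intros]:
  "smooth_on U vol" "smooth_on U fa" "smooth_on U fb1" "smooth_on U fb2" "smooth_on U (conn k)"
proof -
  show v: "smooth_on U vol" unfolding vol_def[abs_def]
    by (intro smooth_intros U smooth_m) (use det_pos in auto)
  show a: "smooth_on U fa" unfolding fa_def[abs_def]
    by (intro smooth_intros U smooth_m) (use m11 in force)+
  show "smooth_on U fb1" unfolding fb1_def[abs_def]
    by (intro smooth_intros U smooth_m a v) (use vol_pos in force)
  show "smooth_on U fb2" unfolding fb2_def[abs_def]
    by (intro smooth_intros U smooth_m a v) (use vol_pos fa_pos in force)
  show "smooth_on U (conn k)" unfolding conn_def[abs_def]
    by (intro smooth_intros U smooth_m a v)
qed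

text \<open>Polynomial relations that encode the square roots in the frame, in a form usable by the
  \<open>algebra\<close> method and by differentiation.\<close>

lemma frame_relations:
  assumes x: "x \<in> U"
  shows "m 1 1 x * (fa x * fa x) = 1" "vol x * vol x = m 1 1 x * m 2 2 x - m 1 2 x * m 1 2 x"
    "fb2 x * (fa x * vol x) = 1" "fb1 x * vol x = - (m 1 2 x * fa x)"
  using det_pos[OF x] m11[OF x] vol_pos[OF x] fa_pos[OF x]
  by (auto simp: vol_def fa_def fb1_def fb2_def)

text \<open>The first structure equation in components: the covariant derivative along the k-th
  coordinate takes the first frame vector to \<open>conn k\<close> times the second, and the second
  to \<open>- conn k\<close> times the first. The second line has 0 on the left because the first
  frame vector has vanishing second component.\<close>

lemma frame_derivative:
  assumes x: "x \<in> U"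
  shows "partial k fa x = conn k x * fb1 x - chr m 1 k 1 x * fa x"
    "0 = conn k x * fb2 x - chr m 2 k 1 x * fa x"
    "partial k fb1 x = - conn k x * fa x - chr m 1 k 1 x * fb1 x - chr m 1 k 2 x * fb2 x"
    "partial k fb2 x = - chr m 2 k 1 x * fb1 x - chr m 2 k 2 x * fb2 x"
proof -
  define E where "E = m 1 1 x" define F where "F = m 1 2 x" define G where "G = m 2 2 x"
  define a where "a = fa x" define s where "s = vol x" define p where "p = fb1 x" define q where "q = fb2 x"
  define a' where "a' = partial k fa x" define s' where "s' = partial k vol x"
  define p' where "p' = partial k fb1 x" define q' where "q' = partial k fb2 x"
  define G11 where "G11 = chr m 1 k 1 x" define G21 where "G21 = chr m 2 k 1 x"
  define G12 where "G12 = chr m 1 k 2 x" define G22 where "G22 = chr m 2 k 2 x"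
  note defs = E_def F_def G_def a_def s_def p_def q_def a'_def s'_def p'_def q'_def G11_def G21_def G12_def G22_def
  note pr = partial_rules[OF x] partial_minus[OF x]
  have pc: "partial k f x = partial k g x" if "smooth_on U f" "\<And>y. y \<in> U \<Longrightarrow> f y = g y" for f g
    by (rule partial_cong[OF U x that])
  have r: "E * (a * a) = 1" "s * s = E * G - F * F" "q * (a * s) = 1" "p * s = - (F * a)"
    using frame_relations[OF x] by (auto simp: defs)
  have nz: "a \<noteq> 0" "s \<noteq> 0" using vol_pos[OF x] fa_pos[OF x] by (auto simp: defs)
  note sm = smooth_intros U smooth_m
  \<comment> \<open>\<open>d1\<close> to \<open>d4\<close> come from differentiating
    \<open>frame_relations\<close>. They are linear in the unknown derivatives, so no square root
    has to be differentiated.\<close>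
  have d1: "2 * (E * G11 + F * G21) * (a * a) + E * (a' * a + a * a') = 0"
    using pc[of "\<lambda>y. m 1 1 y * (fa y * fa y)" "\<lambda>y. 1"] frame_relations(1)
    by (simp add: pr sm metric_partial[OF x] defs)
  have d2: "2 * (s' * s) = 2 * (E * G11 + F * G21) * G + E * (2 * (F * G12 + G * G22))
       - 2 * (F * (E * G12 + F * G22 + F * G11 + G * G21))"
    using pc[of "\<lambda>y. vol y * vol y" "\<lambda>y. m 1 1 y * m 2 2 y - m 1 2 y * m 1 2 y"] frame_relations(2)
    by (simp add: pr sm metric_partial[OF x] defs algebra_simps)
  have d3: "q' * (a * s) + q * (a' * s + a * s') = 0"
    using pc[of "\<lambda>y. fb2 y * (fa y * vol y)" "\<lambda>y. 1"] frame_relations(3)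
    by (simp add: pr sm defs)
  have d4: "p' * s + p * s' = - ((E * G12 + F * G22 + F * G11 + G * G21) * a + F * a')"
    using pc[of "\<lambda>y. fb1 y * vol y" "\<lambda>y. - (m 1 2 y * fa y)"] frame_relations(4)
    by (simp add: pr sm metric_partial[OF x] defs)
  define w where "w = conn k x"
  have w: "w = G21 * (a * a * s)" by (simp add: w_def conn_def defs)
  have A: "a' = w * p - G11 * a"
  proof -
    have "2 * a' = 2 * (- G11 * a - F * G21 * (a * a * a))"
      using d1 r(1) by algebra
    then have "a' = - G11 * a - F * G21 * (a * a * a)" by simp
    moreover have "w * p = - F * a * G21 * (a * a)" using r(4) unfolding w by algebra
    ultimately show ?thesis by algebra
  qed
  \<comment> \<open>The logarithmic derivative of the volume density is a trace of Christoffel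
    symbols.\<close>
  have S: "s' = s * (G11 + G22)"
  proof -
    have "s' * s = (s * (G11 + G22)) * s" using d2 r(2) by algebra
    then show ?thesis using nz by simp
  qed
  have wq: "w * q = G21 * a" using r(3) unfolding w by algebra
  have Q: "q' = - G21 * p - G22 * q"
  proof -
    have "q' * (a * s) = (- G21 * p - G22 * q) * (a * s)"
      using d3 unfolding A S using wq w r(3) by algebra
    then show ?thesis using nz by simp
  qed
  have P: "p' = - w * a - G11 * p - G12 * q"
  proof -
    have Eq: "E * a = q * s" using r(1,3) nz by algebra
    have Fa: "F * a = - p * s" using r(4) by algebra
    have "p' * s * (a * s) = (- w * a - G11 * p - G12 * q) * s * (a * s)"
    proof -
      have "G * a * (E * (a*a)) = a * a * a * (s * s + F * F)" using r(2) by algebra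
      then have Ga: "G * a = a * a * a * (s * s + F * F)" unfolding r(1) by simp
      have "p' * s = - (E * a * G12 + F * a * G22 + F * a * G11 + G * a * G21 + F * a') - p * s'"
        using d4 by algebra
      then show ?thesis unfolding A S Ga w using Eq Fa r(3) by algebra
    qed
    then show ?thesis using nz by simp
  qed
  show "partial k fa x = conn k x * fb1 x - chr m 1 k 1 x * fa x"
    "0 = conn k x * fb2 x - chr m 2 k 1 x * fa x"
    "partial k fb1 x = - conn k x * fa x - chr m 1 k 1 x * fb1 x - chr m 1 k 2 x * fb2 x"
    "partial k fb2 x = - chr m 2 k 1 x * fb1 x - chr m 2 k 2 x * fb2 x"
    using A P Q wq by (auto simp: defs w_def)
qed

section \<open>Curvature from the connection form\<close>

definition "curv x = (\<Sum>l\<in>UNIV. m l 1 x * riem m l 2 1 2 x) / (m 1 1 x * m 2 2 x - m 1 2 x * m 1 2 x)"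

text \<open>The second structure equation. \<open>frame_derivative\<close> is differentiated once
  more and antisymmetrized in the two coordinate directions. Second partial derivatives of the frame
  cancel, and the Christoffel terms assemble to the curvature operator, which sends the first frame
  vector to \<open>dw\<close> times the second (\<open>R11\<close>, \<open>R21\<close>) and the
  second to \<open>- dw\<close> times the first (\<open>R12\<close>, \<open>R22\<close>).\<close>

lemma curv_conn:
  assumes x: "x \<in> U"
  shows "curv x = - (partial 1 (conn 2) x - partial 2 (conn 1) x) / vol x"
proof -
  define dw where "dw = partial 1 (conn 2) x - partial 2 (conn 1) x"
  note pr = partial_rules[OF x] partial_minus[OF x] and sm = smooth_intros U smooth_m and fd = frame_derivative
  have pc: "partial k f x = partial k g x" if "smooth_on U f" "\<And>y. y \<in> U \<Longrightarrow> f y = g y" for k f g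
    by (rule partial_cong[OF U x that])
  define d where "d i l j k = partial i (chr m l j k) x" for i l j k
  define C where "C l j k = chr m l j k x" for l j k
  define w where "w k = conn k x" for k
  define w' where "w' i k = partial i (conn k) x" for i k
  define a where "a = fa x" define p where "p = fb1 x" define q where "q = fb2 x"
  note defs = d_def C_def w_def w'_def a_def p_def q_def
  have a1: "partial k fa x = w k * p - C 1 k 1 * a" and a2: "0 = w k * q - C 2 k 1 * a"
    and p1: "partial k fb1 x = - w k * a - C 1 k 1 * p - C 1 k 2 * q"
    and q1: "partial k fb2 x = - C 2 k 1 * p - C 2 k 2 * q" for k
    using fd[OF x, of k] by (auto simp: defs)
  have aa: "partial i (partial j fa) x = w' i j * p + w j * (- w i * a - C 1 i 1 * p - C 1 i 2 * q)
      - d i 1 j 1 * a - C 1 j 1 * (w i * p - C 1 i 1 * a)" for i j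
    using pc[where k = i, OF _ fd(1)[where k = j]] by (simp add: sm pr a1 p1 q1) (simp add: defs algebra_simps)
  \<comment> \<open>The second component of the first frame vector is identically 0, so its
    structure equation is an identity whose derivative gives a further relation.\<close>
  have bb: "0 = w' i j * q + w j * (- C 2 i 1 * p - C 2 i 2 * q)
      - d i 2 j 1 * a - C 2 j 1 * (w i * p - C 1 i 1 * a)" for i j
  proof -
    have "partial i (\<lambda>x. 0) x = partial i (\<lambda>x. conn j x * fb2 x - chr m 2 j 1 x * fa x) x"
      by (rule pc[OF _ fd(2)]) (rule smooth_on_const)
    also have "\<dots> = w' i j * q + w j * (- C 2 i 1 * p - C 2 i 2 * q)
      - d i 2 j 1 * a - C 2 j 1 * (w i * p - C 1 i 1 * a)"
      by (simp add: sm pr a1 q1) (simp add: defs)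
    finally show ?thesis by simp
  qed
  have pp: "partial i (partial j fb1) x = - w' i j * a - w j * (w i * p - C 1 i 1 * a)
      - d i 1 j 1 * p - C 1 j 1 * (- w i * a - C 1 i 1 * p - C 1 i 2 * q)
      - d i 1 j 2 * q - C 1 j 2 * (- C 2 i 1 * p - C 2 i 2 * q)" for i j
    using pc[where k = i, OF _ fd(3)[where k = j]] by (simp add: sm pr a1 p1 q1) (simp add: defs algebra_simps)
  have qq: "partial i (partial j fb2) x =
      - d i 2 j 1 * p - C 2 j 1 * (- w i * a - C 1 i 1 * p - C 1 i 2 * q)
      - d i 2 j 2 * q - C 2 j 2 * (- C 2 i 1 * p - C 2 i 2 * q)" for i j
    using pc[where k = i, OF _ fd(4)[where k = j]] by (simp add: sm pr a1 p1 q1) (simp add: defs algebra_simps)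
  have com: "partial 1 (partial 2 f) x = partial 2 (partial 1 f) x" if "smooth_on U f" for f
    by (rule partial_commute[OF U x that])
  define R where "R l k = riem m l k 1 2 x" for l k
  have R: "R l k = d 1 l 2 k - d 2 l 1 k + C l 1 1 * C 1 2 k - C l 2 1 * C 1 1 k
      + C l 1 2 * C 2 2 k - C l 2 2 * C 2 1 k" for l k
    by (simp add: R_def riem_def defs sum_2)
  have dw: "dw = w' 1 2 - w' 2 1" by (simp add: dw_def defs)
  have R11: "R 1 1 * a = dw * p" and R21: "R 2 1 * a = dw * q"
  proof -
    have "w' 1 2 * p + w 2 * (- w 1 * a - C 1 1 1 * p - C 1 1 2 * q)
      - d 1 1 2 1 * a - C 1 2 1 * (w 1 * p - C 1 1 1 * a) =
      w' 2 1 * p + w 1 * (- w 2 * a - C 1 2 1 * p - C 1 2 2 * q)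
      - d 2 1 1 1 * a - C 1 1 1 * (w 2 * p - C 1 2 1 * a)"
      using com[of fa] aa[of 1 2] aa[of 2 1] sm by metis
    then show "R 1 1 * a = dw * p" unfolding R dw using a2[of 1] a2[of 2] by algebra
    show "R 2 1 * a = dw * q" unfolding R dw using a2[of 1] a2[of 2] bb[of 1 2] bb[of 2 1] by algebra
  qed
  have R12: "R 1 1 * p + R 1 2 * q = - dw * a"
  proof -
    have "- w' 1 2 * a - w 2 * (w 1 * p - C 1 1 1 * a)
      - d 1 1 2 1 * p - C 1 2 1 * (- w 1 * a - C 1 1 1 * p - C 1 1 2 * q)
      - d 1 1 2 2 * q - C 1 2 2 * (- C 2 1 1 * p - C 2 1 2 * q) =
      - w' 2 1 * a - w 1 * (w 2 * p - C 1 2 1 * a)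
      - d 2 1 1 1 * p - C 1 1 1 * (- w 2 * a - C 1 2 1 * p - C 1 2 2 * q)
      - d 2 1 1 2 * q - C 1 1 2 * (- C 2 2 1 * p - C 2 2 2 * q)"
      using com[of fb1] pp[of 1 2] pp[of 2 1] sm by metis
    then show ?thesis unfolding R dw using a2[of 1] a2[of 2] by algebra
  qed
  have R22: "R 2 1 * p + R 2 2 * q = 0"
  proof -
    have "- d 1 2 2 1 * p - C 2 2 1 * (- w 1 * a - C 1 1 1 * p - C 1 1 2 * q)
      - d 1 2 2 2 * q - C 2 2 2 * (- C 2 1 1 * p - C 2 1 2 * q) =
      - d 2 2 1 1 * p - C 2 1 1 * (- w 2 * a - C 1 2 1 * p - C 1 2 2 * q)
      - d 2 2 1 2 * q - C 2 1 2 * (- C 2 2 1 * p - C 2 2 2 * q)"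
      using com[of fb2] qq[of 1 2] qq[of 2 1] sm by metis
    then show ?thesis unfolding R dw using a2[of 1] a2[of 2] by algebra
  qed
  define s where "s = vol x"
  have s: "s > 0" "a > 0" using vol_pos[OF x] fa_pos[OF x] by (auto simp: s_def a_def)
  have r: "m 1 1 x * (a * a) = 1" "s * s = m 1 1 x * m 2 2 x - m 1 2 x * m 1 2 x"
    "q * (a * s) = 1" "p * s = - (m 1 2 x * a)"
    using frame_relations[OF x] by (auto simp: s_def defs)
  have "(m 1 1 x * R 1 2 + m 1 2 x * R 2 2) = - dw * s"
  proof -
    have Ea: "m 1 1 x * a = q * s" using r(1,3) s by algebra
    \<comment> \<open>The nonzero factor \<open>q * a * a\<close> clears denominators, which leaves
      a polynomial consequence of the action on the frame.\<close>
    have "(m 1 1 x * R 1 2 + m 1 2 x * R 2 2) * (q * a * a) = - dw * s * (q * a * a)"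
      using R11 R21 R12 R22 Ea r(3,4) by algebra
    moreover have "q * a * a \<noteq> 0" using r(3) s by auto
    ultimately show ?thesis by (metis mult_right_cancel)
  qed
  then have "curv x = - dw * s / (s * s)"
    unfolding curv_def r(2) using sym[OF x, of 2 1] by (simp add: sum_2 R_def)
  then show ?thesis using s by (simp add: dw_def s_def)
qed

end

section \<open>Unit vectors, rotation and horizontal lifts over a plane metric\<close>

lemma metric_form_linear:
  "metric_form m x (a *\<^sub>R u + b *\<^sub>R v) w = a * metric_form m x u w + b * metric_form m x v w"
  "metric_form m x w (a *\<^sub>R u + b *\<^sub>R v) = a * metric_form m x w u + b * metric_form m x w v"
  "metric_form m x (u - v) w = metric_form m x u w - metric_form m x v w"
  "metric_form m x (u + v) w = metric_form m x u w + metric_form m x v w"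
  "metric_form m x (a *\<^sub>R u) w = a * metric_form m x u w"
  "metric_form m x w (a *\<^sub>R u) = a * metric_form m x w u"
  by (simp_all add: metric_form_def sum_2 algebra_simps)

lemma has_derivative_partial:
  fixes f :: "real^2 \<Rightarrow> real"
  assumes "smooth_on S f" "x \<in> S"
  shows "(f has_derivative (\<lambda>v. partial 1 f x * v $ 1 + partial 2 f x * v $ 2)) (at x)"
  by (rule has_derivative_eq_rhs[OF smooth_on_has_derivative[OF assms]])
    (rule ext, rule frechet_derivative_partial[OF assms])

lemma chr_form_linear:
  "chr_form m x u (a *\<^sub>R v + b *\<^sub>R w) = a *\<^sub>R chr_form m x u v + b *\<^sub>R chr_form m x u w"
  by (simp add: chr_form_def vec_eq_iff sum_2 algebra_simps)

context plane_metric
begin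

lemma metric_form_sym: "x \<in> U \<Longrightarrow> metric_form m x u v = metric_form m x v u"
  using sym[of x 2 1] by (simp add: metric_form_def sum_2 algebra_simps)

lemma chr_form_sym: "x \<in> U \<Longrightarrow> chr_form m x u v = chr_form m x v u"
  using chr_sym[of x _ 2 1] by (simp add: chr_form_def vec_eq_iff sum_2 algebra_simps)

text \<open>The Koszul formula on the diagonal. It involves the metric and its first derivative
  only, which is what makes two charts comparable.\<close>

lemma chr_form_lower:
  assumes x: "x \<in> U"
  shows "metric_form m x (chr_form m x v v) z = metric_deriv m x v v z - metric_deriv m x z v v / 2"
proof -
  have "metric_form m x (chr_form m x v v) z =
    (\<Sum>c\<in>UNIV. \<Sum>i\<in>UNIV. \<Sum>j\<in>UNIV. z $ c * (v $ i * v $ j) * (m c 1 x * chr m 1 i j x + m c 2 x * chr m 2 i j x))"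
    using sym[OF x, of 2 1] by (simp add: metric_form_def chr_form_def sum_2 algebra_simps)
  also have "\<dots> = (\<Sum>c\<in>UNIV. \<Sum>i\<in>UNIV. \<Sum>j\<in>UNIV. z $ c * (v $ i * v $ j) *
      ((partial i (m j c) x + partial j (m i c) x - partial c (m i j) x) / 2))"
    unfolding chr_lower[OF x] ..
  also have "\<dots> = metric_deriv m x v v z - metric_deriv m x z v v / 2"
    using frechet_derivative_partial[OF smooth_m x] partial_sym[OF x, of _ 2 1]
    by (simp add: metric_deriv_def sum_2 field_simps)
  finally show ?thesis .
qed

definition "e1 x = fa x *\<^sub>R (axis 1 1 :: real^2)"
definition "e2 x = fb1 x *\<^sub>R (axis 1 1 :: real^2) + fb2 x *\<^sub>R axis 2 1"
text \<open>The connection form: the covariant derivative of \<open>e1\<close> along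
  \<open>v\<close> is \<open>cform x v\<close> times \<open>e2\<close>.\<close>

definition "cform x v = conn 1 x * v $ 1 + conn 2 x * (v :: real^2) $ 2"
definition "unit_vec z = cos (snd z) *\<^sub>R e1 (fst z) + sin (snd z :: real) *\<^sub>R e2 (fst z)"
definition "unit_normal z = - sin (snd z) *\<^sub>R e1 (fst z) + cos (snd z :: real) *\<^sub>R e2 (fst z)"
text \<open>\<open>X\<close> in the coordinates (point, angle). Parallel transport along
  \<open>v\<close> changes the angle to the frame at the rate \<open>- cform x v\<close>, which is
  the angular component of a horizontal lift; \<open>lift_H\<close> is the same lift for the rotated
  vector.\<close>

definition "lift_X z = (unit_vec z, - cform (fst z) (unit_vec z))"
definition "lift_H z = (unit_normal z, - cform (fst z) (unit_normal z))"

lemma frame_components [simp]: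
  "e1 x $ 1 = fa x" "e1 x $ 2 = 0" "e2 x $ 1 = fb1 x" "e2 x $ 2 = fb2 x"
  by (simp_all add: e1_def e2_def axis_def)

lemma metric_frame:
  assumes x: "x \<in> U"
  shows "metric_form m x (e1 x) (e1 x) = 1" "metric_form m x (e1 x) (e2 x) = 0"
    "metric_form m x (e2 x) (e1 x) = 0" "metric_form m x (e2 x) (e2 x) = 1"
proof -
  note r = frame_relations[OF x]
  have nz: "vol x \<noteq> 0" "fa x \<noteq> 0" using vol_pos[OF x] fa_pos[OF x] by auto
  show 1: "metric_form m x (e1 x) (e1 x) = 1" using r(1) by (simp add: metric_form_def sum_2 algebra_simps)
  have "(m 1 1 x * fa x * fb1 x + m 1 2 x * fa x * fb2 x) * (vol x * fa x) = 0"
    using r by algebra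
  then have "m 1 1 x * fa x * fb1 x + m 1 2 x * fa x * fb2 x = 0" using nz by simp
  then show 2: "metric_form m x (e1 x) (e2 x) = 0" by (simp add: metric_form_def sum_2 algebra_simps)
  then show "metric_form m x (e2 x) (e1 x) = 0" using metric_form_sym[OF x] by simp
  have "(m 1 1 x * fb1 x * fb1 x + 2 * m 1 2 x * fb1 x * fb2 x + m 2 2 x * fb2 x * fb2 x) * (vol x * vol x * fa x * fa x)
     = 1 * (vol x * vol x * fa x * fa x)"
    using r by algebra
  then have "m 1 1 x * fb1 x * fb1 x + 2 * m 1 2 x * fb1 x * fb2 x + m 2 2 x * fb2 x * fb2 x = 1"
    using nz by (subst (asm) mult_right_cancel) auto
  then show "metric_form m x (e2 x) (e2 x) = 1"
    using sym[OF x, of 2 1] by (simp add: metric_form_def sum_2 algebra_simps)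
qed

lemma frame_expand:
  assumes x: "x \<in> U"
  shows "v = metric_form m x v (e1 x) *\<^sub>R e1 x + metric_form m x v (e2 x) *\<^sub>R e2 x"
proof -
  note r = frame_relations[OF x]
  have nz: "vol x \<noteq> 0" "fa x \<noteq> 0" "fb2 x \<noteq> 0" using vol_pos[OF x] fa_pos[OF x] r(3) by auto
  define d where "d = v $ 2 / fb2 x"
  define c where "c = (v $ 1 - d * fb1 x) / fa x"
  have v: "v = c *\<^sub>R e1 x + d *\<^sub>R e2 x"
    using nz by (simp add: vec_eq_iff forall_2 c_def d_def)
  show ?thesis
    unfolding v by (simp only: metric_form_linear metric_frame[OF x]) simp
qed

lemma metric_form_frame:
  assumes x: "x \<in> U"
  shows "metric_form m x v w = metric_form m x v (e1 x) * metric_form m x w (e1 x)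
    + metric_form m x v (e2 x) * metric_form m x w (e2 x)"
  by (subst frame_expand[OF x, of w]) (simp only: metric_form_linear mult.commute)

lemma metric_form_definite:
  assumes x: "x \<in> U" and "metric_form m x v v = 0" shows "v = 0"
proof -
  have "metric_form m x v (e1 x) = 0" "metric_form m x v (e2 x) = 0"
    using assms(2) metric_form_frame[OF x, of v v] by (simp_all add: sum_squares_eq_zero_iff)
  then show ?thesis using frame_expand[OF x, of v] by simp
qed

definition "rot x v = - metric_form m x v (e2 x) *\<^sub>R e1 x + metric_form m x v (e1 x) *\<^sub>R e2 x"

lemma frame_cross:
  assumes x: "x \<in> U"
  shows "v $ 1 * w $ 2 - v $ 2 * w $ 1 =
    (metric_form m x v (e1 x) * metric_form m x w (e2 x) - metric_form m x v (e2 x) * metric_form m x w (e1 x)) / vol x"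
proof -
  have "fa x * fb2 x = 1 / vol x" using vol_pos[OF x] fa_pos[OF x] by (simp add: fb2_def)
  moreover have "v $ 1 * w $ 2 - v $ 2 * w $ 1 =
    (metric_form m x v (e1 x) * metric_form m x w (e2 x) - metric_form m x v (e2 x) * metric_form m x w (e1 x))
     * (fa x * fb2 x)"
    by (subst (1 2) frame_expand[OF x, of v], subst (1 2) frame_expand[OF x, of w])
      (simp add: algebra_simps)
  ultimately show ?thesis by simp
qed

lemma rot_components:
  assumes x: "x \<in> U"
  shows "metric_form m x (rot x v) (e1 x) = - metric_form m x v (e2 x)"
    "metric_form m x (rot x v) (e2 x) = metric_form m x v (e1 x)"
  unfolding rot_def metric_form_linear metric_frame[OF x] by simp_all

text \<open>Equal length and orthogonality determine the rotated vector up to sign, and orientation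
  fixes the sign. The conditions are those in the definition of \<open>rot90\<close>, so this
  evaluates its \<open>THE\<close>.\<close>

lemma rot_unique:
  assumes x: "x \<in> U"
  shows "w = rot x v \<longleftrightarrow> metric_form m x w w = metric_form m x v v \<and> metric_form m x v w = 0 \<and>
    (v = 0 \<or> v $ 1 * w $ 2 - v $ 2 * w $ 1 > 0)"
proof -
  define c1 where "c1 = metric_form m x v (e1 x)" define c2 where "c2 = metric_form m x v (e2 x)"
  define d1 where "d1 = metric_form m x w (e1 x)" define d2 where "d2 = metric_form m x w (e2 x)"
  have vz: "v = 0 \<longleftrightarrow> c1 = 0 \<and> c2 = 0"
    using frame_expand[OF x, of v] by (auto simp: c1_def c2_def metric_form_def)
  have wr: "w = rot x v \<longleftrightarrow> d1 = - c2 \<and> d2 = c1"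
    using frame_expand[OF x, of w] rot_components[OF x, of v]
    by (auto simp: c1_def c2_def d1_def d2_def rot_def)
  have cr: "v $ 1 * w $ 2 - v $ 2 * w $ 1 > 0 \<longleftrightarrow> c1 * d2 - c2 * d1 > 0"
    unfolding frame_cross[OF x, of v w] c1_def c2_def d1_def d2_def using vol_pos[OF x]
    by (simp add: zero_less_divide_iff)
  have mf: "metric_form m x w w = d1 * d1 + d2 * d2" "metric_form m x v v = c1 * c1 + c2 * c2"
    "metric_form m x v w = c1 * d1 + c2 * d2"
    unfolding c1_def c2_def d1_def d2_def by (rule metric_form_frame[OF x])+
  show ?thesis unfolding wr mf cr vz
  proof (intro iffI)
    assume "d1 = - c2 \<and> d2 = c1"
    moreover have "c1 = 0 \<and> c2 = 0 \<or> c1 * c1 + c2 * c2 > 0"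
      by (metis sum_squares_gt_zero_iff)
    ultimately show "d1 * d1 + d2 * d2 = c1 * c1 + c2 * c2 \<and> c1 * d1 + c2 * d2 = 0 \<and>
        (c1 = 0 \<and> c2 = 0 \<or> 0 < c1 * d2 - c2 * d1)" by auto
  next
    assume a: "d1 * d1 + d2 * d2 = c1 * c1 + c2 * c2 \<and> c1 * d1 + c2 * d2 = 0 \<and>
        (c1 = 0 \<and> c2 = 0 \<or> 0 < c1 * d2 - c2 * d1)"
    show "d1 = - c2 \<and> d2 = c1"
    proof (cases "c1 = 0 \<and> c2 = 0")
      case True
      then show ?thesis using a by (auto simp: sum_squares_eq_zero_iff)
    next
      case False
      define N where "N = c1 * c1 + c2 * c2"
      have N: "N > 0" using False unfolding N_def by (metis sum_squares_gt_zero_iff)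
      have k: "c1 * d2 - c2 * d1 > 0" "c1 * d1 + c2 * d2 = 0" "d1 * d1 + d2 * d2 = N"
        using a False by (auto simp: N_def)
      \<comment> \<open>Lagrange's identity: the squares of cross and inner product add up to the
        product of the squared lengths.\<close>
      have "(c1 * d2 - c2 * d1)\<^sup>2 = N\<^sup>2" using k(2,3) unfolding N_def by algebra
      then have e: "c1 * d2 - c2 * d1 = N" using k(1) N by (simp add: power2_eq_iff)
      have "N * d1 = N * (- c2)" "N * d2 = N * c1"
        using e k(2) unfolding N_def by algebra+
      then show ?thesis using N by (metis mult_left_cancel less_irrefl)
    qed
  qed
qed

lemma unit_vec_unit_normal_metric:
  assumes z: "fst z \<in> U"
  shows "metric_form m (fst z) (unit_vec z) (e1 (fst z)) = cos (snd z)"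
    "metric_form m (fst z) (unit_vec z) (e2 (fst z)) = sin (snd z)"
    "metric_form m (fst z) (unit_vec z) (unit_vec z) = 1" "rot (fst z) (unit_vec z) = unit_normal z"
    "rot (fst z) (unit_normal z) = - unit_vec z"
proof -
  show 1: "metric_form m (fst z) (unit_vec z) (e1 (fst z)) = cos (snd z)"
    and 2: "metric_form m (fst z) (unit_vec z) (e2 (fst z)) = sin (snd z)"
    unfolding unit_vec_def metric_form_linear metric_frame[OF z] by simp_all
  show "metric_form m (fst z) (unit_vec z) (unit_vec z) = 1"
    unfolding metric_form_frame[OF z, of "unit_vec z" "unit_vec z"] 1 2 by (metis sin_cos_squared_add3)
  show "rot (fst z) (unit_vec z) = unit_normal z" unfolding rot_def 1 2 unit_normal_def ..
  have 3: "metric_form m (fst z) (unit_normal z) (e1 (fst z)) = - sin (snd z)"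
    and 4: "metric_form m (fst z) (unit_normal z) (e2 (fst z)) = cos (snd z)"
    unfolding unit_normal_def metric_form_linear metric_frame[OF z] by simp_all
  show "rot (fst z) (unit_normal z) = - unit_vec z" unfolding rot_def 3 4 unit_vec_def by simp
qed

lemma unit_vec_cross:
  assumes z: "fst z \<in> U"
  shows "unit_vec z $ 1 * unit_normal z $ 2 - unit_vec z $ 2 * unit_normal z $ 1 = 1 / vol (fst z)"
proof -
  have "unit_vec z $ 1 * unit_normal z $ 2 - unit_vec z $ 2 * unit_normal z $ 1 = fa (fst z) * fb2 (fst z)"
  proof -
    have "\<lbrakk>c * c + s * s = 1\<rbrakk> \<Longrightarrow> (c * a + s * p) * (c * q) - s * q * (c * p - s * a) = a * q"
      for a p q c s :: real by algebra
    from this[OF sin_cos_squared_add3, of "snd z" "fa (fst z)" "fb1 (fst z)" "fb2 (fst z)"]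
    show ?thesis by (simp add: unit_vec_def unit_normal_def)
  qed
  also have "\<dots> = 1 / vol (fst z)" using fa_pos[OF z] vol_pos[OF z] by (simp add: fb2_def)
  finally show ?thesis .
qed

lemma unit_vector_angle:
  assumes x: "x \<in> U" and v: "metric_form m x v v = 1"
  obtains \<theta> where "v = unit_vec (x, \<theta>)"
proof -
  have "(metric_form m x v (e1 x))\<^sup>2 + (metric_form m x v (e2 x))\<^sup>2 = 1"
    using metric_form_frame[OF x, of v v] v by (simp add: power2_eq_square)
  then obtain \<theta> where "metric_form m x v (e1 x) = cos \<theta>" "metric_form m x v (e2 x) = sin \<theta>"
    by (metis sincos_total_2pi)
  then have "v = unit_vec (x, \<theta>)" using frame_expand[OF x, of v] by (simp add: unit_vec_def)
  then show thesis by (rule that)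
qed

lemma open_lift: "open (U \<times> (UNIV :: real set))"
  using U by (simp add: open_Times)

lemma smooth_on_lift: "smooth_on U f \<Longrightarrow> smooth_on (U \<times> (UNIV :: real set)) (\<lambda>z. f (fst z))"
  by (rule smooth_on_compose[OF open_lift U]) (auto intro!: smooth_intros open_lift)

lemma smooth_e: "smooth_on U e1" "smooth_on U e2"
  unfolding e1_def[abs_def] e2_def[abs_def] by (intro smooth_intros U)+

lemma smooth_lift:
  "smooth_on (U \<times> UNIV) unit_vec" "smooth_on (U \<times> UNIV) unit_normal"
  "smooth_on (U \<times> UNIV) lift_X" "smooth_on (U \<times> UNIV) lift_H"
proof -
  show p: "smooth_on (U \<times> UNIV) unit_vec" and q: "smooth_on (U \<times> UNIV) unit_normal"
    unfolding unit_vec_def[abs_def] unit_normal_def[abs_def]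
    by (intro smooth_intros open_lift smooth_on_lift smooth_e)+
  have c: "smooth_on (U \<times> (UNIV :: real set)) (\<lambda>z. conn k (fst z))" for k
    by (rule smooth_on_lift[OF smooth_frame(5)])
  show "smooth_on (U \<times> UNIV) lift_X" "smooth_on (U \<times> UNIV) lift_H"
    unfolding lift_X_def[abs_def] lift_H_def[abs_def] cform_def
    by (intro smooth_intros open_lift c p q)+
qed

lemma e_derivative:
  assumes x: "x \<in> U"
  shows "(e1 has_derivative (\<lambda>v. cform x v *\<^sub>R e2 x - chr_form m x v (e1 x))) (at x)"
    "(e2 has_derivative (\<lambda>v. - cform x v *\<^sub>R e1 x - chr_form m x v (e2 x))) (at x)"
proof -
  have D: "(f has_derivative (\<lambda>v. partial 1 f x * v $ 1 + partial 2 f x * v $ 2)) (at x)"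
    if "smooth_on U f" for f :: "real^2 \<Rightarrow> real"
    by (rule has_derivative_partial[OF that x])
  note fd = frame_derivative[OF x]
  have "(e1 has_derivative (\<lambda>v. (partial 1 fa x * v $ 1 + partial 2 fa x * v $ 2) *\<^sub>R axis 1 1)) (at x)"
    unfolding e1_def[abs_def] by (intro has_derivative_scaleR_left D smooth_frame)
  then show "(e1 has_derivative (\<lambda>v. cform x v *\<^sub>R e2 x - chr_form m x v (e1 x))) (at x)"
  proof (rule has_derivative_eq_rhs, intro ext)
    fix v
    have "conn 1 x * fb2 x = chr m 2 1 1 x * fa x" "conn 2 x * fb2 x = chr m 2 2 1 x * fa x"
      using fd(2)[of 1] fd(2)[of 2] by auto
    then show "(partial 1 fa x * v $ 1 + partial 2 fa x * v $ 2) *\<^sub>R axis 1 1 = cform x v *\<^sub>R e2 x - chr_form m x v (e1 x)"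
      by (simp add: vec_eq_iff forall_2 fd(1) chr_form_def cform_def sum_2 axis_def)
        (simp add: algebra_simps)
  qed
  have "(e2 has_derivative (\<lambda>v. (partial 1 fb1 x * v $ 1 + partial 2 fb1 x * v $ 2) *\<^sub>R axis 1 1
     + (partial 1 fb2 x * v $ 1 + partial 2 fb2 x * v $ 2) *\<^sub>R axis 2 1)) (at x)"
    unfolding e2_def[abs_def] by (intro has_derivative_add has_derivative_scaleR_left D smooth_frame)
  then show "(e2 has_derivative (\<lambda>v. - cform x v *\<^sub>R e1 x - chr_form m x v (e2 x))) (at x)"
  proof (rule has_derivative_eq_rhs, intro ext)
    fix v
    show "(partial 1 fb1 x * v $ 1 + partial 2 fb1 x * v $ 2) *\<^sub>R axis 1 1
     + (partial 1 fb2 x * v $ 1 + partial 2 fb2 x * v $ 2) *\<^sub>R axis 2 1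
     = - cform x v *\<^sub>R e1 x - chr_form m x v (e2 x)"
      by (simp add: vec_eq_iff forall_2 fd(3,4) chr_form_def cform_def sum_2 axis_def)
        (simp add: algebra_simps)
  qed
qed

text \<open>Turning the frame by the angle adds its differential to the connection form. The
  Christoffel term is the difference between coordinate and covariant derivative.\<close>

lemma unit_vec_derivative:
  assumes z: "fst z \<in> U"
  shows "(unit_vec has_derivative (\<lambda>v. (cform (fst z) (fst v) + snd v) *\<^sub>R unit_normal z - chr_form m (fst z) (fst v) (unit_vec z))) (at z)"
    "(unit_normal has_derivative (\<lambda>v. - (cform (fst z) (fst v) + snd v) *\<^sub>R unit_vec z - chr_form m (fst z) (fst v) (unit_normal z))) (at z)"
proof -
  have e: "((\<lambda>z. e1 (fst z)) has_derivative
      (\<lambda>v. cform (fst z) (fst v) *\<^sub>R e2 (fst z) - chr_form m (fst z) (fst v) (e1 (fst z)))) (at z)"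
    "((\<lambda>z. e2 (fst z)) has_derivative
      (\<lambda>v. - cform (fst z) (fst v) *\<^sub>R e1 (fst z) - chr_form m (fst z) (fst v) (e2 (fst z)))) (at z)"
    using diff_chain_at[OF has_derivative_fst[OF has_derivative_ident] e_derivative(1)[OF z]]
      diff_chain_at[OF has_derivative_fst[OF has_derivative_ident] e_derivative(2)[OF z]]
    by (simp_all add: comp_def)
  have s: "((\<lambda>z. sin (snd z)) has_derivative (\<lambda>v. cos (snd z) * snd v)) (at z)"
    and c: "((\<lambda>z. cos (snd z)) has_derivative (\<lambda>v. - sin (snd z) * snd v)) (at z)"
    by (auto intro!: derivative_eq_intros)
  show "(unit_vec has_derivative (\<lambda>v. (cform (fst z) (fst v) + snd v) *\<^sub>R unit_normal z - chr_form m (fst z) (fst v) (unit_vec z))) (at z)"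
    unfolding unit_vec_def[abs_def]
    by (rule has_derivative_eq_rhs[OF has_derivative_add[OF has_derivative_scaleR[OF c e(1)] has_derivative_scaleR[OF s e(2)]]])
      (simp add: fun_eq_iff unit_normal_def chr_form_linear algebra_simps)
  have cl: "chr_form m x u (- a *\<^sub>R v + b *\<^sub>R w) = - a *\<^sub>R chr_form m x u v + b *\<^sub>R chr_form m x u w" for x u v w a b
    by (rule chr_form_linear)
  show "(unit_normal has_derivative (\<lambda>v. - (cform (fst z) (fst v) + snd v) *\<^sub>R unit_vec z - chr_form m (fst z) (fst v) (unit_normal z))) (at z)"
    unfolding unit_normal_def[abs_def] cl
    by (rule has_derivative_eq_rhs[OF has_derivative_add[OF has_derivative_scaleR[OF has_derivative_minus[OF s] e(1)] has_derivative_scaleR[OF c e(2)]]])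
      (simp add: fun_eq_iff unit_vec_def algebra_simps)
qed

lemma cform_linear:
  "cform x (u + v) = cform x u + cform x v" "cform x (u - v) = cform x u - cform x v"
  "cform x (a *\<^sub>R v) = a * cform x v" "cform x (- v) = - cform x v"
  by (simp_all add: cform_def algebra_simps)

lemma cform_derivative:
  assumes z: "fst z \<in> U" and u: "(u has_derivative u') (at z)"
  shows "((\<lambda>z. cform (fst z) (u z)) has_derivative (\<lambda>v. cform (fst z) (u' v) +
     (partial 1 (conn 1) (fst z) * fst v $ 1 + partial 2 (conn 1) (fst z) * fst v $ 2) * u z $ 1 +
     (partial 1 (conn 2) (fst z) * fst v $ 1 + partial 2 (conn 2) (fst z) * fst v $ 2) * u z $ 2)) (at z)"
proof -
  have c: "((\<lambda>z. conn k (fst z)) has_derivative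
      (\<lambda>v. partial 1 (conn k) (fst z) * fst v $ 1 + partial 2 (conn k) (fst z) * fst v $ 2)) (at z)" for k
  proof -
    have "(conn k has_derivative (\<lambda>v. partial 1 (conn k) (fst z) * v $ 1 + partial 2 (conn k) (fst z) * v $ 2)) (at (fst z))"
      by (rule has_derivative_partial[OF smooth_frame(5) z])
    from diff_chain_at[OF has_derivative_fst[OF has_derivative_ident] this] show ?thesis
      by (simp add: comp_def)
  qed
  have u: "((\<lambda>z. u z $ i) has_derivative (\<lambda>v. u' v $ i)) (at z)" for i
    by (rule bounded_linear.has_derivative[OF bounded_linear_vec_nth u])
  show ?thesis
    unfolding cform_def
    by (rule has_derivative_eq_rhs[OF has_derivative_add[OF has_derivative_mult[OF c u] has_derivative_mult[OF c u]]])
      (simp add: fun_eq_iff algebra_simps)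
qed

text \<open>The first line is the geodesic equation. The second to fourth are
  \<open>[V, X] = H\<close>, \<open>[V, H] = - X\<close> and \<open>[X, H] = K V\<close> in
  coordinates. In the last one the base component vanishes by symmetry of the Christoffel symbols,
  and the angular component is minus the exterior derivative of the connection form on the pair
  \<open>unit_vec\<close>, \<open>unit_normal\<close>, hence the curvature.\<close>

lemma lift_brackets:
  assumes z: "fst z \<in> U"
  shows "frechet_derivative unit_vec (at z) (lift_X z) = - chr_form m (fst z) (unit_vec z) (unit_vec z)"
    "frechet_derivative lift_X (at z) (0, 1) = lift_H z"
    "frechet_derivative lift_H (at z) (0, 1) = - lift_X z"
    "frechet_derivative lift_H (at z) (lift_X z) - frechet_derivative lift_X (at z) (lift_H z) = (0, curv (fst z))"
    "frechet_derivative unit_vec (at z) (0, t) = t *\<^sub>R unit_normal z"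
proof -
  note p = unit_vec_derivative(1)[OF z] and q = unit_vec_derivative(2)[OF z]
  note X = has_derivative_Pair[OF p has_derivative_minus[OF cform_derivative[OF z p]], folded lift_X_def]
  note H = has_derivative_Pair[OF q has_derivative_minus[OF cform_derivative[OF z q]], folded lift_H_def]
  note X' = frechet_derivative_at[OF X, symmetric] and H' = frechet_derivative_at[OF H, symmetric]
    and p' = frechet_derivative_at[OF p, symmetric]
  have c0: "cform x 0 = 0" "chr_form m x 0 v = 0" for x v
    by (simp_all add: cform_def chr_form_def vec_eq_iff)
  show "frechet_derivative unit_vec (at z) (lift_X z) = - chr_form m (fst z) (unit_vec z) (unit_vec z)"
    unfolding p' by (simp add: lift_X_def)
  show "frechet_derivative unit_vec (at z) (0, t) = t *\<^sub>R unit_normal z"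
    unfolding p' by (simp add: c0)
  show "frechet_derivative lift_X (at z) (0, 1) = lift_H z"
    unfolding X' by (simp add: c0 lift_H_def)
  show "frechet_derivative lift_H (at z) (0, 1) = - lift_X z"
    unfolding H' by (simp add: c0 lift_X_def cform_linear)
  have "frechet_derivative lift_H (at z) (lift_X z) - frechet_derivative lift_X (at z) (lift_H z) =
     (0, - (partial 1 (conn 2) (fst z) - partial 2 (conn 1) (fst z)) * (unit_vec z $ 1 * unit_normal z $ 2 - unit_vec z $ 2 * unit_normal z $ 1))"
    unfolding X' H' using chr_form_sym[OF z, of "unit_normal z" "unit_vec z"]
    by (simp add: lift_X_def lift_H_def cform_linear algebra_simps)
  then show "frechet_derivative lift_H (at z) (lift_X z) - frechet_derivative lift_X (at z) (lift_H z) = (0, curv (fst z))"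
    unfolding unit_vec_cross[OF z] curv_conn[OF z] by simp
qed

end

text \<open>The transformation law of the Christoffel symbols under an isometry. The isometry
  condition is differentiated once (\<open>der\<close>) and inserted into the Koszul formula;
  symmetry of the second derivative of \<open>T\<close> merges its two occurrences. Surjectivity of
  the differential and definiteness of the metric then remove the test vector.\<close>

lemma chr_form_transform:
  assumes P: "plane_metric U m" and P': "plane_metric U' m'"
    and S: "open S" "S \<subseteq> U" and T: "smooth_on S T" "T ` S \<subseteq> U'"
    and iso: "\<And>x a b. x \<in> S \<Longrightarrow> metric_form m x a b =
      metric_form m' (T x) (frechet_derivative T (at x) a) (frechet_derivative T (at x) b)"
    and x: "x \<in> S" and onto: "\<And>w. \<exists>a. frechet_derivative T (at x) a = w"
  shows "frechet_derivative T (at x) (chr_form m x v v) =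
    chr_form m' (T x) (frechet_derivative T (at x) v) (frechet_derivative T (at x) v)
    + frechet_derivative (\<lambda>y. frechet_derivative T (at y) v) (at x) v"
proof -
  interpret P: plane_metric U m by fact
  interpret P': plane_metric U' m' by fact
  define J where "J y a = frechet_derivative T (at y) a" for y a
  define J2 where "J2 w a = frechet_derivative (\<lambda>y. J y a) (at x) w" for w a
  have xU: "x \<in> U" "T x \<in> U'" using x S T by auto
  have J2: "((\<lambda>y. J y a) has_derivative (\<lambda>w. J2 w a)) (at x)" for a
    using smooth_on_has_derivative[OF smooth_on_derivative[OF T(1)] x] unfolding J2_def J_def .
  have J2s: "J2 w a = J2 a w" for w a
    unfolding J2_def J_def by (rule symmetric_second_derivative[OF S(1) T(1) x])
  have der: "metric_deriv m x w a b = metric_deriv m' (T x) (J x w) (J x a) (J x b)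
      + metric_form m' (T x) (J2 w a) (J x b) + metric_form m' (T x) (J x a) (J2 w b)" for w a b
  proof -
    have 1: "((\<lambda>y. metric_form m y a b) has_derivative (\<lambda>w. metric_deriv m x w a b)) (at x)"
      using bilinear_sum_has_derivative[of m, OF smooth_on_has_derivative[OF P.smooth_m xU(1)]
          has_derivative_const has_derivative_const]
      by (simp add: metric_form_def metric_deriv_def)
    have c: "((\<lambda>y. m' i j (T y)) has_derivative (\<lambda>w. frechet_derivative (m' i j) (at (T x)) (J x w))) (at x)" for i j
      using diff_chain_at[OF smooth_on_has_derivative[OF T(1) x] smooth_on_has_derivative[OF P'.smooth_m xU(2)]]
      by (simp add: comp_def J_def)
    have 2: "((\<lambda>y. metric_form m' (T y) (J y a) (J y b)) has_derivative
       (\<lambda>w. metric_deriv m' (T x) (J x w) (J x a) (J x b)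
      + metric_form m' (T x) (J2 w a) (J x b) + metric_form m' (T x) (J x a) (J2 w b))) (at x)"
      using bilinear_sum_has_derivative[OF c J2 J2]
      by (simp add: metric_form_def metric_deriv_def)
    have "((\<lambda>y. metric_form m y a b) has_derivative
       (\<lambda>w. metric_deriv m' (T x) (J x w) (J x a) (J x b)
      + metric_form m' (T x) (J2 w a) (J x b) + metric_form m' (T x) (J x a) (J2 w b))) (at x)"
      by (rule has_derivative_transform_within_open[OF 2 S(1) x]) (simp add: iso J_def)
    from has_derivative_unique[OF 1 this] show ?thesis by (rule fun_cong)
  qed
  let ?A = "J x (chr_form m x v v)" and ?B = "chr_form m' (T x) (J x v) (J x v) + J2 v v"
  have "metric_form m' (T x) ?A (J x z) = metric_form m' (T x) ?B (J x z)" for z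
  proof -
    have "metric_form m' (T x) ?A (J x z) = metric_deriv m x v v z - metric_deriv m x z v v / 2"
      using iso[OF x, of "chr_form m x v v" z] P.chr_form_lower[OF xU(1), of v z] by (simp add: J_def)
    also have "\<dots> = metric_deriv m' (T x) (J x v) (J x v) (J x z) - metric_deriv m' (T x) (J x z) (J x v) (J x v) / 2
       + metric_form m' (T x) (J2 v v) (J x z)"
      unfolding der J2s[of v z] P'.metric_form_sym[OF xU(2), of "J2 z v"] by (simp add: field_simps)
    also have "\<dots> = metric_form m' (T x) ?B (J x z)"
      unfolding metric_form_linear P'.chr_form_lower[OF xU(2)] ..
    finally show ?thesis .
  qed
  then have "metric_form m' (T x) (?A - ?B) (J x z) = 0" for z
    unfolding metric_form_linear by simp
  moreover obtain z where "J x z = ?A - ?B" using onto unfolding J_def by metis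
  ultimately have "?A - ?B = 0" using P'.metric_form_definite[OF xU(2)] by metis
  then show ?thesis unfolding J2_def J_def by simp
qed

section \<open>The unit tangent bundle\<close>

context smooth_manifold
begin

lemma tvec_of_transition:
  assumes c: "(U, \<sigma>) \<in> A" "x \<in> U" and d: "(W, \<tau>) \<in> A" "y \<in> W" and eq: "\<sigma> x = \<tau> y"
  shows "tvec_of A \<sigma> x \<xi> = tvec_of A \<tau> y (frechet_derivative (\<lambda>x. inv_into W \<tau> (\<sigma> x)) (at x) \<xi>)"
proof
  fix f
  define T where "T x = inv_into W \<tau> (\<sigma> x)" for x
  define D where "D = {x \<in> U. \<sigma> x \<in> \<tau> ` W}"
  note T = smooth_map_chart[OF identity_smooth c(1) d(1), folded T_def, folded D_def]
  have xD: "x \<in> D" "T x = y" using T(5)[OF c(2) d(2) eq] by auto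
  have "tvec_of A \<sigma> x \<xi> f = tvec_of A \<tau> y (frechet_derivative T (at x) \<xi>) f"
  proof (cases "smooth_near A f (\<sigma> x)")
    case True
    have fy: "smooth_near A f (\<tau> y)" using True eq by simp
    have "((f \<circ> \<tau>) \<circ> T has_derivative (\<lambda>\<xi>. tvec_of A \<tau> y \<xi> f) \<circ> frechet_derivative T (at x)) (at x)"
      by (rule diff_chain_at[OF smooth_on_has_derivative[OF T(2) xD(1)]])
        (use chart_has_derivative[OF d(1,2) fy] xD in simp)
    then have "(f \<circ> \<sigma> has_derivative (\<lambda>\<xi>. tvec_of A \<tau> y \<xi> f) \<circ> frechet_derivative T (at x)) (at x)"
      by (rule has_derivative_transform_within_open[OF _ T(1) xD(1)]) (simp add: T(3))
    from has_derivative_unique[OF chart_has_derivative[OF c True] this]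
    show ?thesis by (auto dest: fun_cong[of _ _ \<xi>])
  qed (simp add: tvec_of_def eq)
  then show "tvec_of A \<sigma> x \<xi> f = tvec_of A \<tau> y (frechet_derivative (\<lambda>x. inv_into W \<tau> (\<sigma> x)) (at x) \<xi>) f"
    by (simp add: T_def[abs_def])
qed

end

text \<open>With 2 t = \<theta> - b the quotient is - cot t = tan (t - pi / 2), and t - pi / 2 lies
  in the range of \<open>arctan\<close>. This recovers the angle smoothly from its sine and cosine
  on a whole open interval of length 2 pi.\<close>

lemma angle_arctan:
  assumes "b < \<theta>" "\<theta> < b + 2 * pi"
  shows "\<theta> = b + pi + 2 * arctan (- sin (\<theta> - b) / (1 - cos (\<theta> - b)))"
proof -
  define t where "t = (\<theta> - b) / 2"
  have t: "0 < t" "t < pi" "\<theta> - b = 2 * t" using assms by (auto simp: t_def)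
  have s: "sin t > 0" by (rule sin_gt_zero[OF t(1,2)])
  have "- sin (2 * t) / (1 - cos (2 * t)) = - cos t / sin t"
    using s by (simp add: sin_double cos_double_sin power2_eq_square)
  also have "\<dots> = tan (t - pi / 2)"
    by (simp add: tan_def sin_diff cos_diff)
  finally have "arctan (- sin (2 * t) / (1 - cos (2 * t))) = t - pi / 2"
    using t by (simp add: arctan_tan)
  then show ?thesis unfolding t(3) using t(3) by simp
qed

text \<open>\<open>C * cos b + S * sin b\<close> is the cosine of the angle measured from
  \<open>b\<close>. The value 1 belongs to the only direction that the open interval misses.\<close>

lemma angle_in_interval:
  assumes "C\<^sup>2 + S\<^sup>2 = 1" "C * cos b + S * sin b \<noteq> 1"
  obtains \<theta> where "b < \<theta>" "\<theta> < b + 2 * pi" "C = cos \<theta>" "S = sin \<theta>"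
proof -
  have sc: "sin b * sin b + cos b * cos b = 1" using sin_cos_squared_add3[of b] by (simp add: add.commute)
  have "(C * cos b + S * sin b)\<^sup>2 + (S * cos b - C * sin b)\<^sup>2 = 1"
    using assms(1) sc by algebra
  then obtain \<alpha> where \<alpha>: "0 \<le> \<alpha>" "\<alpha> < 2 * pi" "C * cos b + S * sin b = cos \<alpha>" "S * cos b - C * sin b = sin \<alpha>"
    by (metis sincos_total_2pi)
  have "\<alpha> \<noteq> 0" using assms(2) \<alpha>(3) by auto
  moreover have "C = cos (b + \<alpha>)" "S = sin (b + \<alpha>)"
    unfolding cos_add sin_add \<alpha>(3,4)[symmetric] using sc by algebra+
  ultimately show thesis using that[of "b + \<alpha>"] \<alpha> by auto
qed

lemma angle_unique:
  assumes "b < \<theta>" "\<theta> < b + 2 * pi" "b < \<theta>'" "\<theta>' < b + 2 * pi" "cos \<theta> = cos \<theta>'" "sin \<theta> = sin \<theta>'"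
  shows "\<theta> = \<theta>'"
proof -
  have "sin (\<theta> - b) = sin (\<theta>' - b)" "cos (\<theta> - b) = cos (\<theta>' - b)"
    using assms(5,6) by (simp_all add: sin_diff cos_diff)
  then show ?thesis using angle_arctan[OF assms(1,2)] angle_arctan[OF assms(3,4)] by simp
qed

lemma angle_not_endpoint:
  assumes "b < \<theta>" "\<theta> < b + 2 * pi"
  shows "cos \<theta> * cos b + sin \<theta> * sin b \<noteq> 1"
proof
  assume "cos \<theta> * cos b + sin \<theta> * sin b = 1"
  then have "cos (\<theta> - b) = 1" by (simp add: cos_diff)
  then obtain n :: int where "\<theta> - b = of_int n * 2 * pi" using cos_one_2pi_int by auto
  then have n: "\<theta> - b = of_int n * (2 * pi)" by (simp only: mult.assoc)
  have "0 < of_int n * (2 * pi)" "of_int n * (2 * pi) < 1 * (2 * pi)"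
    unfolding n[symmetric] using assms by linarith+
  then have "(0::real) < of_int n" "of_int n < (1::real)"
    by (auto simp: zero_less_mult_iff mult_less_cancel_right)
  then have "0 < n" "n < 1" by (simp_all only: of_int_0_less_iff of_int_less_1_iff)
  then show False by simp
qed

section \<open>The atlas of the unit tangent bundle\<close>

locale riemannian_surface = smooth_manifold A for A :: "'m surface" +
  fixes g :: "'m metric"
  assumes oriented: "oriented_atlas A" and metric: "riemannian_metric A g"
begin

abbreviation mc where "mc U \<sigma> \<equiv> metric_coeff A g (U, \<sigma>)"

lemma coord_vec_eq:
  assumes c: "(U, \<sigma>) \<in> A" "x \<in> U"
  shows "coord_vec A (U, \<sigma>) x i = tvec_of A \<sigma> x (axis i 1)"
proof -
  have "((\<lambda>t. x + t *\<^sub>R axis i 1) has_vector_derivative axis i 1) (at 0)"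
    by (auto intro!: derivative_eq_intros)
  from velocity_chart[OF c this] show ?thesis by (simp add: coord_vec_def)
qed

lemma metric_tvec_of:
  assumes c: "(U, \<sigma>) \<in> A" "x \<in> U"
  shows "g (\<sigma> x) (tvec_of A \<sigma> x \<xi>) (tvec_of A \<sigma> x \<eta>) = metric_form (mc U \<sigma>) x \<xi> \<eta>"
proof -
  let ?t = "tvec_of A \<sigma> x"
  have T: "?t \<xi> \<in> tangent_space A (\<sigma> x)" for \<xi> using tangent_space_eq[OF c] by simp
  have p: "\<sigma> x \<in> points A" by (rule pointsI[OF c])
  have sy: "g (\<sigma> x) (?t u) (?t v) = g (\<sigma> x) (?t v) (?t u)" for u v
    using metric p T unfolding riemannian_metric_def by blast
  have "g (\<sigma> x) (\<lambda>f. a * ?t u f + b * ?t v f) (?t w) = a * g (\<sigma> x) (?t u) (?t w) + b * g (\<sigma> x) (?t v) (?t w)"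
    for u v w a b
    using metric p T unfolding riemannian_metric_def by blast
  then have l: "g (\<sigma> x) (?t (a *\<^sub>R u + b *\<^sub>R v)) (?t w) = a * g (\<sigma> x) (?t u) (?t w) + b * g (\<sigma> x) (?t v) (?t w)"
    for u v w a b unfolding tvec_of_linear[OF c] .
  have r: "g (\<sigma> x) (?t w) (?t (a *\<^sub>R u + b *\<^sub>R v)) = a * g (\<sigma> x) (?t w) (?t u) + b * g (\<sigma> x) (?t w) (?t v)"
    for u v w a b using l sy by metis
  show ?thesis
    by (subst (1) vec2_expand[of \<xi>], subst (1) vec2_expand[of \<eta>])
      (simp add: l r metric_form_def sum_2 metric_coeff_def coord_vec_eq[OF c] algebra_simps)
qed

lemma metric_pos:
  assumes c: "(U, \<sigma>) \<in> A" "x \<in> U" and "\<xi> \<noteq> 0"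
  shows "metric_form (mc U \<sigma>) x \<xi> \<xi> > 0"
proof -
  have "tvec_of A \<sigma> x \<xi> \<noteq> (\<lambda>f. 0)" using tvec_of_inj[OF c, of \<xi> 0] tvec_of_zero[OF c] assms(3) by metis
  moreover have "tvec_of A \<sigma> x \<xi> \<in> tangent_space A (\<sigma> x)" using tangent_space_eq[OF c] by simp
  ultimately show ?thesis
    using metric pointsI[OF c] unfolding riemannian_metric_def metric_tvec_of[OF c, symmetric] by blast
qed

lemma plane_metric:
  assumes c: "(U, \<sigma>) \<in> A"
  shows "plane_metric U (mc U \<sigma>)"
proof
  show "open U" by (rule chart_open[OF c])
  show "smooth_on U (mc U \<sigma> i j)" for i j
    using metric c unfolding riemannian_metric_def by fastforce
  fix x assume x: "x \<in> U"
  have T: "tvec_of A \<sigma> x \<xi> \<in> tangent_space A (\<sigma> x)" for \<xi> using tangent_space_eq[OF c x] by simp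
  show sy: "mc U \<sigma> i j x = mc U \<sigma> j i x" for i j
    unfolding metric_coeff_def using metric pointsI[OF c x] T coord_vec_eq[OF c x]
    unfolding riemannian_metric_def by fastforce
  have "(axis 1 1 :: real^2) \<noteq> 0" by (simp add: axis_eq_0_iff)
  from metric_pos[OF c x this] show 1: "mc U \<sigma> 1 1 x > 0"
    by (simp add: metric_form_def sum_2 axis_def)
  \<comment> \<open>On this vector the metric has the value \<open>mc U \<sigma> 1 1 x\<close> times
    the determinant, so definiteness makes the determinant positive.\<close>
  let ?v = "vector [- mc U \<sigma> 1 2 x, mc U \<sigma> 1 1 x] :: real^2"
  have "?v \<noteq> 0" using 1 by (auto simp: vec_eq_iff forall_2)
  from metric_pos[OF c x this]
  have "mc U \<sigma> 1 1 x * (mc U \<sigma> 1 1 x * mc U \<sigma> 2 2 x - mc U \<sigma> 1 2 x * mc U \<sigma> 1 2 x) > 0"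
    by (simp add: metric_form_def sum_2 sy[of 2 1] algebra_simps)
  then show "mc U \<sigma> 1 1 x * mc U \<sigma> 2 2 x - mc U \<sigma> 1 2 x * mc U \<sigma> 1 2 x > 0"
    using 1 by (simp add: zero_less_mult_iff)
qed

lemma tvec_of_zero_iff: "(U, \<sigma>) \<in> A \<Longrightarrow> x \<in> U \<Longrightarrow> tvec_of A \<sigma> x \<xi> = (\<lambda>f. 0) \<longleftrightarrow> \<xi> = 0"
  using tvec_of_inj[of U \<sigma> x \<xi> 0] tvec_of_zero[of U \<sigma> x] by auto

lemma tvec_of_coord_component:
  assumes "(W, \<tau>) \<in> A" "y \<in> W"
  shows "tvec_of A \<tau> y \<xi> (coord (W, \<tau>) k) = \<xi> $ k"
  unfolding coord_def fst_conv snd_conv by (rule tvec_of_coord(2)[OF assms bounded_linear_vec_nth])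

lemma cross_transition:
  assumes c: "(U, \<sigma>) \<in> A" "x \<in> U" and d: "(W, \<tau>) \<in> A" "y \<in> W" and eq: "\<sigma> x = \<tau> y"
  defines "J \<equiv> frechet_derivative (\<lambda>x. inv_into W \<tau> (\<sigma> x)) (at x)"
  shows "J \<xi> $ 1 * J \<eta> $ 2 - J \<xi> $ 2 * J \<eta> $ 1 > 0 \<longleftrightarrow> \<xi> $ 1 * \<eta> $ 2 - \<xi> $ 2 * \<eta> $ 1 > 0"
proof -
  note T = smooth_map_chart[OF identity_smooth c(1) d(1)]
  have xD: "x \<in> {x \<in> U. \<sigma> x \<in> \<tau> ` W}" using c d eq by auto
  have lin: "linear J" unfolding J_def
    by (rule has_derivative_linear[OF smooth_on_has_derivative[OF T(2) xD]])
  have "det (matrix J) > 0"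
    using oriented c d xD unfolding oriented_atlas_def J_def by fastforce
  then have det: "J (axis 1 1) $ 1 * J (axis 2 1) $ 2 - J (axis 2 1) $ 1 * J (axis 1 1) $ 2 > 0"
    by (simp add: det_2 matrix_def)
  have J: "J v = v $ 1 *\<^sub>R J (axis 1 1) + v $ 2 *\<^sub>R J (axis 2 1)" for v
    by (subst vec2_expand[of v]) (simp only: linear_add[OF lin] linear_scale[OF lin])
  have "J \<xi> $ 1 * J \<eta> $ 2 - J \<xi> $ 2 * J \<eta> $ 1 =
    (J (axis 1 1) $ 1 * J (axis 2 1) $ 2 - J (axis 2 1) $ 1 * J (axis 1 1) $ 2) * (\<xi> $ 1 * \<eta> $ 2 - \<xi> $ 2 * \<eta> $ 1)"
    unfolding J[of \<xi>] J[of \<eta>] by (simp add: algebra_simps)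
  then show ?thesis using det by (simp add: zero_less_mult_iff)
qed

text \<open>The definition quantifies over all charts around the point. Transition maps have
  positive determinant, so the sign in a single chart decides.\<close>

lemma positively_oriented_tvec_of:
  assumes c: "(U, \<sigma>) \<in> A" "x \<in> U"
  shows "positively_oriented A (\<sigma> x) (tvec_of A \<sigma> x \<xi>) (tvec_of A \<sigma> x \<eta>) \<longleftrightarrow> \<xi> $ 1 * \<eta> $ 2 - \<xi> $ 2 * \<eta> $ 1 > 0"
proof
  assume "positively_oriented A (\<sigma> x) (tvec_of A \<sigma> x \<xi>) (tvec_of A \<sigma> x \<eta>)"
  then show "\<xi> $ 1 * \<eta> $ 2 - \<xi> $ 2 * \<eta> $ 1 > 0"
    using c unfolding positively_oriented_def by (force simp: tvec_of_coord_component[OF c])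
next
  assume pos: "\<xi> $ 1 * \<eta> $ 2 - \<xi> $ 2 * \<eta> $ 1 > 0"
  show "positively_oriented A (\<sigma> x) (tvec_of A \<sigma> x \<xi>) (tvec_of A \<sigma> x \<eta>)"
    unfolding positively_oriented_def
  proof clarify
    fix W \<tau> y assume d: "(W, \<tau>) \<in> A" "\<sigma> x = snd (W, \<tau>) y" "y \<in> fst (W, \<tau>)"
    then have d: "(W, \<tau>) \<in> A" "y \<in> W" "\<sigma> x = \<tau> y" by auto
    show "tvec_of A \<sigma> x \<xi> (coord (W, \<tau>) 1) * tvec_of A \<sigma> x \<eta> (coord (W, \<tau>) 2)
       - tvec_of A \<sigma> x \<xi> (coord (W, \<tau>) 2) * tvec_of A \<sigma> x \<eta> (coord (W, \<tau>) 1) > 0"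
      unfolding tvec_of_transition[OF c d] tvec_of_coord_component[OF d(1,2)] cross_transition[OF c d]
      by (rule pos)
  qed
qed

lemma rot90_tvec_of:
  assumes c: "(U, \<sigma>) \<in> A" "x \<in> U"
  shows "rot90 A g (\<sigma> x) (tvec_of A \<sigma> x \<xi>) = tvec_of A \<sigma> x (plane_metric.rot (mc U \<sigma>) x \<xi>)"
proof -
  interpret P: plane_metric U "mc U \<sigma>" by (rule plane_metric[OF c(1)])
  have *: "(tvec_of A \<sigma> x \<eta> \<in> tangent_space A (\<sigma> x) \<and> g (\<sigma> x) (tvec_of A \<sigma> x \<eta>) (tvec_of A \<sigma> x \<eta>) = g (\<sigma> x) (tvec_of A \<sigma> x \<xi>) (tvec_of A \<sigma> x \<xi>)
      \<and> g (\<sigma> x) (tvec_of A \<sigma> x \<xi>) (tvec_of A \<sigma> x \<eta>) = 0 \<and>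
     (tvec_of A \<sigma> x \<xi> = (\<lambda>f. 0) \<or> positively_oriented A (\<sigma> x) (tvec_of A \<sigma> x \<xi>) (tvec_of A \<sigma> x \<eta>))) \<longleftrightarrow> \<eta> = P.rot x \<xi>" for \<eta>
    unfolding P.rot_unique[OF c(2), of \<eta> \<xi>] metric_tvec_of[OF c] positively_oriented_tvec_of[OF c] tvec_of_zero_iff[OF c]
    using tangent_space_eq[OF c] by simp
  show ?thesis unfolding rot90_def
  proof (rule the_equality)
    fix w assume w: "w \<in> tangent_space A (\<sigma> x) \<and> g (\<sigma> x) w w = g (\<sigma> x) (tvec_of A \<sigma> x \<xi>) (tvec_of A \<sigma> x \<xi>)
      \<and> g (\<sigma> x) (tvec_of A \<sigma> x \<xi>) w = 0 \<and>
     (tvec_of A \<sigma> x \<xi> = (\<lambda>f. 0) \<or> positively_oriented A (\<sigma> x) (tvec_of A \<sigma> x \<xi>) w)"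
    then obtain \<eta> where \<eta>: "w = tvec_of A \<sigma> x \<eta>" using tangent_space_eq[OF c] by auto
    show "w = tvec_of A \<sigma> x (P.rot x \<xi>)" using w *[of \<eta>] unfolding \<eta> by simp
  qed (use * in blast)
qed

lemma rotate_by_tvec_of:
  assumes c: "(U, \<sigma>) \<in> A" "x \<in> U"
  shows "rotate_by A g (\<sigma> x) \<theta> (tvec_of A \<sigma> x \<xi>) =
    tvec_of A \<sigma> x (cos \<theta> *\<^sub>R \<xi> + sin \<theta> *\<^sub>R plane_metric.rot (mc U \<sigma>) x \<xi>)"
  unfolding rotate_by_def rot90_tvec_of[OF c] tvec_of_linear[OF c] ..

abbreviation lift_p where "lift_p U \<sigma> \<equiv> plane_metric.unit_vec (mc U \<sigma>)"

text \<open>The parametrization in \<open>unit_bundle_atlas\<close> before the angle is restricted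
  to an interval; one map thus serves all bundle charts over the same chart
  \<open>c\<close>.\<close>

definition lift where
  "lift c = (\<lambda>(x, \<theta>). (snd c x, rotate_by A g (snd c x) \<theta> (unit_coord_vec A g c x)))"

lemma lift_eq:
  assumes c: "(U, \<sigma>) \<in> A" "fst z \<in> U"
  shows "lift (U, \<sigma>) z = (\<sigma> (fst z), tvec_of A \<sigma> (fst z) (lift_p U \<sigma> z))"
proof -
  interpret P: plane_metric U "mc U \<sigma>" by (rule plane_metric[OF c(1)])
  have u: "unit_coord_vec A g (U, \<sigma>) (fst z) = tvec_of A \<sigma> (fst z) (P.e1 (fst z))"
    unfolding unit_coord_vec_def P.e1_def tvec_of_scale[OF c] coord_vec_eq[OF c]
    by (simp add: P.fa_def fun_eq_iff)
  have "P.rot (fst z) (P.e1 (fst z)) = P.e2 (fst z)"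
    unfolding P.rot_def by (simp add: P.metric_frame[OF c(2)])
  then show ?thesis
    by (simp add: lift_def case_prod_beta u rotate_by_tvec_of[OF c] P.unit_vec_def)
qed

lemma rotate_by_lift:
  assumes c: "(U, \<sigma>) \<in> A" "x \<in> U"
  shows "rotate_by A g (\<sigma> x) t (tvec_of A \<sigma> x (lift_p U \<sigma> (x, \<theta>))) = tvec_of A \<sigma> x (lift_p U \<sigma> (x, \<theta> + t))"
proof -
  interpret P: plane_metric U "mc U \<sigma>" by (rule plane_metric[OF c(1)])
  have "cos t *\<^sub>R P.unit_vec (x, \<theta>) + sin t *\<^sub>R P.unit_normal (x, \<theta>) = P.unit_vec (x, \<theta> + t)"
    by (simp add: P.unit_vec_def P.unit_normal_def cos_add sin_add algebra_simps)
  then show ?thesis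
    using rotate_by_tvec_of[OF c] P.unit_vec_unit_normal_metric(4)[of "(x, \<theta>)"] c by simp
qed

abbreviation B where "B \<equiv> unit_bundle_atlas A g"

lemma bundle_chartI: "(U, \<sigma>) \<in> A \<Longrightarrow> (U \<times> {a<..<a + 2 * pi}, lift (U, \<sigma>)) \<in> B"
  unfolding unit_bundle_atlas_def lift_def by force

lemma bundle_chartE:
  assumes "(V, \<rho>) \<in> B"
  obtains U \<sigma> a where "(U, \<sigma>) \<in> A" "V = U \<times> {a<..<a + 2 * pi}" "\<rho> = lift (U, \<sigma>)"
  using assms unfolding unit_bundle_atlas_def lift_def by fastforce

lemma lift_eq_iff:
  assumes c: "(U, \<sigma>) \<in> A" "fst z \<in> U" and d: "(W, \<tau>) \<in> A" "fst z' \<in> W"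
  defines "J \<equiv> frechet_derivative (\<lambda>x. inv_into W \<tau> (\<sigma> x)) (at (fst z))"
  shows "lift (U, \<sigma>) z = lift (W, \<tau>) z' \<longleftrightarrow> \<sigma> (fst z) = \<tau> (fst z') \<and> J (lift_p U \<sigma> z) = lift_p W \<tau> z'"
proof (cases "\<sigma> (fst z) = \<tau> (fst z')")
  case True
  then show ?thesis
    unfolding lift_eq[OF c] lift_eq[OF d] tvec_of_transition[OF c d True] J_def
    using tvec_of_inj[OF d] by auto
qed (simp add: lift_eq[OF c] lift_eq[OF d])

lemma metric_transition:
  assumes c: "(U, \<sigma>) \<in> A" "x \<in> U" and d: "(W, \<tau>) \<in> A" "y \<in> W" and eq: "\<sigma> x = \<tau> y"
  defines "J \<equiv> frechet_derivative (\<lambda>x. inv_into W \<tau> (\<sigma> x)) (at x)"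
  shows "metric_form (mc U \<sigma>) x u v = metric_form (mc W \<tau>) y (J u) (J v)" "\<exists>u. J u = w"
proof -
  show "metric_form (mc U \<sigma>) x u v = metric_form (mc W \<tau>) y (J u) (J v)"
    unfolding metric_tvec_of[OF c, symmetric] metric_tvec_of[OF d, symmetric] tvec_of_transition[OF c d eq] J_def eq ..
  have "tvec_of A \<tau> y w \<in> tangent_space A (\<sigma> x)" unfolding eq using tangent_space_eq[OF d] by simp
  then obtain u where "tvec_of A \<tau> y w = tvec_of A \<sigma> x u" using tangent_space_eq[OF c] by auto
  then show "\<exists>u. J u = w" using tvec_of_transition[OF c d eq] tvec_of_inj[OF d] unfolding J_def by metis
qed

lemma lift_p_eq_iff:
  assumes c: "(U, \<sigma>) \<in> A" "x \<in> U"
  shows "v = lift_p U \<sigma> (x, \<theta>) \<longleftrightarrow>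
    metric_form (mc U \<sigma>) x v (plane_metric.e1 (mc U \<sigma>) x) = cos \<theta> \<and>
    metric_form (mc U \<sigma>) x v (plane_metric.e2 (mc U \<sigma>) x) = sin \<theta>"
proof -
  interpret P: plane_metric U "mc U \<sigma>" by (rule plane_metric[OF c(1)])
  show ?thesis
    using P.unit_vec_unit_normal_metric(1,2)[of "(x, \<theta>)"] c P.frame_expand[OF c(2), of v] by (auto simp: P.unit_vec_def)
qed

text \<open>The base point changes by the transition map \<open>T\<close> of the surface. For the
  angle, the unit vector is pushed forward by the derivative of \<open>T\<close>, its cosine
  \<open>C\<close> and sine \<open>S\<close> are read off in the target frame, and the angle is
  recovered by \<open>angle_arctan\<close>.\<close>

lemma bundle_transition:
  fixes a b :: real
  assumes c: "(U, \<sigma>) \<in> A" and d: "(W, \<tau>) \<in> A"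
  defines "V \<equiv> U \<times> {a<..<a + 2 * pi}" and "V' \<equiv> W \<times> {b<..<b + 2 * pi}"
  shows "open {z \<in> V. lift (U, \<sigma>) z \<in> lift (W, \<tau>) ` V'}"
    "smooth_on {z \<in> V. lift (U, \<sigma>) z \<in> lift (W, \<tau>) ` V'} (\<lambda>z. inv_into V' (lift (W, \<tau>)) (lift (U, \<sigma>) z))"
    "inj_on (lift (W, \<tau>)) V'"
proof -
  interpret P: plane_metric U "mc U \<sigma>" by (rule plane_metric[OF c])
  interpret P': plane_metric W "mc W \<tau>" by (rule plane_metric[OF d])
  let ?m' = "mc W \<tau>"
  show inj: "inj_on (lift (W, \<tau>)) V'"
  proof (rule inj_onI)
    fix z z' assume z: "z \<in> V'" "z' \<in> V'" "lift (W, \<tau>) z = lift (W, \<tau>) z'"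
    have zW: "fst z \<in> W" "fst z' \<in> W" using z by (auto simp: V'_def)
    have e: "\<tau> (fst z) = \<tau> (fst z')" "tvec_of A \<tau> (fst z) (P'.unit_vec z) = tvec_of A \<tau> (fst z') (P'.unit_vec z')"
      using z(3) lift_eq[OF d zW(1)] lift_eq[OF d zW(2)] by auto
    have f: "fst z = fst z'" using inj_onD[OF chart_inj[OF d] e(1) zW] .
    have "P'.unit_vec z = P'.unit_vec (fst z, snd z')" using tvec_of_inj[OF d zW(1)] e(2) f by simp
    then have "cos (snd z) = cos (snd z')" "sin (snd z) = sin (snd z')"
      using lift_p_eq_iff[OF d zW(1), of "P'.unit_vec z"] P'.unit_vec_unit_normal_metric(1,2)[OF zW(1)] by auto
    moreover have "b < snd z" "snd z < b + 2 * pi" "b < snd z'" "snd z' < b + 2 * pi"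
      using z(1,2) by (auto simp: V'_def)
    ultimately have "snd z = snd z'" using angle_unique[of b "snd z" "snd z'"] by blast
    then show "z = z'" using f by (simp add: prod_eq_iff)
  qed
  define T where "T x = inv_into W \<tau> (\<sigma> x)" for x
  define D0 where "D0 = {x \<in> U. \<sigma> x \<in> \<tau> ` W}"
  note T = smooth_map_chart[OF identity_smooth c d, folded T_def, folded D0_def]
  define D1 where "D1 = D0 \<times> {a<..<a + 2 * pi}"
  have D1: "open D1" unfolding D1_def by (rule open_Times[OF T(1) open_greaterThanLessThan])
  have D1V: "D1 \<subseteq> V" by (auto simp: D1_def D0_def V_def)
  have V: "V \<subseteq> U \<times> UNIV" by (auto simp: V_def)
  have sT: "smooth_on D1 (\<lambda>z. T (fst z))"
    by (rule smooth_on_compose[OF D1 T(1,2)]) (intro smooth_intros D1, auto simp: D1_def)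
  define v where "v z = frechet_derivative T (at (fst z)) (P.unit_vec z)" for z
  have dT: "frechet_derivative (\<lambda>z. T (fst z)) (at z) (w, 0) = frechet_derivative T (at (fst z)) w"
    if "z \<in> D1" for z :: "(real^2) \<times> real" and w
  proof -
    have "(T has_derivative frechet_derivative T (at (fst z))) (at (fst z))"
      by (rule smooth_on_has_derivative[OF T(2)]) (use that in \<open>auto simp: D1_def\<close>)
    from diff_chain_at[OF has_derivative_fst[OF has_derivative_ident] this]
    have "((\<lambda>z. T (fst z)) has_derivative (\<lambda>v. frechet_derivative T (at (fst z)) (fst v))) (at z)"
      by (simp add: comp_def)
    from fun_cong[OF frechet_derivative_at[OF this], of "(w, 0)"] show ?thesis by simp
  qed
  \<comment> \<open>Regarding \<open>T\<close> as a function of point and angle lets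
    \<open>smooth_on_derivative_field\<close> handle a direction that depends on both.\<close>
  have "smooth_on D1 (\<lambda>z. frechet_derivative (\<lambda>z. T (fst z)) (at z) (P.unit_vec z, 0))"
    by (intro smooth_on_derivative_field D1 sT smooth_intros smooth_on_subset[OF P.smooth_lift(1)])
      (use D1V V in auto)
  then have sv: "smooth_on D1 v"
    by (rule smooth_on_cong[OF D1, THEN iffD1, rotated]) (simp add: dT v_def)
  have comp: "smooth_on D1 (\<lambda>z. metric_form ?m' (T (fst z)) (v z) (e (T (fst z))))" if "smooth_on W e" for e
    unfolding metric_form_def
    by (intro smooth_intros D1 sv smooth_on_compose[OF D1 P'.U P'.smooth_m sT] smooth_on_compose[OF D1 P'.U that sT])
      (use T(4) in \<open>auto simp: D1_def\<close>)
  define C where "C z = metric_form ?m' (T (fst z)) (v z) (P'.e1 (T (fst z)))" for z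
  define S where "S z = metric_form ?m' (T (fst z)) (v z) (P'.e2 (T (fst z)))" for z
  have sC: "smooth_on D1 C" and sS: "smooth_on D1 S"
    unfolding C_def[abs_def] S_def[abs_def] by (intro comp P'.smooth_e)+
  have base: "fst z \<in> U" "T (fst z) \<in> W" "\<sigma> (fst z) = \<tau> (T (fst z))" if "z \<in> D1" for z
    using that T(3,4) by (auto simp: D1_def D0_def)
  have CS: "(C z)\<^sup>2 + (S z)\<^sup>2 = 1" if "z \<in> D1" for z
  proof -
    note b = base[OF that]
    have "metric_form ?m' (T (fst z)) (v z) (v z) = 1"
      using metric_transition(1)[OF c b(1) d b(2,3), of "P.unit_vec z" "P.unit_vec z"] P.unit_vec_unit_normal_metric(3)[OF b(1)]
      by (simp add: v_def T_def[abs_def])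
    then show ?thesis using P'.metric_form_frame[OF b(2), of "v z" "v z"]
      by (simp add: C_def S_def power2_eq_square)
  qed
  have eqv: "lift (U, \<sigma>) z = lift (W, \<tau>) (y, \<theta>) \<longleftrightarrow> y = T (fst z) \<and> C z = cos \<theta> \<and> S z = sin \<theta>"
    if z: "z \<in> D1" and y: "y \<in> W" for z y \<theta>
  proof -
    note b = base[OF z]
    have yy: "fst (y, \<theta>) \<in> W" using y by simp
    have "\<sigma> (fst z) = \<tau> y \<longleftrightarrow> y = T (fst z)" using b inj_onD[OF chart_inj[OF d] _ b(2) y] by auto
    then show ?thesis
      unfolding lift_eq_iff[OF c b(1) d yy] using lift_p_eq_iff[OF d b(2), of "v z" \<theta>]
      by (auto simp: v_def C_def S_def T_def[abs_def])
  qed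
  \<comment> \<open>The unit vectors whose image has angle \<open>b\<close> in the target frame are
    exactly those outside the target chart.\<close>
  define E where "E = {z \<in> D1. C z * cos b + S z * sin b \<noteq> 1}"
  have E: "open E"
  proof -
    have "continuous_on D1 (\<lambda>z. C z * cos b + S z * sin b)"
      by (intro continuous_intros smooth_on_continuous_on sC sS)
    from continuous_open_preimage[OF this D1, of "- {1}"]
    show ?thesis unfolding E_def by (auto simp: Int_def vimage_def)
  qed
  \<comment> \<open>\<open>angle_arctan\<close> with the sine and cosine of \<theta> - b expressed
    by \<open>C\<close> and \<open>S\<close>; the denominator is nonzero exactly for the points of
    \<open>E\<close>.\<close>
  define \<Theta> where "\<Theta> z = b + pi + 2 * arctan (- (S z * cos b - C z * sin b) / (1 - (C z * cos b + S z * sin b)))" for z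
  have th: "\<theta> = \<Theta> z" if "b < \<theta>" "\<theta> < b + 2 * pi" "C z = cos \<theta>" "S z = sin \<theta>" for z \<theta>
    using angle_arctan[OF that(1,2)] that(3,4) unfolding \<Theta>_def by (simp add: sin_diff cos_diff mult.commute)
  have DE: "{z \<in> V. lift (U, \<sigma>) z \<in> lift (W, \<tau>) ` V'} = E"
  proof (intro set_eqI iffI)
    fix z assume "z \<in> {z \<in> V. lift (U, \<sigma>) z \<in> lift (W, \<tau>) ` V'}"
    then obtain y \<theta> where z: "z \<in> V" "y \<in> W" "b < \<theta>" "\<theta> < b + 2 * pi" "lift (U, \<sigma>) z = lift (W, \<tau>) (y, \<theta>)"
      by (auto simp: V'_def)
    have zU: "fst z \<in> U" using z(1) by (auto simp: V_def)
    have "\<sigma> (fst z) = \<tau> y" using z(2,5) lift_eq[OF c zU] lift_eq[OF d, of "(y, \<theta>)"] by simp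
    then have z1: "z \<in> D1" using z(1,2) by (auto simp: D1_def D0_def V_def)
    then show "z \<in> E" using eqv[OF z1 z(2), of \<theta>] z(5) angle_not_endpoint[OF z(3,4)] by (simp add: E_def)
  next
    fix z assume z: "z \<in> E"
    then have z1: "z \<in> D1" "C z * cos b + S z * sin b \<noteq> 1" by (auto simp: E_def)
    obtain \<theta> where "b < \<theta>" "\<theta> < b + 2 * pi" "C z = cos \<theta>" "S z = sin \<theta>"
      using angle_in_interval[OF CS[OF z1(1)] z1(2)] .
    then show "z \<in> {z \<in> V. lift (U, \<sigma>) z \<in> lift (W, \<tau>) ` V'}"
      using eqv[OF z1(1) base(2)[OF z1(1)], of \<theta>] D1V z1(1) base(2)[OF z1(1)]
      by (auto simp: V'_def intro!: image_eqI[of _ _ "(T (fst z), \<theta>)"])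
  qed
  show "open {z \<in> V. lift (U, \<sigma>) z \<in> lift (W, \<tau>) ` V'}" unfolding DE by (rule E)
  have ED: "E \<subseteq> D1" by (auto simp: E_def)
  have inv: "inv_into V' (lift (W, \<tau>)) (lift (U, \<sigma>) z) = (T (fst z), \<Theta> z)" if z: "z \<in> E" for z
  proof -
    have z1: "z \<in> D1" "C z * cos b + S z * sin b \<noteq> 1" using z by (auto simp: E_def)
    obtain \<theta> where t: "b < \<theta>" "\<theta> < b + 2 * pi" "C z = cos \<theta>" "S z = sin \<theta>"
      using angle_in_interval[OF CS[OF z1(1)] z1(2)] .
    then have "lift (U, \<sigma>) z = lift (W, \<tau>) (T (fst z), \<theta>)"
      using eqv[OF z1(1) base(2)[OF z1(1)], of \<theta>] by simp
    then show ?thesis using inv_into_f_f[OF inj, of "(T (fst z), \<theta>)"] t th[OF t] base(2)[OF z1(1)]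
      by (auto simp: V'_def)
  qed
  have "smooth_on E (\<lambda>z. (T (fst z), \<Theta> z))"
    unfolding \<Theta>_def
    by (intro smooth_intros E smooth_on_subset[OF sT ED] smooth_on_subset[OF sC ED] smooth_on_subset[OF sS ED])
      (auto simp: E_def)
  then show "smooth_on {z \<in> V. lift (U, \<sigma>) z \<in> lift (W, \<tau>) ` V'} (\<lambda>z. inv_into V' (lift (W, \<tau>)) (lift (U, \<sigma>) z))"
    unfolding DE by (rule smooth_on_cong[OF E, THEN iffD1, rotated]) (simp add: inv)
qed

lemma bundle_smooth_atlas: "smooth_atlas B"
  unfolding smooth_atlas_def smooth_map_def
proof (intro conjI ballI)
  fix c assume "c \<in> B"
  then obtain U \<sigma> a where c: "(U, \<sigma>) \<in> A" "c = (U \<times> {a<..<a + 2 * pi}, lift (U, \<sigma>))"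
    by (metis bundle_chartE prod.collapse)
  show "case c of (U, \<sigma>) \<Rightarrow> open U \<and> inj_on \<sigma> U"
    using bundle_transition(3)[OF c(1) c(1)] chart_open[OF c(1)] by (simp add: c open_Times)
  show "case c of (U, \<sigma>) \<Rightarrow> \<forall>(W, \<tau>)\<in>B. open {x \<in> U. \<sigma> x \<in> \<tau> ` W} \<and>
      smooth_on {x \<in> U. \<sigma> x \<in> \<tau> ` W} (\<lambda>x. inv_into W \<tau> (\<sigma> x))"
  proof -
    have "open {x \<in> U \<times> {a<..<a + 2 * pi}. lift (U, \<sigma>) x \<in> \<tau> ` W} \<and>
      smooth_on {x \<in> U \<times> {a<..<a + 2 * pi}. lift (U, \<sigma>) x \<in> \<tau> ` W} (\<lambda>x. inv_into W \<tau> (lift (U, \<sigma>) x))"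
      if W: "(W, \<tau>) \<in> B" for W \<tau>
    proof -
      obtain U' \<sigma>' b where c': "(U', \<sigma>') \<in> A" "W = U' \<times> {b<..<b + 2 * pi}" "\<tau> = lift (U', \<sigma>')"
        using bundle_chartE[OF W] .
      show ?thesis unfolding c'(2,3) using bundle_transition(1,2)[OF c(1) c'(1)] by blast
    qed
    then show ?thesis unfolding c(2) by auto
  qed
qed simp

lemma bundle_points: "points B = unit_bundle A g"
proof (intro set_eqI iffI)
  fix u assume "u \<in> points B"
  then obtain V \<rho> z where V: "(V, \<rho>) \<in> B" "z \<in> V" "u = \<rho> z" by (rule pointsE)
  obtain U \<sigma> a where c: "(U, \<sigma>) \<in> A" "V = U \<times> {a<..<a + 2 * pi}" "\<rho> = lift (U, \<sigma>)"
    using bundle_chartE[OF V(1)] .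
  have z: "fst z \<in> U" using V c by auto
  interpret P: plane_metric U "mc U \<sigma>" by (rule plane_metric[OF c(1)])
  show "u \<in> unit_bundle A g"
    unfolding V(3) c(3) lift_eq[OF c(1) z] unit_bundle_def
    using P.unit_vec_unit_normal_metric(3)[OF z] metric_tvec_of[OF c(1) z] tangent_space_eq[OF c(1) z] pointsI[OF c(1) z]
    by simp
next
  fix u assume "u \<in> unit_bundle A g"
  then obtain p v where u: "u = (p, v)" "p \<in> points A" "v \<in> tangent_space A p" "g p v v = 1"
    unfolding unit_bundle_def by auto
  obtain U \<sigma> x where c: "(U, \<sigma>) \<in> A" "x \<in> U" "p = \<sigma> x" using pointsE[OF u(2)] .
  interpret P: plane_metric U "mc U \<sigma>" by (rule plane_metric[OF c(1)])
  obtain \<xi> where \<xi>: "v = tvec_of A \<sigma> x \<xi>" using u(3) tangent_space_eq[OF c(1,2)] c(3) by auto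
  have "metric_form (mc U \<sigma>) x \<xi> \<xi> = 1" using u(4) metric_tvec_of[OF c(1,2)] by (simp add: \<xi> c(3))
  then obtain \<theta> where "\<xi> = P.unit_vec (x, \<theta>)" using P.unit_vector_angle[OF c(2)] by blast
  then have "u = lift (U, \<sigma>) (x, \<theta>)" using lift_eq[OF c(1), of "(x, \<theta>)"] c by (simp add: u(1) \<xi>)
  then show "u \<in> points B"
    \<comment> \<open>Starting the interval at \<open>\<theta> - pi\<close> puts the given angle at
      its centre.\<close>
    using pointsI[OF bundle_chartI[OF c(1), of "\<theta> - pi"], of "(x, \<theta>)"] c(2) by simp
qed

end

section \<open>The frame of the unit tangent bundle\<close>

context plane_metric
begin

lemma unit_normal_metric:
  assumes z: "fst z \<in> U"
  shows "metric_form m (fst z) (unit_normal z) (unit_normal z) = 1" "metric_form m (fst z) (unit_vec z) (unit_normal z) = 0"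
    "metric_form m (fst z) (unit_normal z) (unit_vec z) = 0" "unit_normal z \<noteq> 0"
proof -
  show 1: "metric_form m (fst z) (unit_normal z) (unit_normal z) = 1" and 2: "metric_form m (fst z) (unit_vec z) (unit_normal z) = 0"
    using rot_unique[OF z, of "unit_normal z" "unit_vec z"] unit_vec_unit_normal_metric(3,4)[OF z] by auto
  show "metric_form m (fst z) (unit_normal z) (unit_vec z) = 0" using 2 metric_form_sym[OF z] by simp
  show "unit_normal z \<noteq> 0" using 1 by (auto simp: metric_form_def)
qed

lemma unit_vec_unit_normal_expand:
  assumes z: "fst z \<in> U"
  shows "v = metric_form m (fst z) v (unit_vec z) *\<^sub>R unit_vec z + metric_form m (fst z) v (unit_normal z) *\<^sub>R unit_normal z"
proof -
  have sc: "sin (snd z) * sin (snd z) + cos (snd z) * cos (snd z) = 1"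
    using sin_cos_squared_add3[of "snd z"] by (simp add: add.commute)
  define c1 where "c1 = metric_form m (fst z) v (e1 (fst z))"
  define c2 where "c2 = metric_form m (fst z) v (e2 (fst z))"
  have v: "v = c1 *\<^sub>R e1 (fst z) + c2 *\<^sub>R e2 (fst z)" unfolding c1_def c2_def by (rule frame_expand[OF z])
  define a where "a = cos (snd z) * c1 + sin (snd z) * c2"
  define b where "b = cos (snd z) * c2 - sin (snd z) * c1"
  have c12: "c1 = cos (snd z) * a - sin (snd z) * b" "c2 = sin (snd z) * a + cos (snd z) * b"
    unfolding a_def b_def using sc by algebra+
  have "v = a *\<^sub>R unit_vec z + b *\<^sub>R unit_normal z"
    unfolding unit_vec_def unit_normal_def v c12 by (simp add: vec_eq_iff forall_2 algebra_simps)
  then show ?thesis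
    by (simp add: metric_form_linear unit_normal_metric[OF z] unit_vec_unit_normal_metric(3)[OF z])
qed

lemma lift_frame_expand:
  assumes z: "fst z \<in> U"
  obtains a b c where "\<zeta> = a *\<^sub>R lift_X z + b *\<^sub>R lift_H z + c *\<^sub>R (0, 1)"
proof -
  obtain a b where ab: "fst \<zeta> = a *\<^sub>R unit_vec z + b *\<^sub>R unit_normal z" using unit_vec_unit_normal_expand[OF z, of "fst \<zeta>"] by blast
  show thesis
    by (rule that[of a b "snd \<zeta> + a * cform (fst z) (unit_vec z) + b * cform (fst z) (unit_normal z)"])
      (simp add: prod_eq_iff lift_X_def lift_H_def ab)
qed

lemma lift_frame_independent:
  assumes z: "fst z \<in> U" and "a *\<^sub>R lift_X z + b *\<^sub>R lift_H z + c *\<^sub>R (0, 1) = 0"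
  shows "a = 0 \<and> b = 0 \<and> c = 0"
proof -
  have ab: "a *\<^sub>R unit_vec z + b *\<^sub>R unit_normal z = 0" and c: "- a * cform (fst z) (unit_vec z) - b * cform (fst z) (unit_normal z) + c = 0"
    using assms(2) by (auto simp: prod_eq_iff lift_X_def lift_H_def)
  have "a = metric_form m (fst z) (a *\<^sub>R unit_vec z + b *\<^sub>R unit_normal z) (unit_vec z)"
    "b = metric_form m (fst z) (a *\<^sub>R unit_vec z + b *\<^sub>R unit_normal z) (unit_normal z)"
    unfolding metric_form_linear unit_normal_metric[OF z] unit_vec_unit_normal_metric(3)[OF z] by simp_all
  then have "a = 0" "b = 0" unfolding ab by (simp_all add: metric_form_def)
  then show ?thesis using c by simp
qed

end

lemma christoffel_eq: "christoffel A g c k i j = chr (metric_coeff A g c) k i j"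
  by (simp add: fun_eq_iff christoffel_def chr_def inv_metric_coeff_def)

lemma riemann_eq: "riemann A g c l k i j x = riem (metric_coeff A g c) l k i j x"
  by (simp add: riemann_def riem_def christoffel_eq)

section \<open>The fields X, H, V in bundle charts and their brackets\<close>

context riemannian_surface
begin

sublocale SM: smooth_manifold B
  by (unfold_locales, rule bundle_smooth_atlas)

abbreviation lX where "lX U \<sigma> \<equiv> plane_metric.lift_X (mc U \<sigma>)"
abbreviation lH where "lH U \<sigma> \<equiv> plane_metric.lift_H (mc U \<sigma>)"

text \<open>\<open>geodesic_field\<close> is specified by position and velocity components in every
  chart of the surface, so these functions have to be evaluated in a chart \<open>\<tau>\<close> on
  a vector given over \<open>\<sigma>\<close>. A velocity component is the derivative of the
  transition map applied to the unit vector, which brings in a second derivative.\<close>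

lemma bundle_functions:
  assumes c: "(U, \<sigma>) \<in> A" "z \<in> U \<times> {a<..<a + 2 * pi}" and d: "(W, \<tau>) \<in> A" "y \<in> W"
    and eq: "\<sigma> (fst z) = \<tau> y"
  defines "J \<equiv> \<lambda>x. frechet_derivative (\<lambda>x. inv_into W \<tau> (\<sigma> x)) (at x)"
  shows "tvec_of B (lift (U, \<sigma>)) z \<xi> (\<lambda>(q, w). coord (W, \<tau>) k q) = J (fst z) (fst \<xi>) $ k" (is ?A)
    "tvec_of B (lift (U, \<sigma>)) z \<xi> (\<lambda>(q, w). w (coord (W, \<tau>) k)) =
     (frechet_derivative (\<lambda>y. J y (lift_p U \<sigma> z)) (at (fst z)) (fst \<xi>)
       + J (fst z) (frechet_derivative (lift_p U \<sigma>) (at z) \<xi>)) $ k" (is ?B)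
proof -
  interpret P: plane_metric U "mc U \<sigma>" by (rule plane_metric[OF c(1)])
  define T where "T x = inv_into W \<tau> (\<sigma> x)" for x
  define D0 where "D0 = {x \<in> U. \<sigma> x \<in> \<tau> ` W}"
  note T = smooth_map_chart[OF identity_smooth c(1) d(1), folded T_def, folded D0_def]
  have JT: "J x = frechet_derivative T (at x)" for x by (simp add: J_def T_def[abs_def])
  define N where "N = D0 \<times> {a<..<a + 2 * pi}"
  have N: "open N" unfolding N_def by (rule open_Times[OF T(1) open_greaterThanLessThan])
  have zN: "z \<in> N" using c d eq by (auto simp: N_def D0_def)
  have NV: "N \<subseteq> U \<times> {a<..<a + 2 * pi}" by (auto simp: N_def D0_def)
  have NN: "fst z' \<in> U" "fst z' \<in> D0" "T (fst z') \<in> W" "\<sigma> (fst z') = \<tau> (T (fst z'))" if "z' \<in> N" for z'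
    using that T(3,4) by (auto simp: N_def D0_def)
  have chart: "(U \<times> {a<..<a + 2 * pi}, lift (U, \<sigma>)) \<in> B" by (rule bundle_chartI[OF c(1)])
  have sT: "smooth_on N (\<lambda>z. T (fst z) $ k)"
    by (intro smooth_intros N smooth_on_compose[OF N T(1,2)]) (auto simp: N_def)
  have dT: "(T has_derivative J (fst z)) (at (fst z))"
    unfolding JT using smooth_on_has_derivative[OF T(2)] NN(2)[OF zN] .
  have "((\<lambda>z. T (fst z) $ k) has_derivative (\<lambda>v. J (fst z) (fst v) $ k)) (at z)"
    using bounded_linear.has_derivative[OF bounded_linear_vec_nth
        diff_chain_at[OF has_derivative_fst[OF has_derivative_ident] dT]] by (simp add: comp_def)
  note fd1 = fun_cong[OF frechet_derivative_at[OF this], of \<xi>]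
  have co: "(\<lambda>(q, w). coord (W, \<tau>) k q) (lift (U, \<sigma>) z') = T (fst z') $ k" if "z' \<in> N" for z'
    using lift_eq[OF c(1) NN(1)[OF that]] by (simp add: coord_def T_def)
  show ?A unfolding fd1 by (rule SM.tvec_of_eq(2)[OF chart N zN NV sT]) (rule co)
  let ?w = "\<lambda>z. J (fst z) (P.unit_vec z)"
  have unit_vec: "(P.unit_vec has_derivative frechet_derivative P.unit_vec (at z)) (at z)"
    by (rule smooth_on_has_derivative[OF P.smooth_lift(1)]) (use c(2) in auto)
  have "(?w has_derivative (\<lambda>v. frechet_derivative (\<lambda>y. J y (P.unit_vec z)) (at (fst z)) (fst v)
       + J (fst z) (frechet_derivative P.unit_vec (at z) v))) (at z)"
    unfolding JT
    by (rule derivative_along_field[OF T(2) N zN _ has_derivative_fst[OF has_derivative_ident] unit_vec T(1)])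
      (auto simp: N_def)
  from bounded_linear.has_derivative[OF bounded_linear_vec_nth this]
  have "((\<lambda>z. ?w z $ k) has_derivative (\<lambda>v. (frechet_derivative (\<lambda>y. J y (P.unit_vec z)) (at (fst z)) (fst v)
       + J (fst z) (frechet_derivative P.unit_vec (at z) v)) $ k)) (at z)" .
  note fd2 = fun_cong[OF frechet_derivative_at[OF this], of \<xi>]
  have w: "(\<lambda>(q, w). w (coord (W, \<tau>) k)) (lift (U, \<sigma>) z') = ?w z' $ k" if "z' \<in> N" for z'
    using lift_eq[OF c(1) NN(1)[OF that]] tvec_of_transition[OF c(1) NN(1)[OF that] d(1) NN(3,4)[OF that]]
      tvec_of_coord_component[OF d(1) NN(3)[OF that]] by (simp add: J_def)
  have sw: "smooth_on N (\<lambda>z. ?w z $ k)"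
  proof (rule smooth_on_vec_nth[OF N])
    have b: "J (fst z') (P.unit_vec z') = (\<Sum>b\<in>Basis. (P.unit_vec z' \<bullet> b) *\<^sub>R frechet_derivative T (at (fst z')) b)"
      if "z' \<in> N" for z'
      unfolding JT
      by (rule linear_euclidean_expand[OF has_derivative_linear[OF smooth_on_has_derivative[OF T(2) NN(2)[OF that]]]])
    have "smooth_on N (\<lambda>z'. \<Sum>b\<in>Basis. (P.unit_vec z' \<bullet> b) *\<^sub>R frechet_derivative T (at (fst z')) b)"
      by (intro smooth_intros N smooth_on_subset[OF P.smooth_lift(1)]
          smooth_on_compose[OF N T(1) smooth_on_derivative[OF T(2)]]) (use NN in auto)
    then show "smooth_on N ?w"
      by (rule smooth_on_cong[OF N, THEN iffD1, rotated]) (simp add: b)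
  qed
  show ?B unfolding fd2 by (rule SM.tvec_of_eq(2)[OF chart N zN NV sw]) (rule w)
qed

lemma bundle_functions_same:
  assumes c: "(U, \<sigma>) \<in> A" "z \<in> U \<times> {a<..<a + 2 * pi}"
  shows "tvec_of B (lift (U, \<sigma>)) z \<xi> (\<lambda>(q, w). coord (U, \<sigma>) k q) = fst \<xi> $ k"
    "tvec_of B (lift (U, \<sigma>)) z \<xi> (\<lambda>(q, w). w (coord (U, \<sigma>) k)) =
      frechet_derivative (lift_p U \<sigma>) (at z) \<xi> $ k"
proof -
  interpret P: plane_metric U "mc U \<sigma>" by (rule plane_metric[OF c(1)])
  have zU: "fst z \<in> U" using c(2) by auto
  let ?J = "\<lambda>x. frechet_derivative (\<lambda>x. inv_into U \<sigma> (\<sigma> x)) (at x)"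
  have J: "?J x = (\<lambda>v. v)" if "x \<in> U" for x
  proof -
    have "((\<lambda>x. inv_into U \<sigma> (\<sigma> x)) has_derivative (\<lambda>v. v)) (at x)"
      by (rule has_derivative_transform_within_open[OF has_derivative_ident chart_open[OF c(1)] that])
        (simp add: inv_into_f_f[OF chart_inj[OF c(1)]])
    then show ?thesis by (rule frechet_derivative_at[symmetric])
  qed
  have "((\<lambda>y. ?J y w) has_derivative (\<lambda>v. 0)) (at (fst z))" for w
    by (rule has_derivative_transform_within_open[OF has_derivative_const chart_open[OF c(1)] zU]) (simp add: J)
  then have "frechet_derivative (\<lambda>y. ?J y w) (at (fst z)) = (\<lambda>v. 0)" for w
    by (rule frechet_derivative_at[symmetric])
  then show "tvec_of B (lift (U, \<sigma>)) z \<xi> (\<lambda>(q, w). coord (U, \<sigma>) k q) = fst \<xi> $ k"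
    "tvec_of B (lift (U, \<sigma>)) z \<xi> (\<lambda>(q, w). w (coord (U, \<sigma>) k)) = frechet_derivative (lift_p U \<sigma>) (at z) \<xi> $ k"
    using bundle_functions[OF c c(1) zU refl, of \<xi> k] J[OF zU] by simp_all
qed

text \<open>Both existence and uniqueness are needed for \<open>THE\<close>. Existence requires the
  geodesic equation in every chart and rests on \<open>chr_form_transform\<close>; uniqueness is
  checked in the chart \<open>\<sigma>\<close> alone.\<close>

lemma geodesic_field_chart:
  assumes c: "(U, \<sigma>) \<in> A" "z \<in> U \<times> {a<..<a + 2 * pi}"
  shows "geodesic_field A g (lift (U, \<sigma>) z) = tvec_of B (lift (U, \<sigma>)) z (lX U \<sigma> z)"
proof -
  interpret P: plane_metric U "mc U \<sigma>" by (rule plane_metric[OF c(1)])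
  have zU: "fst z \<in> U" using c(2) by auto
  let ?l = "lift (U, \<sigma>)"
  have chart: "(U \<times> {a<..<a + 2 * pi}, ?l) \<in> B" by (rule bundle_chartI[OF c(1)])
  note ts = SM.tangent_space_eq[OF chart c(2)]
  note le = lift_eq[OF c(1) zU]
  let ?P = "\<lambda>\<xi>. \<xi> \<in> tangent_space B (?l z) \<and>
     (\<forall>c\<in>A. \<forall>x\<in>fst c. snd c x = fst (?l z) \<longrightarrow> (\<forall>k.
        \<xi> (\<lambda>(q, w). coord c k q) = snd (?l z) (coord c k) \<and>
        \<xi> (\<lambda>(q, w). w (coord c k)) =
          - (\<Sum>i\<in>UNIV. \<Sum>j\<in>UNIV.
               christoffel A g c k i j x * snd (?l z) (coord c i) * snd (?l z) (coord c j))))"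
  have geo: "geodesic_field A g (?l z) = (THE \<xi>. ?P \<xi>)" unfolding geodesic_field_def ..
  show ?thesis unfolding geo
  proof (rule the_equality)
    show "?P (tvec_of B ?l z (P.lift_X z))"
    proof (intro conjI)
      show "tvec_of B ?l z (P.lift_X z) \<in> tangent_space B (?l z)" using ts by simp
      show "\<forall>c\<in>A. \<forall>x\<in>fst c. snd c x = fst (?l z) \<longrightarrow> (\<forall>k.
        tvec_of B ?l z (P.lift_X z) (\<lambda>(q, w). coord c k q) = snd (?l z) (coord c k) \<and>
        tvec_of B ?l z (P.lift_X z) (\<lambda>(q, w). w (coord c k)) =
          - (\<Sum>i\<in>UNIV. \<Sum>j\<in>UNIV.
               christoffel A g c k i j x * snd (?l z) (coord c i) * snd (?l z) (coord c j)))"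
      proof (intro ballI impI allI)
        fix c' y k assume c': "c' \<in> A" "y \<in> fst c'" "snd c' y = fst (?l z)"
        obtain W \<tau> where W: "c' = (W, \<tau>)" by fastforce
        have d: "(W, \<tau>) \<in> A" "y \<in> W" "\<sigma> (fst z) = \<tau> y" using c' le by (auto simp: W)
        interpret P': plane_metric W "mc W \<tau>" by (rule plane_metric[OF d(1)])
        define T where "T x = inv_into W \<tau> (\<sigma> x)" for x
        define D0 where "D0 = {x \<in> U. \<sigma> x \<in> \<tau> ` W}"
        note T = smooth_map_chart[OF identity_smooth c(1) d(1), folded T_def, folded D0_def]
        have z0: "fst z \<in> D0" "T (fst z) = y" using T(5)[OF zU d(2,3)] by auto
        let ?J = "frechet_derivative T (at (fst z))"
        have comp: "snd (?l z) (coord (W, \<tau>) i) = ?J (P.unit_vec z) $ i" for i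
          unfolding le snd_conv tvec_of_transition[OF c(1) zU d] tvec_of_coord_component[OF d(1,2)]
          by (simp add: T_def[abs_def])
        have onto: "\<exists>u. ?J u = w" for w
          using metric_transition(2)[OF c(1) zU d] by (simp add: T_def[abs_def])
        have D0U: "D0 \<subseteq> U" by (auto simp: D0_def)
        have TW: "T ` D0 \<subseteq> W" using T(4) by auto
        have iso: "metric_form (mc U \<sigma>) x u v = metric_form (mc W \<tau>) (T x)
            (frechet_derivative T (at x) u) (frechet_derivative T (at x) v)" if x: "x \<in> D0" for x u v
        proof -
          have xU: "x \<in> U" using D0U x by auto
          show ?thesis
            using metric_transition(1)[OF c(1) xU d(1) T(4)[OF x] T(3)[OF x, symmetric]]
            by (simp add: T_def[abs_def])
        qed
        \<comment> \<open>The inhomogeneous term of this law cancels the second derivative of the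
          transition map produced by \<open>bundle_functions\<close>.\<close>
        have tr: "?J (chr_form (mc U \<sigma>) (fst z) (P.unit_vec z) (P.unit_vec z)) =
            chr_form (mc W \<tau>) y (?J (P.unit_vec z)) (?J (P.unit_vec z))
            + frechet_derivative (\<lambda>y. frechet_derivative T (at y) (P.unit_vec z)) (at (fst z)) (P.unit_vec z)"
          using chr_form_transform[OF P.plane_metric_axioms P'.plane_metric_axioms T(1) D0U T(2) TW iso z0(1) onto]
          unfolding z0(2) .
        have lin: "linear ?J"
          by (rule has_derivative_linear[OF smooth_on_has_derivative[OF T(2) z0(1)]])
        note bf = bundle_functions[OF c d, of "P.lift_X z" k, folded T_def]
        have fX: "fst (P.lift_X z) = P.unit_vec z" by (simp add: P.lift_X_def)
        have "tvec_of B ?l z (P.lift_X z) (\<lambda>(q, w). coord c' k q) = snd (?l z) (coord c' k)"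
          unfolding W comp bf(1) fX by simp
        moreover have "tvec_of B ?l z (P.lift_X z) (\<lambda>(q, w). w (coord c' k)) =
          - (chr_form (mc W \<tau>) y (?J (P.unit_vec z)) (?J (P.unit_vec z)) $ k)"
          unfolding W bf(2) P.lift_brackets(1)[OF zU] fX linear_neg[OF lin] tr by simp
        moreover have "chr_form (mc W \<tau>) y (?J (P.unit_vec z)) (?J (P.unit_vec z)) $ k = (\<Sum>i\<in>UNIV. \<Sum>j\<in>UNIV.
               christoffel A g c' k i j y * snd (?l z) (coord c' i) * snd (?l z) (coord c' j))"
          unfolding W comp chr_form_def christoffel_eq by simp
        ultimately show "tvec_of B ?l z (P.lift_X z) (\<lambda>(q, w). coord c' k q) = snd (?l z) (coord c' k) \<and>
          tvec_of B ?l z (P.lift_X z) (\<lambda>(q, w). w (coord c' k)) =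
          - (\<Sum>i\<in>UNIV. \<Sum>j\<in>UNIV.
               christoffel A g c' k i j y * snd (?l z) (coord c' i) * snd (?l z) (coord c' j))"
          by simp
      qed
    qed
    then have X: "\<forall>k. tvec_of B ?l z (P.lift_X z) (\<lambda>(q, w). coord (U, \<sigma>) k q) = snd (?l z) (coord (U, \<sigma>) k) \<and>
        tvec_of B ?l z (P.lift_X z) (\<lambda>(q, w). w (coord (U, \<sigma>) k)) =
          - (\<Sum>i\<in>UNIV. \<Sum>j\<in>UNIV.
               christoffel A g (U, \<sigma>) k i j (fst z) * snd (?l z) (coord (U, \<sigma>) i) * snd (?l z) (coord (U, \<sigma>) j))"
      using c(1) zU le by auto
    fix \<xi> assume \<xi>: "?P \<xi>"
    then obtain \<zeta> where \<zeta>: "\<xi> = tvec_of B ?l z \<zeta>" using ts by auto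
    have Y: "\<forall>k. \<xi> (\<lambda>(q, w). coord (U, \<sigma>) k q) = snd (?l z) (coord (U, \<sigma>) k) \<and>
        \<xi> (\<lambda>(q, w). w (coord (U, \<sigma>) k)) =
          - (\<Sum>i\<in>UNIV. \<Sum>j\<in>UNIV.
               christoffel A g (U, \<sigma>) k i j (fst z) * snd (?l z) (coord (U, \<sigma>) i) * snd (?l z) (coord (U, \<sigma>) j))"
      using \<xi> c(1) zU le by auto
    \<comment> \<open>The position functions determine the base component. The velocity functions
      then determine the angular one, because varying the angle moves the unit vector along the
      nonzero \<open>unit_normal\<close>.\<close>
    have f: "fst \<zeta> = fst (P.lift_X z)"
      using X Y unfolding \<zeta> bundle_functions_same(1)[OF c] by (simp add: vec_eq_iff)
    have "frechet_derivative P.unit_vec (at z) \<zeta> = frechet_derivative P.unit_vec (at z) (P.lift_X z)"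
      using X Y unfolding \<zeta> bundle_functions_same(2)[OF c] by (simp add: vec_eq_iff)
    moreover have "linear (frechet_derivative P.unit_vec (at z))"
      by (rule has_derivative_linear[OF smooth_on_has_derivative[OF P.smooth_lift(1)]])
        (simp add: mem_Times_iff zU)
    ultimately have "frechet_derivative P.unit_vec (at z) (\<zeta> - P.lift_X z) = 0" by (simp add: linear_diff)
    moreover have "\<zeta> - P.lift_X z = (0, snd \<zeta> - snd (P.lift_X z))" using f by (simp add: prod_eq_iff)
    ultimately have "(snd \<zeta> - snd (P.lift_X z)) *\<^sub>R P.unit_normal z = 0" using P.lift_brackets(5)[OF zU] by metis
    then have "snd \<zeta> = snd (P.lift_X z)" using P.unit_normal_metric(4)[OF zU] by simp
    then show "\<xi> = tvec_of B ?l z (P.lift_X z)" using f \<zeta> by (metis prod_eq_iff)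
  qed
qed

lemma vertical_field_chart:
  assumes c: "(U, \<sigma>) \<in> A" "z \<in> U \<times> {a<..<a + 2 * pi}"
  shows "vertical_field A g (lift (U, \<sigma>) z) = tvec_of B (lift (U, \<sigma>)) z (0, 1)"
proof -
  have zU: "fst z \<in> U" using c(2) by auto
  have d: "((\<lambda>t. (fst z, snd z + t)) has_vector_derivative (0, 1)) (at 0)"
    by (auto intro!: derivative_eq_intros has_vector_derivative_Pair)
  have "(fst (lift (U, \<sigma>) z), rotate_by A g (fst (lift (U, \<sigma>) z)) t (snd (lift (U, \<sigma>) z)))
      = lift (U, \<sigma>) (fst z, snd z + t)" for t
    using lift_eq[OF c(1) zU] lift_eq[OF c(1), of "(fst z, snd z + t)"] zU
      rotate_by_lift[OF c(1) zU, of t "snd z"] by simp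
  then have "\<forall>\<^sub>F t in nhds 0. (fst (lift (U, \<sigma>) z), rotate_by A g (fst (lift (U, \<sigma>) z)) t (snd (lift (U, \<sigma>) z)))
      = lift (U, \<sigma>) (fst z, snd z + t)" by simp
  from SM.velocity_chart[OF bundle_chartI[OF c(1)] c(2) d _ this]
  show ?thesis by (simp add: vertical_field_def)
qed

lemma vertical_smooth: "smooth_field B (vertical_field A g)"
  unfolding smooth_field_def
proof clarify
  fix V \<rho> assume "(V, \<rho>) \<in> B"
  then obtain U \<sigma> a where c: "(U, \<sigma>) \<in> A" "V = U \<times> {a<..<a + 2 * pi}" "\<rho> = lift (U, \<sigma>)"
    by (rule bundle_chartE)
  have "\<forall>z\<in>V. vertical_field A g (\<rho> z) = tvec_of B \<rho> z (0, 1)"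
    unfolding c(2,3) using vertical_field_chart[OF c(1)] by blast
  then show "\<exists>P. smooth_on V P \<and> (\<forall>z\<in>V. vertical_field A g (\<rho> z) = tvec_of B \<rho> z (P z))"
    by (intro exI[of _ "\<lambda>z. (0, 1)"] conjI smooth_on_const) simp
qed

lemma lift_smooth_chart:
  assumes c: "(U, \<sigma>) \<in> A"
  shows "smooth_on (U \<times> {a<..<a + 2 * pi}) (lX U \<sigma>)" "smooth_on (U \<times> {a<..<a + 2 * pi}) (lH U \<sigma>)"
proof -
  interpret P: plane_metric U "mc U \<sigma>" by (rule plane_metric[OF c])
  show "smooth_on (U \<times> {a<..<a + 2 * pi}) (lX U \<sigma>)" "smooth_on (U \<times> {a<..<a + 2 * pi}) (lH U \<sigma>)"
    by (rule smooth_on_subset[OF P.smooth_lift(3)] smooth_on_subset[OF P.smooth_lift(4)]; auto)+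
qed

lemma geodesic_smooth: "smooth_field B (geodesic_field A g)"
  unfolding smooth_field_def
proof clarify
  fix V \<rho> assume "(V, \<rho>) \<in> B"
  then obtain U \<sigma> a where c: "(U, \<sigma>) \<in> A" "V = U \<times> {a<..<a + 2 * pi}" "\<rho> = lift (U, \<sigma>)"
    by (rule bundle_chartE)
  have "\<forall>z\<in>V. geodesic_field A g (\<rho> z) = tvec_of B \<rho> z (lX U \<sigma> z)"
    unfolding c(2,3) using geodesic_field_chart[OF c(1)] by blast
  then show "\<exists>P. smooth_on V P \<and> (\<forall>z\<in>V. geodesic_field A g (\<rho> z) = tvec_of B \<rho> z (P z))"
    using lift_smooth_chart(1)[OF c(1)] unfolding c(2) by blast
qed

text \<open>\<open>V\<close> has constant coordinates, so only the angle derivative of the lift of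
  \<open>X\<close> survives in the bracket.\<close>

lemma horizontal_field_chart:
  assumes c: "(U, \<sigma>) \<in> A" "z \<in> U \<times> {a<..<a + 2 * pi}"
  shows "horizontal_field A g (lift (U, \<sigma>) z) = tvec_of B (lift (U, \<sigma>)) z (lH U \<sigma> z)"
proof -
  interpret P: plane_metric U "mc U \<sigma>" by (rule plane_metric[OF c(1)])
  have zU: "fst z \<in> U" using c(2) by auto
  have "lie_bracket B (vertical_field A g) (geodesic_field A g) (lift (U, \<sigma>) z) =
    tvec_of B (lift (U, \<sigma>)) z (frechet_derivative P.lift_X (at z) (0, 1) - frechet_derivative (\<lambda>z. (0, 1)) (at z) (P.lift_X z))"
    by (rule SM.lie_bracket_chart[OF bundle_chartI[OF c(1)] c(2) smooth_on_const vertical_field_chart[OF c(1)]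
        lift_smooth_chart(1)[OF c(1)] geodesic_field_chart[OF c(1)]])
  then show ?thesis unfolding horizontal_field_def P.lift_brackets(2)[OF zU] by simp
qed

lemma horizontal_smooth: "smooth_field B (horizontal_field A g)"
  unfolding smooth_field_def
proof clarify
  fix V \<rho> assume "(V, \<rho>) \<in> B"
  then obtain U \<sigma> a where c: "(U, \<sigma>) \<in> A" "V = U \<times> {a<..<a + 2 * pi}" "\<rho> = lift (U, \<sigma>)"
    by (rule bundle_chartE)
  have "\<forall>z\<in>V. horizontal_field A g (\<rho> z) = tvec_of B \<rho> z (lH U \<sigma> z)"
    unfolding c(2,3) using horizontal_field_chart[OF c(1)] by blast
  then show "\<exists>P. smooth_on V P \<and> (\<forall>z\<in>V. horizontal_field A g (\<rho> z) = tvec_of B \<rho> z (P z))"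
    using lift_smooth_chart(2)[OF c(1)] unfolding c(2) by blast
qed

lemma bundle_pointE:
  assumes "u \<in> points B"
  obtains U \<sigma> a z where "(U, \<sigma>) \<in> A" "z \<in> U \<times> {a<..<a + 2 * pi}" "u = lift (U, \<sigma>) z"
  using assms by (elim pointsE bundle_chartE) auto

lemma bracket_vertical_horizontal:
  assumes u: "u \<in> points B"
  shows "lie_bracket B (vertical_field A g) (horizontal_field A g) u = (\<lambda>f. - geodesic_field A g u f)"
proof -
  obtain U \<sigma> a z where c: "(U, \<sigma>) \<in> A" "z \<in> U \<times> {a<..<a + 2 * pi}" "u = lift (U, \<sigma>) z"
    using bundle_pointE[OF u] .
  interpret P: plane_metric U "mc U \<sigma>" by (rule plane_metric[OF c(1)])
  have zU: "fst z \<in> U" using c(2) by auto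
  note chart = bundle_chartI[OF c(1), of a]
  have "lie_bracket B (vertical_field A g) (horizontal_field A g) (lift (U, \<sigma>) z) =
    tvec_of B (lift (U, \<sigma>)) z (frechet_derivative P.lift_H (at z) (0, 1) - frechet_derivative (\<lambda>z. (0, 1)) (at z) (P.lift_H z))"
    by (rule SM.lie_bracket_chart[OF chart c(2) smooth_on_const vertical_field_chart[OF c(1)]
        lift_smooth_chart(2)[OF c(1)] horizontal_field_chart[OF c(1)]])
  also have "\<dots> = tvec_of B (lift (U, \<sigma>)) z ((-1) *\<^sub>R P.lift_X z)"
    unfolding P.lift_brackets(3)[OF zU] by simp
  finally show ?thesis
    unfolding SM.tvec_of_scale[OF chart c(2)] c(3) geodesic_field_chart[OF c(1,2)] by simp
qed

lemma bracket_geodesic_horizontal_chart: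
  assumes c: "(U, \<sigma>) \<in> A" "z \<in> U \<times> {a<..<a + 2 * pi}"
  shows "lie_bracket B (geodesic_field A g) (horizontal_field A g) (lift (U, \<sigma>) z) =
    (\<lambda>f. plane_metric.curv (mc U \<sigma>) (fst z) * vertical_field A g (lift (U, \<sigma>) z) f)"
proof -
  interpret P: plane_metric U "mc U \<sigma>" by (rule plane_metric[OF c(1)])
  have zU: "fst z \<in> U" using c(2) by auto
  note chart = bundle_chartI[OF c(1), of a]
  have "lie_bracket B (geodesic_field A g) (horizontal_field A g) (lift (U, \<sigma>) z) =
    tvec_of B (lift (U, \<sigma>)) z (frechet_derivative P.lift_H (at z) (P.lift_X z) - frechet_derivative P.lift_X (at z) (P.lift_H z))"
    by (rule SM.lie_bracket_chart[OF chart c(2) lift_smooth_chart(1)[OF c(1)] geodesic_field_chart[OF c(1)]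
        lift_smooth_chart(2)[OF c(1)] horizontal_field_chart[OF c(1)]])
  also have "\<dots> = tvec_of B (lift (U, \<sigma>)) z (P.curv (fst z) *\<^sub>R (0, 1))"
    unfolding P.lift_brackets(4)[OF zU] by simp
  finally show ?thesis
    unfolding SM.tvec_of_scale[OF chart c(2)] vertical_field_chart[OF c] .
qed

lemma vertical_nonzero:
  assumes c: "(U, \<sigma>) \<in> A" "z \<in> U \<times> {a<..<a + 2 * pi}"
    and eq: "(\<lambda>f. k * vertical_field A g (lift (U, \<sigma>) z) f) = (\<lambda>f. l * vertical_field A g (lift (U, \<sigma>) z) f)"
  shows "k = l"
proof -
  note chart = bundle_chartI[OF c(1), of a]
  have "tvec_of B (lift (U, \<sigma>)) z (k *\<^sub>R (0, 1)) = tvec_of B (lift (U, \<sigma>)) z (l *\<^sub>R (0, 1))"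
    using eq unfolding vertical_field_chart[OF c] SM.tvec_of_scale[OF chart c(2)] .
  from SM.tvec_of_inj[OF chart c(2) this] show ?thesis by simp
qed

text \<open>The coordinate expression of the curvature is independent of the chart because it is the
  coefficient in \<open>[X, H] = K V\<close>.\<close>

lemma gauss_curvature_chart:
  assumes c: "(U, \<sigma>) \<in> A" "x \<in> U"
  shows "gauss_curvature A g (\<sigma> x) = plane_metric.curv (mc U \<sigma>) x"
proof -
  interpret P: plane_metric U "mc U \<sigma>" by (rule plane_metric[OF c(1)])
  have formula: "(\<Sum>l\<in>UNIV. metric_coeff A g c l 1 y * riemann A g c l 2 1 2 y)
         / det (\<chi> i j. metric_coeff A g c i j y) = plane_metric.curv (metric_coeff A g c) y"
    if "c \<in> A" "y \<in> fst c" for c y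
  proof -
    obtain W \<tau> where W: "c = (W, \<tau>)" by fastforce
    have "(W, \<tau>) \<in> A" "y \<in> W" using that W by auto
    interpret P': plane_metric W "mc W \<tau>" by (rule plane_metric) fact
    show ?thesis
      unfolding P'.curv_def W riemann_eq det_2 using P'.sym[OF \<open>y \<in> W\<close>, of 2 1] by simp
  qed
  have same: "plane_metric.curv (mc W \<tau>) y = P.curv x"
    if d: "(W, \<tau>) \<in> A" "y \<in> W" "\<tau> y = \<sigma> x" for W \<tau> y
  proof -
    interpret P': plane_metric W "mc W \<tau>" by (rule plane_metric[OF d(1)])
    \<comment> \<open>Any bundle point over \<open>\<sigma> x\<close> allows the comparison of
      coefficients. The one with angle 0 is taken, and \<open>\<theta>\<close> below is its angle in
      the other chart.\<close>
    have z: "(x, 0) \<in> U \<times> {-pi<..<-pi + 2 * pi}" using c(2) by simp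
    let ?J = "frechet_derivative (\<lambda>x. inv_into W \<tau> (\<sigma> x)) (at x)"
    have "metric_form (mc W \<tau>) y (?J (P.unit_vec (x, 0))) (?J (P.unit_vec (x, 0))) = 1"
      using metric_transition(1)[OF c d(1,2) d(3)[symmetric], of "P.unit_vec (x, 0)" "P.unit_vec (x, 0)"]
        P.unit_vec_unit_normal_metric(3)[of "(x, 0)"] c(2) by simp
    then obtain \<theta> where "?J (P.unit_vec (x, 0)) = P'.unit_vec (y, \<theta>)" using P'.unit_vector_angle[OF d(2)] by blast
    then have eq: "lift (U, \<sigma>) (x, 0) = lift (W, \<tau>) (y, \<theta>)"
      using lift_eq_iff[OF c(1) _ d(1), of "(x, 0)" "(y, \<theta>)"] c(2) d(2,3) by simp
    have z': "(y, \<theta>) \<in> W \<times> {\<theta> - pi<..<\<theta> - pi + 2 * pi}" using d(2) by simp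
    have "(\<lambda>f. P.curv x * vertical_field A g (lift (U, \<sigma>) (x, 0)) f) =
       (\<lambda>f. P'.curv y * vertical_field A g (lift (U, \<sigma>) (x, 0)) f)"
      using bracket_geodesic_horizontal_chart[OF c(1) z] bracket_geodesic_horizontal_chart[OF d(1) z']
      unfolding eq by simp
    from vertical_nonzero[OF c(1) z this] show ?thesis by simp
  qed
  show ?thesis
    unfolding gauss_curvature_def
  proof (rule the_equality)
    show "\<forall>c\<in>A. \<forall>y\<in>fst c. snd c y = \<sigma> x \<longrightarrow> P.curv x =
      (\<Sum>l\<in>UNIV. metric_coeff A g c l 1 y * riemann A g c l 2 1 2 y) / det (\<chi> i j. metric_coeff A g c i j y)"
      using formula same by auto
    fix K assume "\<forall>c\<in>A. \<forall>y\<in>fst c. snd c y = \<sigma> x \<longrightarrow> K =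
      (\<Sum>l\<in>UNIV. metric_coeff A g c l 1 y * riemann A g c l 2 1 2 y) / det (\<chi> i j. metric_coeff A g c i j y)"
    then show "K = P.curv x" using formula[of "(U, \<sigma>)" x] c by auto
  qed
qed

lemma bracket_geodesic_horizontal:
  assumes u: "u \<in> points B"
  shows "lie_bracket B (geodesic_field A g) (horizontal_field A g) u =
    (\<lambda>f. gauss_curvature A g (fst u) * vertical_field A g u f)"
proof -
  obtain U \<sigma> a z where c: "(U, \<sigma>) \<in> A" "z \<in> U \<times> {a<..<a + 2 * pi}" "u = lift (U, \<sigma>) z"
    using bundle_pointE[OF u] .
  have zU: "fst z \<in> U" using c(2) by auto
  show ?thesis
    using bracket_geodesic_horizontal_chart[OF c(1,2)] gauss_curvature_chart[OF c(1) zU] lift_eq[OF c(1) zU]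
    by (simp add: c(3))
qed

lemma frame_spans:
  assumes u: "u \<in> points B" and v: "v \<in> tangent_space B u"
  obtains a b c where "v = (\<lambda>f. a * geodesic_field A g u f + b * horizontal_field A g u f + c * vertical_field A g u f)"
proof -
  obtain U \<sigma> a0 z where c: "(U, \<sigma>) \<in> A" "z \<in> U \<times> {a0<..<a0 + 2 * pi}" "u = lift (U, \<sigma>) z"
    using bundle_pointE[OF u] .
  interpret P: plane_metric U "mc U \<sigma>" by (rule plane_metric[OF c(1)])
  have zU: "fst z \<in> U" using c(2) by auto
  note chart = bundle_chartI[OF c(1), of a0]
  note fields = geodesic_field_chart[OF c(1,2)] horizontal_field_chart[OF c(1,2)] vertical_field_chart[OF c(1,2)]
  obtain \<zeta> where \<zeta>: "v = tvec_of B (lift (U, \<sigma>)) z \<zeta>" using v SM.tangent_space_eq[OF chart c(2)] c(3) by auto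
  obtain a b k where "\<zeta> = a *\<^sub>R P.lift_X z + b *\<^sub>R P.lift_H z + k *\<^sub>R (0, 1)"
    using P.lift_frame_expand[OF zU] .
  then have "v = (\<lambda>f. a * geodesic_field A g u f + b * horizontal_field A g u f + k * vertical_field A g u f)"
    unfolding \<zeta> c(3) fields
    using SM.tvec_of_linear[OF chart c(2), of 1 "a *\<^sub>R P.lift_X z + b *\<^sub>R P.lift_H z" k "(0, 1)"]
      SM.tvec_of_linear[OF chart c(2), of a "P.lift_X z" b "P.lift_H z"] by simp
  then show thesis by (rule that)
qed

lemma frame_independent:
  assumes u: "u \<in> points B"
    and 0: "(\<lambda>f. a * geodesic_field A g u f + b * horizontal_field A g u f + k * vertical_field A g u f) = (\<lambda>f. 0)"
  shows "a = 0 \<and> b = 0 \<and> k = 0"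
proof -
  obtain U \<sigma> a0 z where c: "(U, \<sigma>) \<in> A" "z \<in> U \<times> {a0<..<a0 + 2 * pi}" "u = lift (U, \<sigma>) z"
    using bundle_pointE[OF u] .
  interpret P: plane_metric U "mc U \<sigma>" by (rule plane_metric[OF c(1)])
  have zU: "fst z \<in> U" using c(2) by auto
  note chart = bundle_chartI[OF c(1), of a0]
  note fields = geodesic_field_chart[OF c(1,2)] horizontal_field_chart[OF c(1,2)] vertical_field_chart[OF c(1,2)]
  have "tvec_of B (lift (U, \<sigma>)) z (a *\<^sub>R P.lift_X z + b *\<^sub>R P.lift_H z + k *\<^sub>R (0, 1)) = tvec_of B (lift (U, \<sigma>)) z 0"
    using 0 SM.tvec_of_zero[OF chart c(2)] unfolding c(3) fields
    using SM.tvec_of_linear[OF chart c(2), of 1 "a *\<^sub>R P.lift_X z + b *\<^sub>R P.lift_H z" k "(0, 1)"]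
      SM.tvec_of_linear[OF chart c(2), of a "P.lift_X z" b "P.lift_H z"] by simp
  from P.lift_frame_independent[OF zU SM.tvec_of_inj[OF chart c(2) this]] show ?thesis .
qed

end

section \<open>The Green bundles\<close>

lemma line_of_scale:
  assumes "k \<noteq> 0" shows "line_of (\<lambda>w. k * \<xi> w) = line_of \<xi>"
proof -
  have 1: "(\<lambda>w. c * \<xi> w) = (\<lambda>w. (c / k) * (k * \<xi> w))" for c using assms by auto
  have 2: "(\<lambda>w. c * (k * \<xi> w)) = (\<lambda>w. (c * k) * \<xi> w)" for c by (simp only: mult.assoc)
  show ?thesis unfolding line_of_def
  proof (intro equalityI subsetI; elim rangeE)
    fix \<eta> c assume "\<eta> = (\<lambda>w. c * (k * \<xi> w))"
    then show "\<eta> \<in> range (\<lambda>c w. c * \<xi> w)" unfolding 2 by blast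
  next
    fix \<eta> c assume "\<eta> = (\<lambda>w. c * \<xi> w)"
    then have "\<eta> = (\<lambda>w. (c / k) * (k * \<xi> w))" using 1[of c] by simp
    then show "\<eta> \<in> range (\<lambda>c w. c * (k * \<xi> w))" by (rule range_eqI)
  qed
qed

text \<open>Vectors spanning the same line are proportional, so the products \<eta>(w) \<xi>(w0) and
  \<xi>(w) \<eta>(w0) agree eventually and hence in the limit. As both limits are nonzero, they span
  one line. This evaluates the \<open>THE\<close> in the Green bundles.\<close>

lemma lines_tendsto_unique:
  assumes "lines_tendsto L l F" "lines_tendsto L l' F" "F \<noteq> bot"
  shows "l = l'"
proof -
  obtain \<xi> \<xi>0 where x: "\<forall>\<^sub>F t in F. L t = line_of (\<xi> t)" "\<And>w. ((\<lambda>t. \<xi> t w) \<longlongrightarrow> \<xi>0 w) F"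
    "\<xi>0 \<noteq> (\<lambda>w. 0)" "l = line_of \<xi>0" using assms(1) unfolding lines_tendsto_def by blast
  obtain \<eta> \<eta>0 where y: "\<forall>\<^sub>F t in F. L t = line_of (\<eta> t)" "\<And>w. ((\<lambda>t. \<eta> t w) \<longlongrightarrow> \<eta>0 w) F"
    "\<eta>0 \<noteq> (\<lambda>w. 0)" "l' = line_of \<eta>0" using assms(2) unfolding lines_tendsto_def by blast
  obtain w0 where w0: "\<xi>0 w0 \<noteq> 0" using x(3) by auto
  have "\<eta>0 w * \<xi>0 w0 = \<xi>0 w * \<eta>0 w0" for w
  proof (rule tendsto_unique[OF assms(3)])
    show "((\<lambda>t. \<eta> t w * \<xi> t w0) \<longlongrightarrow> \<eta>0 w * \<xi>0 w0) F" by (intro tendsto_mult x y)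
    have "((\<lambda>t. \<xi> t w * \<eta> t w0) \<longlongrightarrow> \<xi>0 w * \<eta>0 w0) F" by (intro tendsto_mult x y)
    moreover have "\<forall>\<^sub>F t in F. \<xi> t w * \<eta> t w0 = \<eta> t w * \<xi> t w0"
      using x(1) y(1)
    proof eventually_elim
      case (elim t)
      have "\<eta> t \<in> line_of (\<eta> t)" unfolding line_of_def by (rule range_eqI[of _ _ 1]) simp
      then obtain c where "\<eta> t = (\<lambda>w. c * \<xi> t w)" using elim unfolding line_of_def by auto
      then show ?case by simp
    qed
    ultimately show "((\<lambda>t. \<eta> t w * \<xi> t w0) \<longlongrightarrow> \<xi>0 w * \<eta>0 w0) F"
      by (rule Lim_transform_eventually)
  qed
  then have e: "\<eta>0 = (\<lambda>w. (\<eta>0 w0 / \<xi>0 w0) * \<xi>0 w)" using w0 by (auto simp: field_simps)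
  have "\<eta>0 w0 / \<xi>0 w0 \<noteq> 0"
  proof
    assume "\<eta>0 w0 / \<xi>0 w0 = 0"
    with e have "\<eta>0 = (\<lambda>w. 0)" by simp
    with y(3) show False by contradiction
  qed
  then have "line_of \<eta>0 = line_of \<xi>0" by (subst e) (rule line_of_scale)
  then show ?thesis using x(4) y(4) by simp
qed

section \<open>The scalar Jacobi equation\<close>

lemma jacobi_wronskian:
  fixes A A1 S S1 q :: "real \<Rightarrow> real"
  assumes A: "\<And>t. (A has_real_derivative A1 t) (at t)" "\<And>t. (A1 has_real_derivative q t * A t) (at t)"
    and S: "\<And>t. (S has_real_derivative S1 t) (at t)" "\<And>t. (S1 has_real_derivative q t * S t) (at t)"
    and init: "A 0 = 1" "A1 0 = 0" "S 0 = 0" "S1 0 = 1"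
  shows "A t * S1 t - A1 t * S t = 1"
proof -
  have "((\<lambda>t. A t * S1 t - A1 t * S t) has_real_derivative 0) (at t)" for t
    by (rule derivative_eq_intros A S | simp add: algebra_simps)+
  then have "A t * S1 t - A1 t * S t = A 0 * S1 0 - A1 0 * S 0"
    using DERIV_isconst_all[of "\<lambda>t. A t * S1 t - A1 t * S t"] by blast
  then show ?thesis by (simp add: init)
qed

text \<open>The quotient \<open>A / S\<close> is decreasing, and it is bounded below by the increasing function
  \<open>A' / S'\<close>, which becomes positive immediately if \<open>q 0 > 0\<close>.\<close>

lemma jacobi_ratio_limit:
  fixes A A1 S S1 q :: "real \<Rightarrow> real"
  assumes A: "\<And>t. (A has_real_derivative A1 t) (at t)" "\<And>t. (A1 has_real_derivative q t * A t) (at t)"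
    and S: "\<And>t. (S has_real_derivative S1 t) (at t)" "\<And>t. (S1 has_real_derivative q t * S t) (at t)"
    and init: "A 0 = 1" "A1 0 = 0" "S 0 = 0" "S1 0 = 1" and q: "\<And>t. q t \<ge> 0"
  obtains r where "((\<lambda>t. A t / S t) \<longlongrightarrow> r) at_top" "r \<ge> 0" "q 0 > 0 \<longrightarrow> r > 0"
    "\<And>t. t > 0 \<Longrightarrow> S t > 0" "(\<forall>t. q t = 0) \<longrightarrow> r = 0"
proof -
  note W = jacobi_wronskian[OF A S init]
  \<comment> \<open>Working with the square avoids assuming the sign of \<open>A\<close>:
    \<open>A * A1\<close> is nondecreasing from 0 whatever that sign is. Positivity then follows by
    continuity, since \<open>A\<close> cannot reach 0.\<close>
  have A2: "A t * A t \<ge> 1" if t: "t \<ge> 0" for t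
  proof -
    have AA1: "A s * A1 s \<ge> 0" if s: "s \<ge> 0" for s
    proof -
      have "A 0 * A1 0 \<le> A s * A1 s"
      proof (rule DERIV_nonneg_imp_nondecreasing[OF s])
        fix x :: real
        have "((\<lambda>s. A s * A1 s) has_real_derivative A1 x * A1 x + q x * (A x * A x)) (at x)"
          by (rule derivative_eq_intros A | simp add: algebra_simps)+
        moreover have "A1 x * A1 x + q x * (A x * A x) \<ge> 0" using q by simp
        ultimately show "\<exists>y. ((\<lambda>s. A s * A1 s) has_real_derivative y) (at x) \<and> 0 \<le> y" by blast
      qed
      then show ?thesis by (simp add: init)
    qed
    have "A 0 * A 0 \<le> A t * A t"
    proof (rule DERIV_nonneg_imp_nondecreasing[OF t])
      fix x :: real assume "0 \<le> x"
      then have "2 * (A x * A1 x) \<ge> 0" using AA1 by simp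
      moreover have "((\<lambda>s. A s * A s) has_real_derivative 2 * (A x * A1 x)) (at x)"
        by (rule derivative_eq_intros A | simp add: algebra_simps)+
      ultimately show "\<exists>y. ((\<lambda>s. A s * A s) has_real_derivative y) (at x) \<and> 0 \<le> y" by blast
    qed
    then show ?thesis by (simp add: init)
  qed
  have Apos: "A t > 0" if t: "t \<ge> 0" for t
  proof (rule ccontr)
    assume "\<not> A t > 0"
    moreover have "\<forall>x. 0 \<le> x \<and> x \<le> t \<longrightarrow> isCont A x" using A(1) DERIV_isCont by blast
    ultimately obtain x where "0 \<le> x" "A x = 0"
      using IVT2[of A t 0 0] t init(1) by auto
    then show False using A2[of x] by simp
  qed
  \<comment> \<open>By the Wronskian identity, \<open>S / A\<close> has derivative
    \<open>1 / (A * A)\<close>.\<close>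
  have Spos: "S t > 0" if t: "t > 0" for t
  proof -
    have "S 0 / A 0 < S t / A t"
    proof (rule DERIV_pos_imp_increasing[OF t])
      fix x :: real assume "0 \<le> x"
      then have a: "A x > 0" by (rule Apos)
      have "((\<lambda>s. S s / A s) has_real_derivative (S1 x * A x - S x * A1 x) / (A x * A x)) (at x)"
        using a by (intro DERIV_divide A S) auto
      moreover have "(S1 x * A x - S x * A1 x) / (A x * A x) > 0"
        using W[of x] a by (simp add: mult.commute)
      ultimately show "\<exists>y. ((\<lambda>s. S s / A s) has_real_derivative y) (at x) \<and> y > 0" by blast
    qed
    then show ?thesis using Apos[of t] t by (simp add: init zero_less_divide_iff)
  qed
  have S1pos: "S1 t \<ge> 1" if t: "t \<ge> 0" for t
  proof -
    have "S1 0 \<le> S1 t"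
    proof (rule DERIV_nonneg_imp_nondecreasing[OF t])
      fix x :: real assume "0 \<le> x"
      then have "q x * S x \<ge> 0" using Spos[of x] q init by (cases "x = 0") auto
      then show "\<exists>y. (S1 has_real_derivative y) (at x) \<and> 0 \<le> y" using S(2) by blast
    qed
    then show ?thesis by (simp add: init)
  qed
  define f where "f t = A t / S t" for t
  have dec: "f t \<le> f s" if "0 < s" "s \<le> t" for s t
    unfolding f_def
  proof (rule DERIV_nonpos_imp_nonincreasing[OF that(2)])
    fix x :: real assume "s \<le> x"
    then have s: "S x > 0" using Spos that(1) by simp
    have "((\<lambda>s. A s / S s) has_real_derivative (A1 x * S x - A x * S1 x) / (S x * S x)) (at x)"
      using s by (intro DERIV_divide A S) auto
    moreover have "(A1 x * S x - A x * S1 x) / (S x * S x) \<le> 0"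
      using W[of x] s by (simp add: divide_le_0_iff)
    ultimately show "\<exists>y. ((\<lambda>s. A s / S s) has_real_derivative y) (at x) \<and> y \<le> 0" by blast
  qed
  have fpos: "f t > 0" if "t > 0" for t
    unfolding f_def using Apos[of t] Spos[OF that] that by simp
  \<comment> \<open>A decreasing function bounded below tends to its infimum; in this form, lower
    bounds for \<open>f\<close> at positive times pass to \<open>r\<close> at once.\<close>
  define r where "r = Inf (f ` {0<..})"
  have bdd: "bdd_below (f ` {0<..})" using fpos by (intro bdd_belowI[of _ 0]) (auto intro: less_imp_le)
  have lim: "(f \<longlongrightarrow> r) at_top"
  proof (rule decreasing_tendsto)
    show "\<forall>\<^sub>F t in at_top. r \<le> f t"
      using eventually_gt_at_top[of 0] by eventually_elim (auto simp: r_def intro!: cInf_lower bdd)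
    fix x assume "r < x"
    then obtain t0 where t0: "t0 > 0" "f t0 < x"
      using cInf_lessD[of "f ` {0<..}" x] unfolding r_def by auto
    show "\<forall>\<^sub>F t in at_top. f t < x"
      using eventually_ge_at_top[of t0] by eventually_elim (use dec[OF t0(1)] t0(2) in force)
  qed
  have r0: "r \<ge> 0" unfolding r_def by (rule cInf_greatest) (auto intro: less_imp_le fpos)
  have rpos: "r > 0" if q0: "q 0 > 0"
  proof -
    have "(A1 has_real_derivative q 0) (at 0)" using A(2)[of 0] init by simp
    then obtain d where d: "d > 0" "\<And>h. 0 < h \<Longrightarrow> h < d \<Longrightarrow> A1 0 < A1 (0 + h)"
      using DERIV_pos_inc_right[OF _ q0] by blast
    \<comment> \<open>A time right after 0 at which \<open>A1\<close>, whose derivative at 0 is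
      \<open>q 0 > 0\<close>, has become positive.\<close>
    define T where "T = d / 2"
    have T: "T > 0" "A1 T > 0" using d(1) d(2)[of T] init by (auto simp: T_def)
    define \<delta> where "\<delta> = A1 T / S1 T"
    have \<delta>: "\<delta> > 0" unfolding \<delta>_def using T S1pos[of T] by simp
    have ge: "\<delta> \<le> f t" if t: "t \<ge> T" for t
    proof -
      have tp: "t > 0" using t T by simp
      have "A1 T / S1 T \<le> A1 t / S1 t"
      proof (rule DERIV_nonneg_imp_nondecreasing[OF t])
        fix x :: real assume "T \<le> x"
        then have s: "S1 x > 0" using S1pos[of x] T by simp
        have "((\<lambda>s. A1 s / S1 s) has_real_derivative (q x * A x * S1 x - A1 x * (q x * S x)) / (S1 x * S1 x)) (at x)"
          using s by (intro DERIV_divide A S) auto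
        moreover have "q x * A x * S1 x - A1 x * (q x * S x) = q x"
          using W[of x] by algebra
        ultimately show "\<exists>y. ((\<lambda>s. A1 s / S1 s) has_real_derivative y) (at x) \<and> 0 \<le> y"
          using q[of x] s by (auto intro!: exI[of _ "q x / (S1 x * S1 x)"])
      qed
      \<comment> \<open>By the Wronskian identity the difference of the two quotients is
        \<open>1 / (S t * S1 t)\<close>.\<close>
      also have "\<dots> \<le> A t / S t"
        using W[of t] S1pos[of t] Spos[OF tp] tp by (simp add: frac_le_eq divide_le_0_iff algebra_simps)
      finally show ?thesis unfolding \<delta>_def f_def .
    qed
    have "\<delta> \<le> r" unfolding r_def
    proof (rule cInf_greatest)
      fix y assume "y \<in> f ` {0<..}"
      then obtain t where t: "t > 0" "y = f t" by auto
      show "\<delta> \<le> y"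
        using ge[of t] ge[of T] dec[OF t(1), of T] t(2) by (cases "t \<ge> T") auto
    qed simp
    then show ?thesis using \<delta> by simp
  qed
  \<comment> \<open>For the free equation \<open>A\<close> is constantly 1 and
    \<open>S t = t\<close>, so the quotient is \<open>1 / t\<close>.\<close>
  have rz: "r = 0" if q0: "\<And>t. q t = 0"
  proof -
    have A1z: "A1 t = 0" for t
      using DERIV_isconst_all[of A1 t 0] A(2) q0 init by simp
    then have At: "A t = 1" for t
      using DERIV_isconst_all[of A t 0] A(1) init by simp
    have "S1 t = 1" for t
      using DERIV_isconst_all[of S1 t 0] S(2) q0 init by simp
    then have "((\<lambda>t. S t - t) has_real_derivative 0) (at t)" for t
      using DERIV_diff[OF S(1)[of t] DERIV_ident] by simp
    then have "S t - t = S 0 - 0" for t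
      using DERIV_isconst_all[of "\<lambda>t. S t - t"] by blast
    then have "f = (\<lambda>t. 1 / t)" by (auto simp: f_def At init)
    moreover have "((\<lambda>t::real. 1 / t) \<longlongrightarrow> 0) at_top"
      using tendsto_inverse_0_at_top[OF filterlim_ident] by (simp add: inverse_eq_divide)
    ultimately show "r = 0" using lim tendsto_unique[OF trivial_limit_at_top_linorder] by metis
  qed
  show thesis
    by (rule that[OF lim[unfolded f_def] r0 _ Spos]) (use rpos rz in auto)
qed

section \<open>Covectors along a curve of tangent vectors\<close>

context smooth_manifold
begin

lemma cotangent_chart_sum:
  assumes c: "(U, \<sigma>) \<in> A" "x \<in> U" and \<xi>: "\<xi> \<in> cotangent_space A (\<sigma> x)" and v: "v \<in> tangent_space A (\<sigma> x)"
  shows "\<xi> v = (\<Sum>b\<in>Basis. v (\<lambda>q. inv_into U \<sigma> q \<bullet> b) * \<xi> (tvec_of A \<sigma> x b))"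
proof -
  obtain \<zeta> where \<zeta>: "v = tvec_of A \<sigma> x \<zeta>" using v tangent_space_eq[OF c] by auto
  have l: "\<xi> (tvec_of A \<sigma> x (a *\<^sub>R u + b *\<^sub>R w)) = a * \<xi> (tvec_of A \<sigma> x u) + b * \<xi> (tvec_of A \<sigma> x w)" for a b u w
    using \<xi> tangent_space_eq[OF c] unfolding cotangent_space_def tvec_of_linear[OF c] by auto
  have "linear (\<lambda>\<zeta>. \<xi> (tvec_of A \<sigma> x \<zeta>))"
    using l[of 1 _ 1] l[of _ _ 0] by (intro linearI) auto
  from linear_euclidean_expand[OF this, of \<zeta>]
  show ?thesis unfolding \<zeta> tvec_of_coord(2)[OF c bounded_linear_inner_left] by simp
qed

text \<open>Derivatives along the flow are known for each test function separately. A covector is a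
  finite combination of evaluations at coordinate functions (\<open>cotangent_chart_sum\<close>), so
  differentiability for each \<open>f\<close> carries over.\<close>

lemma cotangent_derivative:
  assumes p: "p \<in> points A" and \<xi>: "\<xi> \<in> cotangent_space A p"
    and T: "\<And>t. E t \<in> tangent_space A p" "E' \<in> tangent_space A p"
    and E: "\<And>f. ((\<lambda>t. E t f) has_real_derivative E' f) (at t)"
  shows "((\<lambda>t. \<xi> (E t)) has_real_derivative \<xi> E') (at t)"
proof -
  obtain U \<sigma> x where c: "(U, \<sigma>) \<in> A" "x \<in> U" "p = \<sigma> x" using pointsE[OF p] .
  note s = cotangent_chart_sum[OF c(1,2), of \<xi>, folded c(3), OF \<xi>]
  have "((\<lambda>t. \<Sum>b\<in>Basis. E t (\<lambda>q. inv_into U \<sigma> q \<bullet> b) * \<xi> (tvec_of A \<sigma> x b)) has_real_derivative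
    (\<Sum>b\<in>Basis. E' (\<lambda>q. inv_into U \<sigma> q \<bullet> b) * \<xi> (tvec_of A \<sigma> x b))) (at t)"
    by (intro DERIV_sum DERIV_cmult_right E)
  then show ?thesis unfolding s[OF T(1)] s[OF T(2)] .
qed

lemma cotangent_combination:
  "\<xi> \<in> cotangent_space A p \<Longrightarrow> v \<in> tangent_space A p \<Longrightarrow> w \<in> tangent_space A p \<Longrightarrow>
    \<xi> (\<lambda>f. a * v f + b * w f) = a * \<xi> v + b * \<xi> w"
  unfolding cotangent_space_def by blast

end

section \<open>Dynamics of the magnetic flow\<close>

locale magnetic_flow = riemannian_surface A g for A :: "'m surface" and g :: "'m metric" +
  fixes lam :: "'m \<times> 'm tvec \<Rightarrow> real" and \<phi> :: "real \<Rightarrow> 'm \<times> 'm tvec \<Rightarrow> 'm \<times> 'm tvec"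
  assumes lam: "smooth_fun (unit_bundle_atlas A g) lam"
    and magnetic: "u \<in> unit_bundle A g \<Longrightarrow> vertical_field A g u lam = 0"
    and flow: "is_flow (unit_bundle_atlas A g) (thermostat_field A g lam) \<phi>"
begin

abbreviation X where "X \<equiv> geodesic_field A g"
abbreviation H where "H \<equiv> horizontal_field A g"
abbreviation V where "V \<equiv> vertical_field A g"
abbreviation F where "F \<equiv> thermostat_field A g lam"

lemma F_eq: "F u = (\<lambda>f. 1 * X u f + lam u * V u f)"
  by (simp add: thermostat_field_def)

lemma F_smooth: "smooth_field B F"
proof -
  have "smooth_fun B (\<lambda>_. 1)" by (auto simp: smooth_fun_def comp_def smooth_on_const)
  from SM.smooth_field_combination[OF this lam geodesic_smooth vertical_smooth]
  show ?thesis by (simp add: thermostat_field_def[abs_def])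
qed

sublocale FL: smooth_flow B F \<phi>
  by unfold_locales (rule F_smooth, rule flow)

lemmas tangent_fields = SM.smooth_field_tangent[OF geodesic_smooth] SM.smooth_field_tangent[OF horizontal_smooth]
  SM.smooth_field_tangent[OF vertical_smooth] SM.smooth_field_tangent[OF F_smooth]

lemma bracket_F:
  assumes u: "u \<in> points B" and Y: "smooth_field B Y" and f: "smooth_near B f u"
  shows "lie_bracket B F Y u f = lie_bracket B X Y u f + lam u * lie_bracket B V Y u f - Y u lam * V u f"
proof -
  note T = SM.smooth_field_tangent[OF Y u]
  note lu = SM.smooth_fun_near[OF lam u]
  note Xf = SM.smooth_field_apply[OF geodesic_smooth u f] and Vf = SM.smooth_field_apply[OF vertical_smooth u f]
  have "Y u (\<lambda>q. F q f) = Y u (\<lambda>q. X q f + lam q * V q f)" by (simp add: thermostat_field_def)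
  also have "\<dots> = Y u (\<lambda>q. X q f) + (Y u lam * V u f + lam u * Y u (\<lambda>q. V q f))"
    by (simp only: SM.tangent_add[OF u Xf SM.smooth_near_mult[OF u lu Vf] T] SM.tangent_mult[OF u lu Vf T])
  finally show ?thesis
    using f by (simp add: lie_bracket_def thermostat_field_def algebra_simps)
qed

text \<open>The magnetic condition enters here: it removes the term \<open>- (V \<lambda>) V\<close>
  of \<open>bracket_F\<close>, leaving \<open>[X, V] = - H\<close>.\<close>

lemma bracket_F_V:
  assumes u: "u \<in> points B" shows "lie_bracket B F V u = (\<lambda>f. - H u f)"
proof
  fix f show "lie_bracket B F V u f = - H u f"
  proof (cases "smooth_near B f u")
    case True
    then show ?thesis
      using bracket_F[OF u vertical_smooth True] magnetic u bundle_points
      by (simp add: horizontal_field_def lie_bracket_def)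
  qed (simp add: horizontal_field_def lie_bracket_def)
qed

text \<open>\<open>[X, H] + \<lambda> [V, H] - (H \<lambda>) V\<close> equals
  \<open>K V - \<lambda> X - (H \<lambda>) V\<close>. Substituting
  \<open>X = F - \<lambda> V\<close> produces the square of \<lambda> and thereby
  \<open>kappa0\<close>.\<close>

lemma bracket_F_H:
  assumes u: "u \<in> points B" shows "lie_bracket B F H u = (\<lambda>f. kappa0 A g lam u * V u f + (- lam u) * F u f)"
proof
  fix f show "lie_bracket B F H u f = kappa0 A g lam u * V u f + (- lam u) * F u f"
  proof (cases "smooth_near B f u")
    case True
    show ?thesis
      unfolding bracket_F[OF u horizontal_smooth True] bracket_geodesic_horizontal[OF u]
        bracket_vertical_horizontal[OF u]
      by (simp add: kappa0_def thermostat_field_def power2_eq_square algebra_simps)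
  next
    case False
    then show ?thesis
      using SM.tangent_not_smooth[OF u tangent_fields(3)[OF u] False]
        SM.tangent_not_smooth[OF u tangent_fields(4)[OF u] False]
      by (simp add: lie_bracket_def)
  qed
qed

lemma cotangent_frame:
  assumes u: "u \<in> points B" and \<xi>: "\<xi> \<in> cotangent_space B u"
  shows "\<xi> (\<lambda>f. a * X u f + b * H u f + k * V u f) = a * \<xi> (X u) + b * \<xi> (H u) + k * \<xi> (V u)"
proof -
  note T = tangent_fields[OF u]
  have "\<xi> (\<lambda>f. 1 * (a * X u f + b * H u f) + k * V u f) = 1 * \<xi> (\<lambda>f. a * X u f + b * H u f) + k * \<xi> (V u)"
    by (rule SM.cotangent_combination[OF \<xi> SM.tangent_combination[OF u T(1,2)] T(3)])
  then show ?thesis using SM.cotangent_combination[OF \<xi> T(1,2), of a b] by simp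
qed

lemma covector_exists:
  assumes u: "u \<in> points B"
  obtains \<xi> where "\<xi> \<in> cotangent_space B u" "\<xi> (X u) = x" "\<xi> (H u) = y" "\<xi> (V u) = z"
proof -
  let ?c = "\<lambda>a b k f. a * X u f + b * H u f + k * V u f"
  note T = tangent_fields[OF u]
  have tan: "?c a b k \<in> tangent_space B u" for a b k
    using SM.tangent_combination[OF u SM.tangent_combination[OF u T(1,2), of a b] T(3), of 1 k] by simp
  have inj: "a = a' \<and> b = b' \<and> k = k'" if "?c a b k = ?c a' b' k'" for a b k a' b' k'
  proof -
    have "?c (a - a') (b - b') (k - k') = (\<lambda>f. 0)"
      using that by (auto simp: fun_eq_iff algebra_simps)
    from frame_independent[OF u this] show ?thesis by simp
  qed
  \<comment> \<open>Uniqueness of the frame coefficients makes the \<open>THE\<close> meaningful;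
    the value 0 elsewhere is required by \<open>cotangent_space\<close>.\<close>
  define \<xi> where "\<xi> v = (if v \<in> tangent_space B u then
    (THE s. \<exists>a b k. v = ?c a b k \<and> s = a * x + b * y + k * z) else 0)" for v
  have val: "\<xi> (?c a b k) = a * x + b * y + k * z" for a b k
    unfolding \<xi>_def if_P[OF tan] by (rule the_equality) (use inj in blast)+
  have "\<xi> \<in> cotangent_space B u"
    unfolding cotangent_space_def
  proof (intro CollectI conjI ballI allI impI)
    fix v w s t assume v: "v \<in> tangent_space B u" and w: "w \<in> tangent_space B u"
    obtain a b k where 1: "v = ?c a b k" using frame_spans[OF u v] .
    obtain a' b' k' where 2: "w = ?c a' b' k'" using frame_spans[OF u w] .
    have "(\<lambda>f. s * v f + t * w f) = ?c (s * a + t * a') (s * b + t * b') (s * k + t * k')"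
      unfolding 1 2 by (simp add: fun_eq_iff algebra_simps)
    then show "\<xi> (\<lambda>f. s * v f + t * w f) = s * \<xi> v + t * \<xi> w"
      unfolding 1 2 by (simp only: val) (simp add: algebra_simps)
  qed (simp add: \<xi>_def)
  moreover have "\<xi> (X u) = x" "\<xi> (H u) = y" "\<xi> (V u) = z"
    using val[of 1 0 0] val[of 0 1 0] val[of 0 0 1] by simp_all
  ultimately show thesis by (rule that)
qed

lemma covector_eqI:
  assumes u: "u \<in> points B" and "\<xi> \<in> cotangent_space B u" "\<eta> \<in> cotangent_space B u"
    and "\<xi> (X u) = \<eta> (X u)" "\<xi> (H u) = \<eta> (H u)" "\<xi> (V u) = \<eta> (V u)"
  shows "\<xi> = \<eta>"
proof
  fix v
  show "\<xi> v = \<eta> v"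
  proof (cases "v \<in> tangent_space B u")
    case True
    then obtain a b k where "v = (\<lambda>f. a * X u f + b * H u f + k * V u f)" using frame_spans[OF u] by blast
    then show ?thesis using cotangent_frame[OF u assms(2)] cotangent_frame[OF u assms(3)] assms(4-6) by simp
  next
    case False then show ?thesis using assms(2,3) by (simp add: cotangent_space_def)
  qed
qed

lemma beta_form:
  assumes u: "u \<in> points B"
  shows "beta_form A g u \<in> cotangent_space B u" "beta_form A g u (X u) = 0"
    "beta_form A g u (H u) = 1" "beta_form A g u (V u) = 0"
proof -
  obtain \<xi> where \<xi>: "\<xi> \<in> cotangent_space B u" "\<xi> (X u) = 0" "\<xi> (H u) = 1" "\<xi> (V u) = 0"
    using covector_exists[OF u] .
  have "beta_form A g u = \<xi>" unfolding beta_form_def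
  proof (rule the_equality)
    fix \<eta> assume "\<eta> \<in> cotangent_space B u \<and> \<eta> (X u) = 0 \<and> \<eta> (H u) = 1 \<and> \<eta> (V u) = 0"
    then show "\<eta> = \<xi>" by (intro covector_eqI[OF u _ \<xi>(1)]) (simp_all add: \<xi>)
  qed (simp add: \<xi>)
  then show "beta_form A g u \<in> cotangent_space B u" "beta_form A g u (X u) = 0"
    "beta_form A g u (H u) = 1" "beta_form A g u (V u) = 0" using \<xi> by auto
qed

lemma covector_F:
  assumes u: "u \<in> points B" and \<xi>: "\<xi> \<in> cotangent_space B u"
  shows "\<xi> (F u) = \<xi> (X u) + lam u * \<xi> (V u)"
  unfolding F_eq using SM.cotangent_combination[OF \<xi> tangent_fields(1,3)[OF u], of 1 "lam u"] by simp

text \<open>The image of \<open>Hstar\<close> at \<open>\<phi> T u\<close> in the cotangent space at \<open>u\<close>; the bundle \<open>green_stable\<close>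
  is its limit for \<open>T\<close> to plus infinity, \<open>green_unstable\<close> the one for \<open>T\<close> to minus infinity.\<close>

definition pulled_line where
  "pulled_line T u = inverse_transpose B (\<phi> (- T)) (\<phi> T u) ` Hstar A g (\<phi> T u)"

text \<open>The differentials of \<open>\<phi> T\<close> and \<open>\<phi> (- T)\<close> are
  mutually inverse, so \<open>inverse_transpose\<close> along the latter is composition with the
  former. On pulled-back fields \<open>\<eta>\<close> thus has the values of
  \<open>beta_form\<close> at \<open>\<phi> T u\<close>, which determine it.\<close>

lemma pulled_beta:
  fixes T :: real
  assumes u: "u \<in> points B"
  defines "\<eta> \<equiv> inverse_transpose B (\<phi> (- T)) (\<phi> T u) (beta_form A g (\<phi> T u))"
  shows "pulled_line T u = line_of \<eta>" "\<eta> \<in> cotangent_space B u"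
    "\<And>Y. smooth_field B Y \<Longrightarrow> \<eta> (FL.pull_back Y T u) = beta_form A g (\<phi> T u) (Y (\<phi> T u))"
proof -
  let ?\<beta> = "beta_form A g (\<phi> T u)" and ?d = "differential B B (\<phi> T) u"
  have uT: "\<phi> T u \<in> points B" by (rule FL.flow_points[OF u])
  note \<beta> = beta_form(1)[OF uT]
  have \<eta>: "inverse_transpose B (\<phi> (- T)) (\<phi> T u) \<zeta> = (\<lambda>w. if w \<in> tangent_space B u then \<zeta> (?d w) else 0)" for \<zeta>
  proof
    fix w
    have "inv_into (tangent_space B (\<phi> T u)) (differential B B (\<phi> (- T)) (\<phi> T u)) w = ?d w"
      if w: "w \<in> tangent_space B u"
    proof (rule inv_into_f_eq)
      show "inj_on (differential B B (\<phi> (- T)) (\<phi> T u)) (tangent_space B (\<phi> T u))"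
        by (rule inj_on_inverseI[of _ ?d])
          (use FL.differential_flow_inverse[OF uT, of _ "- T"] FL.flow_inverse(1)[OF u] in simp)
      show "?d w \<in> tangent_space B (\<phi> T u)" by (rule SM.differential_tangent[OF FL.flow_map_smooth u w])
      show "differential B B (\<phi> (- T)) (\<phi> T u) (?d w) = w" by (rule FL.differential_flow_inverse[OF u w])
    qed
    then show "inverse_transpose B (\<phi> (- T)) (\<phi> T u) \<zeta> w = (if w \<in> tangent_space B u then \<zeta> (?d w) else 0)"
      by (simp add: inverse_transpose_def FL.flow_inverse(1)[OF u])
  qed
  have "inverse_transpose B (\<phi> (- T)) (\<phi> T u) (\<lambda>w. c * ?\<beta> w) = (\<lambda>w. c * \<eta> w)" for c
    unfolding \<eta>_def \<eta> by auto
  then show "pulled_line T u = line_of \<eta>"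
    unfolding pulled_line_def Hstar_def line_of_def image_image by simp
  show "\<eta> \<in> cotangent_space B u"
    unfolding cotangent_space_def
  proof (intro CollectI conjI ballI allI impI)
    fix v w a b assume v: "v \<in> tangent_space B u" and w: "w \<in> tangent_space B u"
    show "\<eta> (\<lambda>f. a * v f + b * w f) = a * \<eta> v + b * \<eta> w"
      unfolding \<eta>_def \<eta> using v w SM.tangent_combination[OF u v w, of a b]
        SM.cotangent_combination[OF \<beta> SM.differential_tangent[OF FL.flow_map_smooth u v]
          SM.differential_tangent[OF FL.flow_map_smooth u w], of a b]
      by (simp add: SM.differential_combination)
  qed (simp add: \<eta>_def \<eta>)
  show "\<eta> (FL.pull_back Y T u) = ?\<beta> (Y (\<phi> T u))" if Y: "smooth_field B Y" for Y
    unfolding \<eta>_def \<eta> using FL.pull_back_tangent[OF Y u] FL.differential_pull_back[OF Y u] by simp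
qed

lemma pulled_line_jacobi:
  assumes u: "u \<in> points B"
  obtains \<theta>2 \<theta>3 A' A1 S S1 where
    "\<theta>2 \<in> cotangent_space B u" "\<theta>3 \<in> cotangent_space B u"
    "\<theta>2 (H u) = 1" "\<theta>2 (V u) = 0" "\<theta>3 (H u) = 0" "\<theta>3 (V u) = 1"
    "\<And>t. (A' has_real_derivative A1 t) (at t)"
    "\<And>t. (A1 has_real_derivative - kappa0 A g lam (\<phi> t u) * A' t) (at t)"
    "\<And>t. (S has_real_derivative S1 t) (at t)"
    "\<And>t. (S1 has_real_derivative - kappa0 A g lam (\<phi> t u) * S t) (at t)"
    "A' 0 = 1" "A1 0 = 0" "S 0 = 0" "S1 0 = (1::real)"
    "\<And>T. pulled_line T u = line_of (\<lambda>w. A' T * \<theta>2 w + S T * \<theta>3 w)"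
proof -
  obtain \<theta>2 where t2: "\<theta>2 \<in> cotangent_space B u" "\<theta>2 (X u) = 0" "\<theta>2 (H u) = 1" "\<theta>2 (V u) = 0"
    using covector_exists[OF u] .
  \<comment> \<open>The value on \<open>X u\<close> is forced by the requirement that
    \<open>\<theta>3\<close> annihilate \<open>F u\<close>.\<close>
  obtain \<theta>3 where t3: "\<theta>3 \<in> cotangent_space B u" "\<theta>3 (X u) = - lam u" "\<theta>3 (H u) = 0" "\<theta>3 (V u) = 1"
    using covector_exists[OF u] .
  have F0: "\<theta>2 (F u) = 0" "\<theta>3 (F u) = 0" using covector_F[OF u t2(1)] covector_F[OF u t3(1)] t2 t3 by auto
  let ?E = "\<lambda>Y t. FL.pull_back Y t u"
  let ?k = "\<lambda>t. kappa0 A g lam (\<phi> t u)"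
  note EV = FL.pull_back_tangent[OF vertical_smooth u] and EH = FL.pull_back_tangent[OF horizontal_smooth u]
  have dV: "((\<lambda>t. \<xi> (?E V t)) has_real_derivative - \<xi> (?E H t)) (at t)"
    if \<xi>: "\<xi> \<in> cotangent_space B u" for \<xi> t
  proof -
    have e: "FL.pull_back (lie_bracket B F V) t u = (\<lambda>f. (-1) * ?E H t f + 0 * ?E H t f)"
      unfolding FL.pull_back_def bracket_F_V[OF FL.flow_points[OF u]]
      by (subst SM.differential_combination[symmetric]) simp
    have "((\<lambda>t. \<xi> (?E V t)) has_real_derivative \<xi> (FL.pull_back (lie_bracket B F V) t u)) (at t)"
      by (rule SM.cotangent_derivative[OF u \<xi> EV _ FL.pull_back_derivative[OF vertical_smooth u]])
        (unfold e, rule SM.tangent_combination[OF u EH EH])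
    then show ?thesis unfolding e SM.cotangent_combination[OF \<xi> EH EH] by simp
  qed
  \<comment> \<open>Here \<open>\<xi> (F u) = 0\<close> is essential: it discards the
    \<open>F\<close> component of \<open>[F, H]\<close>, so that the system closes.\<close>
  have dH: "((\<lambda>t. \<xi> (?E H t)) has_real_derivative ?k t * \<xi> (?E V t)) (at t)"
    if \<xi>: "\<xi> \<in> cotangent_space B u" "\<xi> (F u) = 0" for \<xi> t
  proof -
    have e: "FL.pull_back (lie_bracket B F H) t u = (\<lambda>f. ?k t * ?E V t f + (- lam (\<phi> t u)) * F u f)"
      unfolding FL.pull_back_self[OF u, of t, symmetric]
      unfolding FL.pull_back_def bracket_F_H[OF FL.flow_points[OF u]]
      by (rule SM.differential_combination)
    have "((\<lambda>t. \<xi> (?E H t)) has_real_derivative \<xi> (FL.pull_back (lie_bracket B F H) t u)) (at t)"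
      by (rule SM.cotangent_derivative[OF u \<xi>(1) EH _ FL.pull_back_derivative[OF horizontal_smooth u]])
        (unfold e, rule SM.tangent_combination[OF u EV tangent_fields(4)[OF u]])
    then show ?thesis unfolding e SM.cotangent_combination[OF \<xi>(1) EV tangent_fields(4)[OF u]] \<xi>(2) by simp
  qed
  \<comment> \<open>The signs are chosen so that \<open>A'\<close> and \<open>S\<close> have the
    initial data (1, 0) and (0, 1).\<close>
  define A' where "A' t = \<theta>3 (?E V t)" for t
  define A1 where "A1 t = - \<theta>3 (?E H t)" for t
  define S where "S t = - \<theta>2 (?E V t)" for t
  define S1 where "S1 t = \<theta>2 (?E H t)" for t
  have dA: "(A' has_real_derivative A1 t) (at t)" "(A1 has_real_derivative - ?k t * A' t) (at t)"
    and dS: "(S has_real_derivative S1 t) (at t)" "(S1 has_real_derivative - ?k t * S t) (at t)" for t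
    using dV[OF t3(1), of t] DERIV_minus[OF dH[OF t3(1) F0(2), of t]]
      DERIV_minus[OF dV[OF t2(1), of t]] dH[OF t2(1) F0(1), of t]
    by (simp_all add: A'_def[abs_def] A1_def[abs_def] S_def[abs_def] S1_def[abs_def])
  have init: "A' 0 = 1" "A1 0 = 0" "S 0 = 0" "S1 0 = 1"
    unfolding A'_def A1_def S_def S1_def FL.pull_back_zero[OF vertical_smooth u]
      FL.pull_back_zero[OF horizontal_smooth u] using t2 t3 by simp_all
  note W = jacobi_wronskian[OF dA dS init]
  have line: "pulled_line T u = line_of (\<lambda>w. A' T * \<theta>2 w + S T * \<theta>3 w)" for T
  proof -
    define \<eta> where "\<eta> = inverse_transpose B (\<phi> (- T)) (\<phi> T u) (beta_form A g (\<phi> T u))"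
    note \<eta> = pulled_beta[OF u, where T = T, folded \<eta>_def]
    have uT: "\<phi> T u \<in> points B" by (rule FL.flow_points[OF u])
    note b = beta_form[OF uT]
    have \<eta>F: "\<eta> (F u) = 0"
      using \<eta>(3)[OF F_smooth] covector_F[OF uT b(1)] b FL.pull_back_self[OF u] by simp
    have co: "(\<lambda>w. a * \<theta>2 w + b * \<theta>3 w) \<in> cotangent_space B u" for a b
      using t2(1) t3(1) unfolding cotangent_space_def by (auto simp: algebra_simps)
    \<comment> \<open>The covectors annihilating \<open>F u\<close> form a plane, in which
      \<open>\<theta>2\<close>, \<open>\<theta>3\<close> are dual to \<open>H u\<close> and
      \<open>V u\<close>.\<close>
    have rep: "\<eta> = (\<lambda>w. \<eta> (H u) * \<theta>2 w + \<eta> (V u) * \<theta>3 w)"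
      by (rule covector_eqI[OF u \<eta>(2) co])
        (use t2 t3 \<eta>F covector_F[OF u \<eta>(2)] in \<open>auto simp: algebra_simps\<close>)
    have 0: "\<eta> (?E V T) = 0" "\<eta> (?E H T) = 1"
      using \<eta>(3)[OF vertical_smooth] \<eta>(3)[OF horizontal_smooth] b by auto
    have 1: "\<eta> (H u) * S T = \<eta> (V u) * A' T" "\<eta> (H u) * S1 T - \<eta> (V u) * A1 T = 1"
      using 0 fun_cong[OF rep, of "?E V T"] fun_cong[OF rep, of "?E H T"]
      by (simp_all add: A'_def A1_def S_def S1_def)
    \<comment> \<open>Cramer's rule for the two equations; the determinant is the Wronskian, which
      is 1.\<close>
    have "\<eta> (H u) = A' T" "\<eta> (V u) = S T" using 1 W[of T] by algebra+
    then have "\<eta> = (\<lambda>w. A' T * \<theta>2 w + S T * \<theta>3 w)" using rep by simp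
    then show ?thesis using \<eta>(1) by simp
  qed
  show thesis
    by (rule that[OF t2(1) t3(1) t2(3,4) t3(3,4) dA dS init line])
qed

lemma green_bundles:
  assumes u: "u \<in> points B" and k: "\<And>t. kappa0 A g lam (\<phi> t u) \<le> 0"
  shows "kappa0 A g lam u \<noteq> 0 \<Longrightarrow> green_stable A g \<phi> u \<noteq> green_unstable A g \<phi> u"
    "(\<And>t. kappa0 A g lam (\<phi> t u) = 0) \<Longrightarrow> green_stable A g \<phi> u = green_unstable A g \<phi> u"
proof -
  obtain \<theta>2 \<theta>3 A' A1 S S1 where t:
    "\<theta>2 \<in> cotangent_space B u" "\<theta>3 \<in> cotangent_space B u"
    "\<theta>2 (H u) = 1" "\<theta>2 (V u) = 0" "\<theta>3 (H u) = 0" "\<theta>3 (V u) = 1"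
    and d: "\<And>t. (A' has_real_derivative A1 t) (at t)"
    "\<And>t. (A1 has_real_derivative - kappa0 A g lam (\<phi> t u) * A' t) (at t)"
    "\<And>t. (S has_real_derivative S1 t) (at t)"
    "\<And>t. (S1 has_real_derivative - kappa0 A g lam (\<phi> t u) * S t) (at t)"
    and init: "A' 0 = 1" "A1 0 = 0" "S 0 = 0" "S1 0 = (1::real)"
    and line: "\<And>T. pulled_line T u = line_of (\<lambda>w. A' T * \<theta>2 w + S T * \<theta>3 w)"
    by (rule pulled_line_jacobi[OF u]) (rule that)
  have q: "- kappa0 A g lam (\<phi> t u) \<ge> 0" for t using k by simp
  have q0: "- kappa0 A g lam (\<phi> 0 u) > 0 \<longleftrightarrow> kappa0 A g lam u \<noteq> 0"
    using k[of 0] FL.flow_zero[OF u] by auto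
  obtain r where r: "((\<lambda>t. A' t / S t) \<longlongrightarrow> r) at_top" "r \<ge> 0"
    "- kappa0 A g lam (\<phi> 0 u) > 0 \<longrightarrow> r > 0" "\<And>t. t > 0 \<Longrightarrow> S t > 0"
    "(\<forall>t. - kappa0 A g lam (\<phi> t u) = 0) \<longrightarrow> r = 0"
    by (rule jacobi_ratio_limit[OF d init q]) (rule that)
  have m: "(h has_real_derivative h') (at (- t)) \<Longrightarrow> ((\<lambda>t. h (- t)) has_real_derivative - h') (at t)"
    for h h' and t :: real
    using DERIV_mirror[of h h' t] by simp
  \<comment> \<open>Reversing time preserves the Jacobi equation but flips first derivatives.
    Negating \<open>S\<close> restores its initial slope 1, so the same limit lemma applies to the
    past.\<close>
  have d1: "((\<lambda>t. A' (- t)) has_real_derivative - A1 (- t)) (at t)"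
    "((\<lambda>t. - A1 (- t)) has_real_derivative - kappa0 A g lam (\<phi> (- t) u) * A' (- t)) (at t)"
    "((\<lambda>t. - S (- t)) has_real_derivative S1 (- t)) (at t)"
    "((\<lambda>t. S1 (- t)) has_real_derivative - kappa0 A g lam (\<phi> (- t) u) * - S (- t)) (at t)" for t
    using m[OF d(1), of t] DERIV_minus[OF m[OF d(2), of t]] DERIV_minus[OF m[OF d(3), of t]] m[OF d(4), of t]
    by simp_all
  have i1: "A' (- 0) = 1" "- A1 (- 0) = 0" "- S (- 0) = 0" "S1 (- 0) = 1" using init by simp_all
  obtain s where s: "((\<lambda>t. A' (- t) / - S (- t)) \<longlongrightarrow> s) at_top" "s \<ge> 0"
    "\<And>t. t > 0 \<Longrightarrow> - S (- t) > 0" "(\<forall>t. - kappa0 A g lam (\<phi> (- t) u) = 0) \<longrightarrow> s = 0"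
    by (rule jacobi_ratio_limit[OF d1 i1 q]) (rule that)
  \<comment> \<open>Dividing by \<open>S\<close> normalises the coefficient of
    \<open>\<theta>3\<close> to 1, so the limit covector is nonzero. The reparametrization
    \<open>\<tau>\<close> is the identity for the stable and the reversal for the unstable
    bundle.\<close>
  have lim: "lines_tendsto (\<lambda>t. pulled_line (\<tau> t) u) (line_of (\<lambda>w. c * \<theta>2 w + \<theta>3 w)) at_top"
    if c: "((\<lambda>t. A' (\<tau> t) / S (\<tau> t)) \<longlongrightarrow> c) at_top" and nz: "\<And>t. t > 0 \<Longrightarrow> S (\<tau> t) \<noteq> 0" for \<tau> :: "real \<Rightarrow> real" and c
    unfolding lines_tendsto_def
  proof (intro exI conjI allI)
    show "\<forall>\<^sub>F t in at_top. pulled_line (\<tau> t) u = line_of (\<lambda>w. A' (\<tau> t) / S (\<tau> t) * \<theta>2 w + \<theta>3 w)"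
      using eventually_gt_at_top[of 0]
    proof eventually_elim
      case (elim t)
      have "(\<lambda>w. A' (\<tau> t) * \<theta>2 w + S (\<tau> t) * \<theta>3 w) = (\<lambda>w. S (\<tau> t) * (A' (\<tau> t) / S (\<tau> t) * \<theta>2 w + \<theta>3 w))"
        using nz[OF elim] by (auto simp: field_simps)
      then show ?case unfolding line using line_of_scale[OF nz[OF elim]] by simp
    qed
    show "((\<lambda>t. A' (\<tau> t) / S (\<tau> t) * \<theta>2 w + \<theta>3 w) \<longlongrightarrow> c * \<theta>2 w + \<theta>3 w) at_top" for w
      by (intro tendsto_intros c)
    show "(\<lambda>w. c * \<theta>2 w + \<theta>3 w) \<noteq> (\<lambda>w. 0)" using t by (auto dest: fun_cong[of _ _ "V u"])
  qed simp
  have the: "(THE l. lines_tendsto L l at_top) = l" if "lines_tendsto L l at_top" for L :: "real \<Rightarrow> _" and l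
  proof (rule the_equality)
    fix l' assume "lines_tendsto L l' at_top"
    then show "l' = l" by (rule lines_tendsto_unique[OF _ that]) simp
  qed (rule that)
  have st: "green_stable A g \<phi> u = line_of (\<lambda>w. r * \<theta>2 w + \<theta>3 w)"
    unfolding green_stable_def
    by (rule the) (use lim[of "\<lambda>t. t", OF r(1)] r(4) in \<open>force simp: pulled_line_def\<close>)
  have un: "green_unstable A g \<phi> u = line_of (\<lambda>w. - s * \<theta>2 w + \<theta>3 w)"
  proof -
    have "((\<lambda>t. A' (- t) / S (- t)) \<longlongrightarrow> - s) at_top" using tendsto_minus[OF s(1)] by simp
    from lim[of "\<lambda>t. - t", OF this] s(3)
    have "lines_tendsto (\<lambda>t. pulled_line (- t) u) (line_of (\<lambda>w. - s * \<theta>2 w + \<theta>3 w)) at_top" by force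
    then show ?thesis unfolding green_unstable_def by (intro the) (simp add: pulled_line_def)
  qed
  show "green_stable A g \<phi> u \<noteq> green_unstable A g \<phi> u" if "kappa0 A g lam u \<noteq> 0"
  proof
    assume "green_stable A g \<phi> u = green_unstable A g \<phi> u"
    then have eq: "line_of (\<lambda>w. r * \<theta>2 w + \<theta>3 w) = line_of (\<lambda>w. - s * \<theta>2 w + \<theta>3 w)"
      unfolding st un .
    have "(\<lambda>w. r * \<theta>2 w + \<theta>3 w) \<in> line_of (\<lambda>w. r * \<theta>2 w + \<theta>3 w)"
      unfolding line_of_def by (rule range_eqI[of _ _ 1]) simp
    then have "(\<lambda>w. r * \<theta>2 w + \<theta>3 w) \<in> line_of (\<lambda>w. - s * \<theta>2 w + \<theta>3 w)"
      unfolding eq .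
    then obtain c where c: "(\<lambda>w. r * \<theta>2 w + \<theta>3 w) = (\<lambda>w. c * (- s * \<theta>2 w + \<theta>3 w))"
      unfolding line_of_def by auto
    \<comment> \<open>Evaluation at \<open>V u\<close> compares the coefficients of
      \<open>\<theta>3\<close>, and evaluation at \<open>H u\<close> those of
      \<open>\<theta>2\<close>. The result \<open>r = - s\<close> contradicts r > 0 and s \<ge>
      0.\<close>
    have "c = 1" using fun_cong[OF c, of "V u"] t by simp
    then have "r = - s" using fun_cong[OF c, of "H u"] t by simp
    then show False using r(2,3) s(2) q0 that by simp
  qed
  show "green_stable A g \<phi> u = green_unstable A g \<phi> u" if "\<And>t. kappa0 A g lam (\<phi> t u) = 0"
    using r(5) s(4) that unfolding st un by simp
qed

end

theorem corollary1p10: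
  fixes A :: "'m surface" and g :: "'m metric"
    and lam :: "'m \<times> 'm tvec \<Rightarrow> real"
    and \<phi> :: "real \<Rightarrow> 'm \<times> 'm tvec \<Rightarrow> 'm \<times> 'm tvec"
  assumes "magnetic_system A g lam"
    and "thermostat_flow A g lam \<phi>"
    and "\<forall>u\<in>unit_bundle A g. kappa0 A g lam u \<le> 0"
  shows "(\<forall>u\<in>unit_bundle A g. kappa0 A g lam u = 0) \<longleftrightarrow>
         (\<forall>u\<in>unit_bundle A g. green_stable A g \<phi> u = green_unstable A g \<phi> u)"
proof -
  interpret magnetic_flow A g lam \<phi>
    by unfold_locales (use assms(1,2) in \<open>auto simp: magnetic_system_def thermostat_def
      closed_oriented_surface_def thermostat_flow_def\<close>)
  \<comment> \<open>Orbits stay in the unit bundle, so the pointwise conditions on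
    \<open>kappa0\<close> hold along each of them.\<close>
  have "\<phi> t u \<in> unit_bundle A g" if "u \<in> unit_bundle A g" for t u
    using FL.flow_points that by (simp add: bundle_points)
  then show ?thesis
    using green_bundles assms(3) by (metis bundle_points)
qed

end
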